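(* Let $G$ be a planar cyclically $4$-connected cubic graph with $n \geq 8$ vertices, $n$ even, such that $G \not\cong Q_n$. Then $G$ is (isomorphic to a graph) obtained from $Q_{2k}$, for some $k \geq 4$, by a sequence of bridgings, each of which bridges a pair of edges with cycle spread at least $(1,2)$ in the current graph.
   Context: Graphs are finite and simple. A cubic graph is one in which every vertex has degree $3$. An edge-cut is a set of edges whose removal disconnects the graph; it is cycle-separating if at least two components of the resulting graph contain cycles. A $3$-connected cubic graph is cyclically $4$-connected if it has at least $8$ vertices and has no cycle-separating edge-cut of size less than $4$. Bridging: given two distinct edges $ab$ and $cd$ of a graph, subdivide $ab$ by a new vertex $x$ (replacing $ab$ by the path $a x b$) and $cd$ by a new vertex $y$ (replacing $cd$ by $c y d$), and add the edge $xy$. Cycle spread: let $ab$ and $cd$ be two edges of a $2$-connected graph and let $C$ be a smallest cycle containing both. Removing the two edges from $C$ leaves two paths joining them; labelling so that these paths join $a$ to $c$ and $b$ to $d$ and the $a$–$c$ path is no longer than the $b$–$d$ path, the cycle spread of $ab, cd$ is the pair $(i,j)$, $i \le j$, of the lengths of these two paths. Pairs are compared lexicographically. Thus two edges have cycle spread at least $(1,2)$ exactly when they are non-adjacent (share no end vertex) and there is no $4$-cycle containing both of them. For $m \ge 4$, $Q_{2m}$ (the ladder) is the graph on $2m$ vertices consisting of two $m$-cycles $u_1\cdots u_m u_1$ and $v_1\cdots v_m v_1$ together with the edges $u_iv_i$, $1\le i\le m$; $Q_n$ denotes this graph with $n=2m$ vertices. *)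

theory Defs
  imports "HOL-Analysis.Analysis"
begin

datatype 'a ugraph = UGraph (verts: "'a set") (edges: "'a set set")

definition simple_graph :: "'a ugraph \<Rightarrow> bool" where
  "simple_graph G \<longleftrightarrow> finite (verts G) \<and> (\<forall>e\<in>edges G. e \<subseteq> verts G \<and> card e = 2)"

definition graph_iso :: "'a ugraph \<Rightarrow> 'b ugraph \<Rightarrow> bool" (infix "\<cong>\<^sub>G" 50) where
  "G \<cong>\<^sub>G H \<longleftrightarrow> (\<exists>\<phi>. bij_betw \<phi> (verts G) (verts H) \<and> edges H = (\<lambda>e. \<phi> ` e) ` edges G)"

definition cubic :: "'a ugraph \<Rightarrow> bool" where
  "cubic G \<longleftrightarrow> (\<forall>v\<in>verts G. card {e \<in> edges G. v \<in> e} = 3)"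

definition del_edges :: "'a ugraph \<Rightarrow> 'a set set \<Rightarrow> 'a ugraph" where
  "del_edges G F = UGraph (verts G) (edges G - F)"

definition del_verts :: "'a ugraph \<Rightarrow> 'a set \<Rightarrow> 'a ugraph" where
  "del_verts G S = UGraph (verts G - S) {e \<in> edges G. e \<inter> S = {}}"

definition reach :: "'a ugraph \<Rightarrow> 'a \<Rightarrow> 'a \<Rightarrow> bool" where
  "reach G = (\<lambda>u v. {u, v} \<in> edges G)\<^sup>*\<^sup>*"

definition graph_connected :: "'a ugraph \<Rightarrow> bool" where
  "graph_connected G \<longleftrightarrow> verts G \<noteq> {} \<and> (\<forall>u\<in>verts G. \<forall>v\<in>verts G. reach G u v)"

definition graph_components :: "'a ugraph \<Rightarrow> 'a set set" where
  "graph_components G = {{v \<in> verts G. reach G u v} | u. u \<in> verts G}"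

definition k_connected :: "nat \<Rightarrow> 'a ugraph \<Rightarrow> bool" where
  "k_connected k G \<longleftrightarrow> k < card (verts G) \<and>
     (\<forall>S. S \<subseteq> verts G \<and> card S < k \<longrightarrow> graph_connected (del_verts G S))"

text \<open>A cycle is given by the list of its vertices in cyclic order, so its length is the
  length of the list.\<close>

definition cycle_edges :: "'a list \<Rightarrow> 'a set set" where
  "cycle_edges vs = {{vs ! i, vs ! (Suc i mod length vs)} | i. i < length vs}"

definition is_cycle :: "'a ugraph \<Rightarrow> 'a list \<Rightarrow> bool" where
  "is_cycle G vs \<longleftrightarrow>
     3 \<le> length vs \<and> distinct vs \<and> set vs \<subseteq> verts G \<and> cycle_edges vs \<subseteq> edges G"

definition edge_cut :: "'a ugraph \<Rightarrow> 'a set set \<Rightarrow> bool" where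
  "edge_cut G F \<longleftrightarrow> F \<subseteq> edges G \<and> \<not> graph_connected (del_edges G F)"

definition cycle_separating :: "'a ugraph \<Rightarrow> 'a set set \<Rightarrow> bool" where
  "cycle_separating G F \<longleftrightarrow>
     (\<exists>C\<in>graph_components (del_edges G F). \<exists>D\<in>graph_components (del_edges G F). C \<noteq> D \<and>
        (\<exists>vs. is_cycle (del_edges G F) vs \<and> set vs \<subseteq> C) \<and>
        (\<exists>vs. is_cycle (del_edges G F) vs \<and> set vs \<subseteq> D))"

definition cyclically_4_connected :: "'a ugraph \<Rightarrow> bool" where
  "cyclically_4_connected G \<longleftrightarrow>
     k_connected 3 G \<and> cubic G \<and> 8 \<le> card (verts G) \<and>
     \<not> (\<exists>F. edge_cut G F \<and> cycle_separating G F \<and> card F < 4)"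

text \<open>A drawing in the plane: vertices are distinct points, edges are arcs joining their end
  vertices, an arc passes through no vertex other than its ends, and two distinct arcs meet
  only in common end vertices.\<close>

definition planar :: "'a ugraph \<Rightarrow> bool" where
  "planar G \<longleftrightarrow>
     (\<exists>(p :: 'a \<Rightarrow> complex) (\<gamma> :: 'a set \<Rightarrow> real \<Rightarrow> complex).
        inj_on p (verts G) \<and>
        (\<forall>e\<in>edges G. arc (\<gamma> e) \<and> {pathstart (\<gamma> e), pathfinish (\<gamma> e)} = p ` e) \<and>
        (\<forall>e\<in>edges G. \<forall>v\<in>verts G. p v \<in> path_image (\<gamma> e) \<longrightarrow> v \<in> e) \<and>
        (\<forall>e\<in>edges G. \<forall>f\<in>edges G. e \<noteq> f \<longrightarrow>
            path_image (\<gamma> e) \<inter> path_image (\<gamma> f) \<subseteq> p ` (e \<inter> f)))"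

definition smallest_cycle_through :: "'a ugraph \<Rightarrow> 'a set \<Rightarrow> 'a set \<Rightarrow> 'a list \<Rightarrow> bool" where
  "smallest_cycle_through G e f vs \<longleftrightarrow>
     is_cycle G vs \<and> e \<in> cycle_edges vs \<and> f \<in> cycle_edges vs \<and>
     (\<forall>ws. is_cycle G ws \<and> e \<in> cycle_edges ws \<and> f \<in> cycle_edges ws \<longrightarrow> length vs \<le> length ws)"

text \<open>The smallest cycle is written as \<open>P @ R\<close>, where \<open>P\<close> lists the vertices of the path from
  \<open>a\<close> to \<open>c\<close> and \<open>R\<close> those of the path from \<open>d\<close> to \<open>b\<close>; the two edges are then the ones where
  the lists meet. A path has one edge less than it has vertices. This is a relation because
  different smallest cycles through the two edges may yield different pairs.\<close>

definition is_cycle_spread :: "'a ugraph \<Rightarrow> 'a set \<Rightarrow> 'a set \<Rightarrow> nat \<times> nat \<Rightarrow> bool" where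
  "is_cycle_spread G e f s \<longleftrightarrow>
     (\<exists>P R. P \<noteq> [] \<and> R \<noteq> [] \<and> smallest_cycle_through G e f (P @ R) \<and>
        e = {hd P, last R} \<and> f = {last P, hd R} \<and>
        s = (length P - 1, length R - 1) \<and> length P \<le> length R)"

text \<open>\<^const>\<open>pair_leq\<close> is the reflexive lexicographic order on pairs of naturals. The first
  conjunct, automatic for distinct edges of a 2-connected graph, says that the cycle spread
  exists.\<close>

definition cycle_spread_at_least :: "'a ugraph \<Rightarrow> 'a set \<Rightarrow> 'a set \<Rightarrow> nat \<times> nat \<Rightarrow> bool" where
  "cycle_spread_at_least G e f t \<longleftrightarrow>
     (\<exists>s. is_cycle_spread G e f s) \<and> (\<forall>s. is_cycle_spread G e f s \<longrightarrow> (t, s) \<in> pair_leq)"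

definition bridging :: "'a ugraph \<Rightarrow> 'a \<Rightarrow> 'a \<Rightarrow> 'a \<Rightarrow> 'a \<Rightarrow> 'a \<Rightarrow> 'a \<Rightarrow> 'a ugraph" where
  "bridging G a b c d x y =
     UGraph (verts G \<union> {x, y})
       ((edges G - {{a, b}, {c, d}}) \<union> {{a, x}, {x, b}, {c, y}, {y, d}, {x, y}})"

definition bridging_step :: "'a ugraph \<Rightarrow> 'a ugraph \<Rightarrow> bool" where
  "bridging_step G H \<longleftrightarrow>
     (\<exists>a b c d x y. {a, b} \<in> edges G \<and> {c, d} \<in> edges G \<and> {a, b} \<noteq> {c, d} \<and>
        cycle_spread_at_least G {a, b} {c, d} (1, 2) \<and>
        x \<notin> verts G \<and> y \<notin> verts G \<and> x \<noteq> y \<and>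
        H = bridging G a b c d x y)"

text \<open>The ladder on \<open>n = 2m\<close> vertices, meaningful for even \<open>n \<ge> 8\<close>: the vertices
  \<open>u\<^sub>1, \<dots>, u\<^sub>m\<close> are \<open>0, \<dots>, m - 1\<close>, and \<open>v\<^sub>1, \<dots>, v\<^sub>m\<close> are \<open>m, \<dots>, 2m - 1\<close>.\<close>

definition ladder :: "nat \<Rightarrow> nat ugraph" where
  "ladder n = (let m = n div 2 in
     UGraph {..<2 * m}
       ({{i, Suc i mod m} | i. i < m} \<union>
        {{m + i, m + Suc i mod m} | i. i < m} \<union>
        {{i, m + i} | i. i < m}))"

end

theory Submission
  imports Defs
begin

text \<open>Removing an edge \<open>xy\<close> from a cyclically 4-connected cubic graph and suppressing its ends is the
  inverse of a bridging. The result is again cyclically 4-connected unless \<open>xy\<close> lies in a 4-edge-cut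
  both of whose sides have at least four vertices, and the bridged pair has cycle spread at least
  \<open>(1, 2)\<close> unless \<open>xy\<close> is shared by two 4-cycles that form a domino with \<open>xy\<close> in the middle. Call
  \<open>xy\<close> good if neither obstruction occurs.

  Without 4-cycles, a good edge is found inside a smallest side of a 4-edge-cut. If there is a 4-cycle
  but no good edge, then uncrossing two 4-edge-cuts shows that every 4-cycle is continued by further
  4-cycles on two opposite sides; following these continuations until they close up, the graph is a
  ladder or a Moebius ladder. In a Moebius ladder, as in \<open>K\<^sub>3\<^sub>,\<^sub>3\<close>, a Hamiltonian cycle has three
  pairwise crossing chords, two of which would lie on the same side of the Jordan curve formed by the
  cycle, so planarity excludes it.\<close>

section \<open>Edge cuts in cubic graphs\<close>

text \<open>Every connectivity argument double counts \<open>cut_size\<close> on vertex sets: two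
  crossing sets divide the vertices into corners, the cuts of the corners are expressed by the cuts
  of the two sets, and the parity of \<open>cut_size\<close> settles the borderline cases. The
  counting is done for a bare adjacency relation because two graphs on one vertex type are compared,
  the given one and the one with an edge removed and its ends suppressed.

  The obstacle is the bottom of the induction. Suppression in an eight-vertex graph leads to six
  vertices, where K_{3,3} still satisfies the cut condition although the lemmas on squares fail for
  it, since opposite corners share outer neighbours there. Hence there are two locales, with at
  least six and at least eight vertices, and planarity, which suppression preserves, rules out the
  six-vertex outcome.

  The ladders live on the naturals while \<open>G\<close> has an arbitrary vertex type, so the
  generating sequence is built on the naturals and an isomorphism is carried along.\<close>

locale cubic_adj =
  fixes V :: "'a set" and adj :: "'a \<Rightarrow> 'a \<Rightarrow> bool"
  assumes finV: "finite V"
    and adj_sym: "adj u v \<Longrightarrow> adj v u"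
    and adj_irrefl: "\<not> adj u u"
    and adj_V: "adj u v \<Longrightarrow> u \<in> V"
    and deg3: "v \<in> V \<Longrightarrow> card {w. adj v w} = 3"
begin

text \<open>Ordered pairs are counted: for disjoint arguments this is the number of edges between
  them, while \<open>links X X\<close> is twice the number of inner edges, as the degree sum
  \<open>3 * card X\<close> requires.\<close>

definition links :: "'a set \<Rightarrow> 'a set \<Rightarrow> nat" where
  "links X Y = (\<Sum>x\<in>X. \<Sum>y\<in>Y. of_bool (adj x y))"

definition cut_size :: "'a set \<Rightarrow> nat" where
  "cut_size X = links X (V - X)"

lemma adj_V2: "adj u v \<Longrightarrow> v \<in> V"
  using adj_V adj_sym by blast

lemma adj_neq: "adj u v \<Longrightarrow> u \<noteq> v"
  using adj_irrefl by blast

lemma fin: "X \<subseteq> V \<Longrightarrow> finite X"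
  using finV finite_subset by blast

lemma links_sym: "links X Y = links Y X"
proof -
  have "adj x y = adj y x" for x y using adj_sym by blast
  then show ?thesis unfolding links_def by (subst sum.swap) (intro sum.cong refl, simp)
qed

lemma links_empty [simp]: "links {} Y = 0" "links X {} = 0"
  by (auto simp: links_def)

lemma links_Un_left:
  assumes "finite X" "finite X'" "X \<inter> X' = {}"
  shows "links (X \<union> X') Y = links X Y + links X' Y"
  unfolding links_def using assms by (rule sum.union_disjoint)

lemma links_Un_right:
  assumes "finite Y" "finite Y'" "Y \<inter> Y' = {}"
  shows "links X (Y \<union> Y') = links X Y + links X Y'"
  using links_Un_left[OF assms] by (simp add: links_sym)

lemma links_insert:
  assumes "finite X" "x \<notin> X"
  shows "links (insert x X) Y = links {x} Y + links X Y"
  unfolding links_def using assms by simp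

lemma links_nbrs:
  assumes "finite Y"
  shows "links {x} Y = card ({w. adj x w} \<inter> Y)"
proof -
  have "links {x} Y = (\<Sum>y\<in>Y. of_bool (adj x y))" by (simp add: links_def)
  also have "\<dots> = card (Y \<inter> {w. adj x w})"
    using assms by simp
  finally show ?thesis by (simp add: Int_commute)
qed

lemma links_single:
  assumes "{w. adj x w} = {p, q, r}" "p \<noteq> q" "p \<noteq> r" "q \<noteq> r" "finite Y"
  shows "links {x} Y = of_bool (p \<in> Y) + of_bool (q \<in> Y) + of_bool (r \<in> Y)"
  using assms(2-4) unfolding links_nbrs[OF assms(5)] assms(1) by (simp add: Int_insert_left)

lemma links_single_single: "links {x} {y} = of_bool (adj x y)"
  by (simp add: links_def)

lemma links_0: "finite X \<Longrightarrow> finite Y \<Longrightarrow> links X Y = 0 \<longleftrightarrow> (\<forall>x\<in>X. \<forall>y\<in>Y. \<not> adj x y)"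
  unfolding links_def by (auto simp del: sum_of_bool_eq)

lemma finite_nbrs: "finite {w. adj v w}"
  by (rule finite_subset[OF _ finV]) (auto intro: adj_V2)

lemma links_V:
  assumes "X \<subseteq> V"
  shows "links X V = 3 * card X"
proof -
  have "(\<Sum>y\<in>V. of_bool (adj x y)) = (3::nat)" if "x \<in> X" for x
  proof -
    have "links {x} V = 3"
      unfolding links_nbrs[OF finV] using deg3[of x] that assms adj_V2
      by (metis (no_types, lifting) Int_absorb2 mem_Collect_eq subsetD subsetI)
    then show ?thesis by (simp add: links_def)
  qed
  then show ?thesis by (simp add: links_def)
qed

lemma even_links: "finite X \<Longrightarrow> even (links X X)"
proof (induction rule: finite_induct)
  case (insert x X)
  have "links (insert x X) (insert x X) = links {x} {x} + links {x} X + (links X {x} + links X X)"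
    using insert links_insert links_sym by metis
  moreover have "links {x} {x} = 0" by (simp add: links_single_single adj_irrefl)
  ultimately show ?case using insert links_sym[of X "{x}"] by simp
qed simp

lemma cut_size_plus_links:
  assumes "X \<subseteq> V"
  shows "cut_size X + links X X = 3 * card X"
proof -
  have "links X ((V - X) \<union> X) = cut_size X + links X X"
    unfolding cut_size_def using fin[OF assms] finV by (intro links_Un_right) auto
  moreover have "(V - X) \<union> X = V" using assms by blast
  ultimately show ?thesis using links_V[OF assms] by simp
qed

text \<open>The degree sum \<open>3 * card X\<close> differs from the cut by the even number
  \<open>links X X\<close>. This parity later lifts sides of three vertices to four.\<close>

lemma even_cut_size: "X \<subseteq> V \<Longrightarrow> even (cut_size X) = even (card X)"
  using cut_size_plus_links[of X] even_links[OF fin, of X] by presburger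

lemma cut_size_compl: "X \<subseteq> V \<Longrightarrow> cut_size (V - X) = cut_size X"
  unfolding cut_size_def using links_sym[of "V - X" X] by (simp add: double_diff)

lemma cut_size_parts:
  assumes "X \<subseteq> V" "V - X = Y1 \<union> Y2" "Y1 \<inter> Y2 = {}"
  shows "cut_size X = links X Y1 + links X Y2"
proof -
  have "Y1 \<subseteq> V" "Y2 \<subseteq> V" using assms by auto
  then show ?thesis unfolding cut_size_def assms(2) using fin assms(3) by (intro links_Un_right) auto
qed

lemma third_nbr:
  assumes "adj v p" "adj v q" "p \<noteq> q"
  obtains r where "{w. adj v w} = {p, q, r}" "r \<noteq> p" "r \<noteq> q" "adj v r"
proof -
  have c: "card {w. adj v w} = 3" using deg3 assms adj_V by blast
  have "card ({w. adj v w} - {p, q}) = 1"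
    using assms c by (subst card_Diff_subset) auto
  then obtain r where r: "{w. adj v w} - {p, q} = {r}" using card_1_singletonE by blast
  then have "adj v r" "r \<noteq> p" "r \<noteq> q" by auto
  moreover have "{w. adj v w} = {p, q, r}" using r assms by auto
  ultimately show ?thesis using that by blast
qed

lemma other_nbrs:
  assumes "adj v p"
  obtains q r where "{w. adj v w} = {p, q, r}" "p \<noteq> q" "p \<noteq> r" "q \<noteq> r" "adj v q" "adj v r"
proof -
  have c: "card {w. adj v w} = 3" using deg3 assms adj_V by blast
  have "{w. adj v w} \<noteq> {p}" using c by auto
  then obtain q where "adj v q" "q \<noteq> p" using assms by auto
  then show ?thesis using third_nbr[OF assms, of q] that by (metis (full_types))
qed

text \<open>By parity the sides of a 4-cut have even size, and the ends of any edge form such a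
  side. Four is the first harmful size: once \<open>x\<close> and the cut edge \<open>xy\<close> are
  gone, at least three vertices remain behind a cut of size three.\<close>

definition removable :: "'a \<Rightarrow> 'a \<Rightarrow> bool" where
  "removable x y \<longleftrightarrow>
     (\<forall>B. B \<subseteq> V \<and> x \<in> B \<and> y \<notin> B \<and> 4 \<le> card B \<and> 4 \<le> card (V - B) \<longrightarrow> cut_size B \<noteq> 4)"

text \<open>Suppressing \<open>x\<close> and \<open>y\<close> would make \<open>pq\<close> and
  \<open>rs\<close> opposite sides of the 4-cycle \<open>p r s q\<close>, so the bridging that
  restores \<open>xy\<close> would have cycle spread (1,1).\<close>

definition domino_rung :: "'a \<Rightarrow> 'a \<Rightarrow> bool" where
  "domino_rung x y \<longleftrightarrow> (\<exists>p q r s. adj x p \<and> adj x q \<and> p \<noteq> q \<and> p \<noteq> y \<and> q \<noteq> y \<and>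
     adj y r \<and> adj y s \<and> r \<noteq> s \<and> r \<noteq> x \<and> s \<noteq> x \<and> adj p r \<and> adj q s)"

definition good :: "'a \<Rightarrow> 'a \<Rightarrow> bool" where
  "good x y \<longleftrightarrow> adj x y \<and> removable x y \<and> \<not> domino_rung x y"

definition square :: "'a \<Rightarrow> 'a \<Rightarrow> 'a \<Rightarrow> 'a \<Rightarrow> bool" where
  "square p q r s \<longleftrightarrow> adj p q \<and> adj q r \<and> adj r s \<and> adj s p \<and> p \<noteq> r \<and> q \<noteq> s"

end

locale cyc4_adj = cubic_adj +
  assumes cut4: "X \<subseteq> V \<Longrightarrow> 2 \<le> card X \<Longrightarrow> 2 \<le> card (V - X) \<Longrightarrow> 4 \<le> cut_size X"
    and card6: "6 \<le> card V"
begin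

lemma card_compl: "X \<subseteq> V \<Longrightarrow> card X + card (V - X) = card V"
  using finV card_mono[OF finV, of X] by (simp add: card_Diff_subset fin)

lemma cut_size_ge3:
  assumes "X \<subseteq> V" "X \<noteq> {}" "2 \<le> card (V - X)"
  shows "3 \<le> cut_size X"
proof (cases "2 \<le> card X")
  case False
  moreover have "card X \<noteq> 0" using assms fin by auto
  ultimately have c: "card X = 1" by linarith
  then obtain x where "X = {x}" using card_1_singletonE by blast
  then have "links X X = 0" by (simp add: links_single_single adj_irrefl)
  then show ?thesis using cut_size_plus_links[OF assms(1)] c by simp
next
  case True
  then show ?thesis using cut4[OF assms(1) True assms(3)] by simp
qed

text \<open>A triangle has degree sum 9 and \<open>links\<close> equal to 6, hence cut size
  3.\<close>

lemma no_triangle: "adj p q \<Longrightarrow> adj q r \<Longrightarrow> adj r p \<Longrightarrow> False"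
proof -
  assume a: "adj p q" "adj q r" "adj r p"
  let ?X = "{p, q, r}"
  have X: "?X \<subseteq> V" using a adj_V by auto
  have n: "p \<noteq> q" "q \<noteq> r" "p \<noteq> r" using a adj_neq by auto
  then have c: "card ?X = 3" by simp
  have "links ?X ?X = 6"
    using n a a[THEN adj_sym] by (simp add: links_def adj_irrefl)
  then have "cut_size ?X = 3" using cut_size_plus_links[OF X] c by simp
  then show False using cut4[OF X] c card_compl[OF X] card6 by simp
qed

end

locale cyc4_adj8 = cyc4_adj +
  assumes card8: "8 \<le> card V"
begin

text \<open>Neighbouring corners with a common outer neighbour would form a triangle, and opposite
  corners with one would give five vertices with a cut of size at most three. The names fit the
  later strips: rows \<open>a u1 u2 c\<close> and \<open>b v1 v2 e\<close>.\<close>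

lemma square_outer:
  assumes "square u1 u2 v2 v1"
  obtains a b c e where
    "{w. adj u1 w} = {u2, v1, a}" "{w. adj v1 w} = {u1, v2, b}"
    "{w. adj u2 w} = {u1, v2, c}" "{w. adj v2 w} = {u2, v1, e}"
    "distinct [u1, u2, v1, v2, a, b, c, e]" "set [u1, u2, v1, v2, a, b, c, e] \<subseteq> V"
proof -
  have s: "adj u1 u2" "adj u2 v2" "adj v2 v1" "adj v1 u1" "u1 \<noteq> v2" "u2 \<noteq> v1"
    using assms by (auto simp: square_def)
  obtain a where a: "{w. adj u1 w} = {u2, v1, a}" "a \<noteq> u2" "a \<noteq> v1" "adj u1 a"
    using third_nbr[of u1 u2 v1] s adj_sym by metis
  obtain b where b: "{w. adj v1 w} = {u1, v2, b}" "b \<noteq> u1" "b \<noteq> v2" "adj v1 b"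
    using third_nbr[of v1 u1 v2] s adj_sym by metis
  obtain c where c: "{w. adj u2 w} = {u1, v2, c}" "c \<noteq> u1" "c \<noteq> v2" "adj u2 c"
    using third_nbr[of u2 u1 v2] s adj_sym by metis
  obtain e where e: "{w. adj v2 w} = {u2, v1, e}" "e \<noteq> u2" "e \<noteq> v1" "adj v2 e"
    using third_nbr[of v2 u2 v1] s adj_sym by metis
  have nadj: "\<not> adj u1 v2" "\<not> adj u2 v1"
    using s(1-4) no_triangle[of u1 u2 v2] no_triangle[of u2 v2 v1] adj_sym by blast+
  have nadj': "\<not> adj v2 u1" "\<not> adj v1 u2" using nadj adj_sym by blast+
  have d1: "a \<noteq> v2" "b \<noteq> u2" "c \<noteq> v1" "e \<noteq> u1"
    using a(4) b(4) c(4) e(4) nadj nadj' by auto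
  have d2: "a \<noteq> b" "a \<noteq> c" "b \<noteq> e" "c \<noteq> e" 
    using no_triangle[of u1 a v1] no_triangle[of u1 a u2] no_triangle[of v1 b v2]
      no_triangle[of u2 c v2] a(4) b(4) c(4) e(4) s(1-4) by (metis adj_sym)+
  have d3: "u1 \<noteq> u2" "u2 \<noteq> v2" "v2 \<noteq> v1" "v1 \<noteq> u1" "a \<noteq> u1" "b \<noteq> v1" "c \<noteq> u2" "e \<noteq> v2"
    using s(1-4) a(4) b(4) c(4) e(4) adj_neq by auto
  \<comment> \<open>The square and \<open>w\<close> carry at least six edges, so
    \<open>links\<close> is at least 12 and the cut size at most 15 - 12 = 3, with three vertices
    left outside by \<open>card8\<close>.\<close>
  have d4: False if "w \<notin> {u1, u2, v2, v1}" "w \<in> V"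
    and "adj u1 w \<and> adj v2 w \<or> adj v1 w \<and> adj u2 w" for w
  proof -
    let ?X = "{w, u1, u2, v2, v1}"
    have X: "?X \<subseteq> V" using s that adj_V by auto
    have k: "card ?X = 5" using that(1) s d3 by simp
    have "links {w} {u1, u2, v2, v1} \<ge> 2"
    proof -
      have "adj w u1 \<and> adj w v2 \<or> adj w v1 \<and> adj w u2" using that(3) adj_sym by blast
      then show ?thesis using s(5,6) d3(1-4) by (auto simp: links_def simp del: sum_of_bool_eq)
    qed
    moreover have "links {u1, u2, v2, v1} {u1, u2, v2, v1} = 8"
      using s(1-4) s(1-4)[THEN adj_sym] s(5,6) d3 nadj nadj' by (simp add: links_def adj_irrefl)
    moreover have "links ?X ?X = links {w} {w} + links {w} {u1, u2, v2, v1} +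
        (links {u1, u2, v2, v1} {w} + links {u1, u2, v2, v1} {u1, u2, v2, v1})"
      using links_insert[OF _ that(1), of ?X] links_insert[OF _ that(1), of "{w}"]
        links_insert[OF _ that(1), of "{u1, u2, v2, v1}"]
        links_sym[of "{w}" ?X] links_sym[of "{u1, u2, v2, v1}" ?X] links_sym[of "{u1, u2, v2, v1}" "{w}"] by simp
    ultimately have "links ?X ?X \<ge> 12" 
      using links_sym[of "{w}" "{u1, u2, v2, v1}"] by linarith
    then have "cut_size ?X \<le> 3" using cut_size_plus_links[OF X] k by simp
    then show False using cut4[OF X] k card_compl[OF X] card8 by simp
  qed
  have inV: "u1 \<in> V" "u2 \<in> V" "v1 \<in> V" "v2 \<in> V" "a \<in> V" "b \<in> V" "c \<in> V" "e \<in> V"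
    using s(1-4) a(4) b(4) c(4) e(4) adj_V adj_V2 by auto
  have "a \<noteq> e" using d4[of a] a e d1 d2 d3 inV by auto
  moreover have "b \<noteq> c" using d4[of b] b c d1 d2 d3 inV by auto
  ultimately show ?thesis
    using that[OF a(1) b(1) c(1) e(1)] d1 d2 d3 s(5,6) inV
      a(2,3) b(2,3) c(2,3) e(2,3) by auto
qed

end

section \<open>Squares\<close>

context cyc4_adj8
begin

lemma links_insert2:
  assumes "finite X" "x \<notin> insert y X"
  shows "links (insert x (insert y X)) Y = links {x} Y + links (insert y X) Y"
  using links_insert[of "insert y X"] assms by simp

text \<open>The layout is a piece of a strip with rows \<open>a u1 u2 c\<close> and
  \<open>b v1 v2 e\<close>; the sides \<open>u1 v1\<close> and \<open>u2 v2\<close> are rungs. Whole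
  neighbourhoods are recorded, so that \<open>links\<close> from a corner can be computed.\<close>

definition square_nbrs :: "'a \<Rightarrow> 'a \<Rightarrow> 'a \<Rightarrow> 'a \<Rightarrow> 'a \<Rightarrow> 'a \<Rightarrow> 'a \<Rightarrow> 'a \<Rightarrow> bool" where
  "square_nbrs u1 u2 v1 v2 a b c e \<longleftrightarrow>
     {w. adj u1 w} = {u2, v1, a} \<and> {w. adj v1 w} = {u1, v2, b} \<and>
     {w. adj u2 w} = {u1, v2, c} \<and> {w. adj v2 w} = {u2, v1, e} \<and>
     distinct [u1, u2, v1, v2, a, b, c, e] \<and> {u1, u2, v1, v2, a, b, c, e} \<subseteq> V"

lemma square_nbrsD:
  assumes "square_nbrs u1 u2 v1 v2 a b c e"
  shows "distinct [u1, u2, v1, v2, a, b, c, e]" "{u1, u2, v1, v2, a, b, c, e} \<subseteq> V"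
    "{w. adj u1 w} = {u2, v1, a}" "{w. adj v1 w} = {u1, v2, b}"
    "{w. adj u2 w} = {u1, v2, c}" "{w. adj v2 w} = {u2, v1, e}"
  using assms unfolding square_nbrs_def by argo+

text \<open>This diagonal reflection and the mirror image in \<open>square_nbrs_flip\<close>
  generate all eight symmetries of the square, so each argument is made for one side only.\<close>

lemma square_nbrs_transpose:
  "square_nbrs u1 u2 v1 v2 a b c e \<Longrightarrow> square_nbrs u1 v1 u2 v2 a c b e"
  unfolding square_nbrs_def by (simp add: insert_commute) blast

lemma square_nbrs_flip:
  "square_nbrs u1 u2 v1 v2 a b c e \<Longrightarrow> square_nbrs u2 u1 v2 v1 c e a b"
  unfolding square_nbrs_def by (simp add: insert_commute) blast

lemma links_square_out:
  assumes "square_nbrs u1 u2 v1 v2 a b c e" "X \<subseteq> V" "X \<inter> {u1, u2, v1, v2} = {}"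
  shows "links {u1} X = of_bool (a \<in> X)" "links {v1} X = of_bool (b \<in> X)"
    "links {u2} X = of_bool (c \<in> X)" "links {v2} X = of_bool (e \<in> X)"
proof -
  note s = assms(1)[unfolded square_nbrs_def]
  have f: "finite X" using fin assms(2) .
  have n: "u1 \<notin> X" "u2 \<notin> X" "v1 \<notin> X" "v2 \<notin> X" using assms(3) by auto
  show "links {u1} X = of_bool (a \<in> X)"
    by (subst links_single[of u1 u2 v1 a]) (use s f n in auto)
  show "links {v1} X = of_bool (b \<in> X)"
    by (subst links_single[of v1 u1 v2 b]) (use s f n in auto)
  show "links {u2} X = of_bool (c \<in> X)"
    by (subst links_single[of u2 u1 v2 c]) (use s f n in auto)
  show "links {v2} X = of_bool (e \<in> X)"
    by (subst links_single[of v2 u2 v1 e]) (use s f n in auto)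
qed

text \<open>Exactly four edges leave the square, so
  \<open>cut_size R + cut_size S = 4 + 2 * links R S\<close>. If both cuts on the left are at least
  four, then \<open>links R S\<close> is at least 2, and two sides of the square supply the rest of
  the 4-cut \<open>B\<close>.\<close>

lemma square_cut:
  assumes sq: "square_nbrs u1 u2 v1 v2 a b c e" and "\<not> removable u1 v1"
  obtains R S where "R \<union> S = V - {u1, u2, v1, v2}" "R \<inter> S = {}"
    "a \<in> R" "c \<in> R" "b \<in> S" "e \<in> S" "links R S = 2"
proof -
  obtain B where B: "B \<subseteq> V" "u1 \<in> B" "v1 \<notin> B" "4 \<le> card B" "4 \<le> card (V - B)" "cut_size B = 4"
    using assms(2) unfolding removable_def by blast
  note s = sq[unfolded square_nbrs_def]
  let ?Z = "{u1, u2, v1, v2}"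
  define P Q R S where "P = B \<inter> ?Z" and "Q = ?Z - B" and "R = B - ?Z" and "S = V - B - ?Z"
  have ZV: "?Z \<subseteq> V" and dist: "u1 \<noteq> u2" "u1 \<noteq> v1" "u1 \<noteq> v2" "u2 \<noteq> v1" "u2 \<noteq> v2" "v1 \<noteq> v2"
    using s by auto
  have RV: "R \<subseteq> V" "S \<subseteq> V" "R \<inter> ?Z = {}" "S \<inter> ?Z = {}" "R \<inter> S = {}"
    using B by (auto simp: R_def S_def)
  have fins: "finite P" "finite Q" "finite R" "finite S"
    using fin[OF RV(1)] fin[OF RV(2)] by (auto simp: P_def Q_def)
  have cB: "card B = card P + card R"
  proof -
    have "B = P \<union> R" "P \<inter> R = {}" by (auto simp: P_def R_def)
    then show ?thesis using fins by (simp add: card_Un_disjoint)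
  qed
  have cB': "card (V - B) = card Q + card S"
  proof -
    have "V - B = Q \<union> S" "Q \<inter> S = {}" using ZV by (auto simp: Q_def S_def)
    then show ?thesis using fins by (simp add: card_Un_disjoint)
  qed
  have dB: "cut_size B = links P Q + links P S + links Q R + links R S"
  proof -
    have "cut_size B = links B Q + links B S"
      using ZV B by (intro cut_size_parts) (auto simp: Q_def S_def)
    moreover have "B = P \<union> R" "P \<inter> R = {}" by (auto simp: P_def R_def)
    ultimately show ?thesis using links_Un_left[of P R] fins links_sym[of R Q] by simp
  qed
  have dR: "cut_size R = links ?Z R + links R S"
  proof -
    have "cut_size R = links R ?Z + links R S"
      using ZV RV B by (intro cut_size_parts) (auto simp: R_def S_def)
    then show ?thesis using links_sym[of R ?Z] by linarith
  qed
  have dS: "cut_size S = links ?Z S + links R S"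
  proof -
    have "cut_size S = links S ?Z + links S R"
      using ZV RV B by (intro cut_size_parts) (auto simp: R_def S_def)
    then show ?thesis using links_sym[of S ?Z] links_sym[of S R] by linarith
  qed
  have mZ: "links ?Z X = links {u1} X + links {u2} X + links {v1} X + links {v2} X" for X
    using dist by (simp add: links_insert2)
  note oR = links_square_out[OF sq RV(1) RV(3)]
  note oS = links_square_out[OF sq RV(2) RV(4)]
  have mem: "a \<in> S \<longleftrightarrow> a \<notin> R" "b \<in> S \<longleftrightarrow> b \<notin> R" "c \<in> S \<longleftrightarrow> c \<notin> R" "e \<in> S \<longleftrightarrow> e \<notin> R"
    using s by (auto simp: R_def S_def)
  have cPQ: "card P + card Q = 4"
  proof -
    have "?Z = P \<union> Q" "P \<inter> Q = {}" by (auto simp: P_def Q_def)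
    then have "card ?Z = card P + card Q" using fins by (metis card_Un_disjoint)
    then show ?thesis using dist by simp
  qed
  have "u1 \<in> P" "v1 \<in> Q" using B by (auto simp: P_def Q_def)
  then have cP: "card P \<ge> 1" "card Q \<ge> 1" using fins by (auto simp: Suc_le_eq card_gt_0_iff)
  then have cR: "card R \<ge> 1" "card S \<ge> 1" "card P = 2 \<Longrightarrow> card R \<ge> 2" "card P = 2 \<Longrightarrow> card S \<ge> 2"
    "card P = 1 \<Longrightarrow> card R \<ge> 2" "card P = 3 \<Longrightarrow> card S \<ge> 2"
    using cB cB' cPQ B by linarith+
  have cZR: "card (V - R) \<ge> 2" "card (V - S) \<ge> 2"
  proof -
    have "?Z \<subseteq> V - R" "?Z \<subseteq> V - S" "card ?Z = 4" using ZV RV dist by auto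
    then show "card (V - R) \<ge> 2" "card (V - S) \<ge> 2"
      using card_mono[of "V - R" ?Z] card_mono[of "V - S" ?Z] finV by auto
  qed
  have gR: "cut_size R \<ge> 3" "cut_size S \<ge> 3" "card R \<ge> 2 \<Longrightarrow> cut_size R \<ge> 4" "card S \<ge> 2 \<Longrightarrow> cut_size S \<ge> 4"
  proof -
    have "R \<noteq> {}" "S \<noteq> {}" using cR(1,2) by auto
    then show "cut_size R \<ge> 3" "cut_size S \<ge> 3" "card R \<ge> 2 \<Longrightarrow> cut_size R \<ge> 4" "card S \<ge> 2 \<Longrightarrow> cut_size S \<ge> 4"
      using cut_size_ge3[of R] cut_size_ge3[of S] cut4[of R] cut4[of S] cZR RV(1,2) by simp_all
  qed
  have n1: "links {u1} X = of_bool (u2 \<in> X) + of_bool (v1 \<in> X) + of_bool (a \<in> X)"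
    "links {v1} X = of_bool (u1 \<in> X) + of_bool (v2 \<in> X) + of_bool (b \<in> X)"
    "links {u2} X = of_bool (u1 \<in> X) + of_bool (v2 \<in> X) + of_bool (c \<in> X)"
    "links {v2} X = of_bool (u2 \<in> X) + of_bool (v1 \<in> X) + of_bool (e \<in> X)" if "finite X" for X
  proof -
    show "links {u1} X = of_bool (u2 \<in> X) + of_bool (v1 \<in> X) + of_bool (a \<in> X)"
      by (rule links_single[OF square_nbrsD(3)[OF sq]]) (use square_nbrsD(1)[OF sq] that in simp_all)
    show "links {v1} X = of_bool (u1 \<in> X) + of_bool (v2 \<in> X) + of_bool (b \<in> X)"
      by (rule links_single[OF square_nbrsD(4)[OF sq]]) (use square_nbrsD(1)[OF sq] that in simp_all)
    show "links {u2} X = of_bool (u1 \<in> X) + of_bool (v2 \<in> X) + of_bool (c \<in> X)"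
      by (rule links_single[OF square_nbrsD(5)[OF sq]]) (use square_nbrsD(1)[OF sq] that in simp_all)
    show "links {v2} X = of_bool (u2 \<in> X) + of_bool (v1 \<in> X) + of_bool (e \<in> X)"
      by (rule links_single[OF square_nbrsD(6)[OF sq]]) (use square_nbrsD(1)[OF sq] that in simp_all)
  qed
  have "distinct [u1, u2, v1, v2, a, b, c, e]" using square_nbrsD(1)[OF sq] .
  then have nZ: "a \<notin> ?Z" "b \<notin> ?Z" "c \<notin> ?Z" "e \<notin> ?Z" by auto
  \<comment> \<open>Only the split into rows survives. A diagonal split cuts all four sides of the
    square and leaves \<open>cut_size R = 2\<close>; a split into one and three corners forces
    \<open>links R S = 2\<close> and with it a cut of size three around \<open>R\<close> or
    \<open>S\<close>, on a side with at least two vertices.\<close>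
  have "P = {u1, u2} \<and> links R S = 2 \<and> a \<in> R \<and> c \<in> R \<and> b \<in> S \<and> e \<in> S"
  proof (cases "u2 \<in> B"; cases "v2 \<in> B")
    assume "u2 \<in> B" "v2 \<in> B"
    then have P: "P = {u1, u2, v2}" and Q: "Q = {v1}" using B dist by (auto simp: P_def Q_def)
    have "links P Q = 2" unfolding P Q using dist nZ by (simp add: links_insert2 n1)
    moreover have "card P = 3" using P dist by simp
    moreover have "links P S = links {u1} S + links {u2} S + links {v2} S" "links Q R = links {v1} R"
      unfolding P Q using dist by (simp_all add: links_insert2)
    ultimately show ?thesis using dB dR dS B(6) gR cR mem unfolding mZ oR oS of_bool_def
      by (simp split: if_splits)
  next
    assume "u2 \<in> B" "v2 \<notin> B"
    then have P: "P = {u1, u2}" and Q: "Q = {v1, v2}" using B dist by (auto simp: P_def Q_def)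
    have "links P Q = 2" unfolding P Q using dist nZ by (simp add: links_insert2 n1)
    moreover have "card P = 2" using P dist by simp
    moreover have "links P S = links {u1} S + links {u2} S" "links Q R = links {v1} R + links {v2} R"
      unfolding P Q using dist by (simp_all add: links_insert2)
    ultimately show ?thesis using P dB dR dS B(6) gR cR mem unfolding mZ oR oS of_bool_def
      by (simp split: if_splits)
  next
    assume "u2 \<notin> B" "v2 \<in> B"
    then have P: "P = {u1, v2}" and Q: "Q = {v1, u2}" using B dist by (auto simp: P_def Q_def)
    have "links P Q = 4" unfolding P Q using dist nZ by (simp add: links_insert2 n1)
    moreover have "card P = 2" using P dist by simp
    ultimately show ?thesis using dB dR dS B(6) gR cR mem unfolding mZ oR oS of_bool_def
      by (simp split: if_splits)
  next
    assume "u2 \<notin> B" "v2 \<notin> B"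
    then have P: "P = {u1}" and Q: "Q = {u2, v1, v2}" using B dist by (auto simp: P_def Q_def)
    have "links P Q = 2" unfolding P Q using dist nZ by (simp add: links_insert2 n1)
    moreover have "card P = 1" using P dist by simp
    moreover have "links P S = links {u1} S" "links Q R = links {u2} R + links {v1} R + links {v2} R"
      unfolding P Q using dist by (simp_all add: links_insert2)
    ultimately show ?thesis using dB dR dS B(6) gR cR mem unfolding mZ oR oS of_bool_def
      by (simp split: if_splits)
  qed
  moreover have "R \<union> S = V - ?Z" using B by (auto simp: R_def S_def)
  ultimately show ?thesis using that RV by blast
qed

text \<open>The two cuts divide the vertices off the square into four corners, whose cut sizes are all
  forced to be 3, so that every corner is a single vertex.\<close>

lemma square_two_cuts:
  assumes sq: "square_nbrs u1 u2 v1 v2 a b c e"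
    and nr: "\<not> removable u1 v1" "\<not> removable u1 u2"
  shows "adj a b \<and> adj c e"
proof -
  let ?Z = "{u1, u2, v1, v2}"
  obtain R S where RS: "R \<union> S = V - ?Z" "R \<inter> S = {}" "a \<in> R" "c \<in> R" "b \<in> S" "e \<in> S" "links R S = 2"
    using square_cut[OF sq nr(1)] .
  obtain R' S' where RS': "R' \<union> S' = V - {u1, v1, u2, v2}" "R' \<inter> S' = {}" "a \<in> R'" "b \<in> R'" "c \<in> S'" "e \<in> S'" "links R' S' = 2"
    using square_cut[OF square_nbrs_transpose[OF sq] nr(2)] .
  have Z': "{u1, v1, u2, v2} = ?Z" by auto
  note s = sq[unfolded square_nbrs_def]
  have dist: "u1 \<noteq> u2" "u1 \<noteq> v1" "u1 \<noteq> v2" "u2 \<noteq> v1" "u2 \<noteq> v2" "v1 \<noteq> v2" using s by auto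
  define A1 A2 A3 A4 where "A1 = R \<inter> R'" and "A2 = S \<inter> R'" and "A3 = R \<inter> S'" and "A4 = S \<inter> S'"
  note defs = A1_def A2_def A3_def A4_def
  have ZV: "?Z \<subseteq> V" using s by auto
  have sub: "A1 \<subseteq> V" "A2 \<subseteq> V" "A3 \<subseteq> V" "A4 \<subseteq> V" using RS(1) by (auto simp: defs)
  have f: "finite A1" "finite A2" "finite A3" "finite A4" using sub fin by auto
  have disj: "A1 \<inter> ?Z = {}" "A2 \<inter> ?Z = {}" "A3 \<inter> ?Z = {}" "A4 \<inter> ?Z = {}"
    using RS(1) by (auto simp: defs)
  have disj2: "A1 \<inter> A2 = {}" "A1 \<inter> A3 = {}" "A1 \<inter> A4 = {}" "A2 \<inter> A3 = {}" "A2 \<inter> A4 = {}" "A3 \<inter> A4 = {}"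
    using RS(2) RS'(2) by (auto simp: defs)
  have V: "V = A1 \<union> A2 \<union> A3 \<union> A4 \<union> ?Z"
    using RS(1) RS'(1) ZV unfolding Z' defs by blast
  have diff: "A1 \<union> A2 \<union> A3 \<union> A4 \<union> Z - A1 = Z \<union> (A2 \<union> (A3 \<union> A4))"
    "A1 \<union> A2 \<union> A3 \<union> A4 \<union> Z - A2 = Z \<union> (A1 \<union> (A3 \<union> A4))"
    "A1 \<union> A2 \<union> A3 \<union> A4 \<union> Z - A3 = Z \<union> (A1 \<union> (A2 \<union> A4))"
    "A1 \<union> A2 \<union> A3 \<union> A4 \<union> Z - A4 = Z \<union> (A1 \<union> (A2 \<union> A3))"
    if "A1 \<inter> Z = {}" "A2 \<inter> Z = {}" "A3 \<inter> Z = {}" "A4 \<inter> Z = {}" for Z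
    using disj2 that by blast+
  note VQ = diff[OF disj, folded V]
  have dd: "cut_size X = links X ?Z + links X Y1 + links X Y2 + links X Y3"
    if "X \<subseteq> V" "V - X = ?Z \<union> (Y1 \<union> (Y2 \<union> Y3))" "?Z \<inter> (Y1 \<union> (Y2 \<union> Y3)) = {}"
      "Y1 \<inter> (Y2 \<union> Y3) = {}" "Y2 \<inter> Y3 = {}" "finite Y1" "finite Y2" "finite Y3" for X Y1 Y2 Y3
    using cut_size_parts[OF that(1-3)] links_Un_right[of Y1 "Y2 \<union> Y3" X] links_Un_right[of Y2 Y3 X] that by simp
  have mZ: "links X ?Z = links {u1} X + links {u2} X + links {v1} X + links {v2} X" for X
  proof -
    have "links ?Z X = links {u1} X + links {u2} X + links {v1} X + links {v2} X" using dist by (simp add: links_insert2)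
    then show ?thesis using links_sym[of X ?Z] by linarith
  qed
  have mem: "a \<in> A1" "b \<in> A2" "c \<in> A3" "e \<in> A4" using RS RS' by (auto simp: defs)
  have nmem: "a \<notin> A2" "a \<notin> A3" "a \<notin> A4" "b \<notin> A1" "b \<notin> A3" "b \<notin> A4" "c \<notin> A1" "c \<notin> A2" "c \<notin> A4"
    "e \<notin> A1" "e \<notin> A2" "e \<notin> A3" using mem disj2 by auto
  have z: "links A1 ?Z = 1" "links A2 ?Z = 1" "links A3 ?Z = 1" "links A4 ?Z = 1"
    unfolding mZ using mem nmem by (simp_all add: links_square_out[OF sq] sub disj)
  have "cut_size A1 = links A1 ?Z + links A1 A2 + links A1 A3 + links A1 A4"
    by (rule dd[OF _ VQ(1)]) (use sub f disj disj2 in auto)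
  then have d1: "cut_size A1 = 1 + links A1 A2 + links A1 A3 + links A1 A4" using z by simp
  have "cut_size A2 = links A2 ?Z + links A2 A1 + links A2 A3 + links A2 A4"
    by (rule dd[OF _ VQ(2)]) (use sub f disj disj2 in auto)
  then have d2: "cut_size A2 = 1 + links A1 A2 + links A2 A3 + links A2 A4" using z links_sym[of A2 A1] by simp
  have "cut_size A3 = links A3 ?Z + links A3 A1 + links A3 A2 + links A3 A4"
    by (rule dd[OF _ VQ(3)]) (use sub f disj disj2 in auto)
  then have d3: "cut_size A3 = 1 + links A1 A3 + links A2 A3 + links A3 A4"
    using z links_sym[of A3 A1] links_sym[of A3 A2] by simp
  have "cut_size A4 = links A4 ?Z + links A4 A1 + links A4 A2 + links A4 A3"
    by (rule dd[OF _ VQ(4)]) (use sub f disj disj2 in auto)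
  then have d4: "cut_size A4 = 1 + links A1 A4 + links A2 A4 + links A3 A4"
    using z links_sym[of A4 A1] links_sym[of A4 A2] links_sym[of A4 A3] by simp
  have split4: "links (X1 \<union> X2) (Y1 \<union> Y2) = links X1 Y1 + links X1 Y2 + links X2 Y1 + links X2 Y2"
    if "finite X1" "finite X2" "finite Y1" "finite Y2" "X1 \<inter> X2 = {}" "Y1 \<inter> Y2 = {}" for X1 X2 Y1 Y2
    using that by (simp add: links_Un_left links_Un_right)
  have "R = A1 \<union> A3" "S = A2 \<union> A4" "R' = A1 \<union> A2" "S' = A3 \<union> A4"
    using RS(1) RS'(1) unfolding Z' defs by blast+
  then have r1: "links A1 A2 + links A1 A4 + links A2 A3 + links A3 A4 = 2"
    and r2: "links A1 A3 + links A1 A4 + links A2 A3 + links A2 A4 = 2"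
    using RS(7) RS'(7) split4[of A1 A3 A2 A4] split4[of A1 A2 A3 A4] f disj2 links_sym[of A3 A2] by auto
  have cc: "cut_size X \<ge> 3 \<and> (cut_size X = 3 \<longrightarrow> card X = 1)" if "X \<subseteq> V" "X \<inter> ?Z = {}" "X \<noteq> {}" for X
  proof -
    have "?Z \<subseteq> V - X" "card ?Z = 4" using ZV that dist by auto
    then have "card (V - X) \<ge> 2" using card_mono[of "V - X" ?Z] finV by auto
    moreover have "card X \<noteq> 0" using that fin by auto
    ultimately show ?thesis using cut_size_ge3[of X] cut4[of X] that by force
  qed
  have ne: "A1 \<noteq> {}" "A2 \<noteq> {}" "A3 \<noteq> {}" "A4 \<noteq> {}" using mem by auto
  note c1 = cc[OF sub(1) disj(1) ne(1)] and c2 = cc[OF sub(2) disj(2) ne(2)]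
    and c3 = cc[OF sub(3) disj(3) ne(3)] and c4 = cc[OF sub(4) disj(4) ne(4)]
  \<comment> \<open>The sum of \<open>d1\<close> to \<open>d4\<close> minus twice the sum of
    \<open>r1\<close> and \<open>r2\<close> shows that the four cut sizes add up to
    \<open>12 - 2 * (links A1 A4 + links A2 A3)\<close>, while each of them is at least 3.\<close>
  have eq: "links A1 A4 = 0" "links A2 A3 = 0" "cut_size A1 = 3" "cut_size A2 = 3" "cut_size A3 = 3" "cut_size A4 = 3"
    using c1[THEN conjunct1] c2[THEN conjunct1] c3[THEN conjunct1] c4[THEN conjunct1]
      d1 d2 d3 d4 r1 r2 by linarith+
  then have "card A1 = 1" "card A2 = 1" "card A3 = 1" "card A4 = 1" using c1 c2 c3 c4 by auto
  then have sing: "A1 = {a}" "A2 = {b}" "A3 = {c}" "A4 = {e}"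
    using mem by (auto simp: card_1_singleton_iff)
  have "links A1 A2 \<le> 1" "links A1 A3 \<le> 1" "links A3 A4 \<le> 1" "links A2 A4 \<le> 1"
    unfolding sing links_single_single by auto
  then have "links A1 A2 = 1" "links A3 A4 = 1" using eq d1 d2 d3 d4 by linarith+
  then show ?thesis unfolding sing links_single_single of_bool_eq_1_iff by (rule conjI)
qed

text \<open>Besides each other, \<open>u1\<close> and \<open>v1\<close> have the neighbours
  \<open>u2\<close>, \<open>a\<close> and \<open>v2\<close>, \<open>b\<close>. A domino matches
  these two pairs by edges, and \<open>u2\<close> is not adjacent to \<open>b\<close>, so
  \<open>u2\<close> goes with \<open>v2\<close> and \<open>a\<close> with \<open>b\<close>.\<close>

lemma square_not_domino:
  assumes sq: "square_nbrs u1 u2 v1 v2 a b c e" and "\<not> adj a b"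
  shows "\<not> domino_rung u1 v1"
proof
  note s = sq[unfolded square_nbrs_def]
  have N: "adj u1 w \<longleftrightarrow> w = u2 \<or> w = v1 \<or> w = a" "adj v1 w \<longleftrightarrow> w = u1 \<or> w = v2 \<or> w = b"
    "adj u2 w \<longleftrightarrow> w = u1 \<or> w = v2 \<or> w = c" for w using s by blast+
  assume "domino_rung u1 v1"
  then obtain p q r t where p: "adj u1 p" "adj u1 q" "p \<noteq> q" "p \<noteq> v1" "q \<noteq> v1"
     "adj v1 r" "adj v1 t" "r \<noteq> t" "r \<noteq> u1" "t \<noteq> u1" "adj p r" "adj q t"
    unfolding domino_rung_def by blast
  have "{p, q} = {u2, a}" "{r, t} = {v2, b}" using p N by auto
  then have "adj a b \<or> adj u2 b" using p(11,12) \<open>p \<noteq> q\<close> \<open>r \<noteq> t\<close> adj_sym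
    by (auto simp: doubleton_eq_iff)
  then show False using assms(2) N s by auto
qed

text \<open>\<open>adj a b\<close> says that the square is continued beyond the side
  \<open>u1 v1\<close>, and likewise for the other sides. A side without continuation is no domino
  rung, so without good edges it is not removable. If each pair of opposite sides has a member
  without continuation, two such sides share a corner, and \<open>square_two_cuts\<close> at that
  corner is contradicted.\<close>

lemma square_extends:
  assumes sq: "square_nbrs u1 u2 v1 v2 a b c e" and ng: "\<And>x y. \<not> good x y"
  shows "(adj a b \<and> adj c e) \<or> (adj a c \<and> adj b e)"
proof (rule ccontr)
  assume n: "\<not> ?thesis"
  have adjs: "adj u1 v1" "adj u1 u2" "adj u2 v2" "adj v1 v2" using sq unfolding square_nbrs_def by auto
  have nr1: "\<not> removable u1 v1" if "square_nbrs u1 u2 v1 v2 a b c e" "adj u1 v1" "\<not> adj a b" for u1 u2 v1 v2 a b c e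
    using square_not_domino[OF that(1,3)] ng[of u1 v1] that(2) unfolding good_def by blast
  have rs: "removable y x" if "removable x y" "adj x y" for x y
    unfolding removable_def
  proof (intro allI impI)
    fix B assume B: "B \<subseteq> V \<and> y \<in> B \<and> x \<notin> B \<and> 4 \<le> card B \<and> 4 \<le> card (V - B)"
    then have "cut_size (V - B) \<noteq> 4"
      using that(1)[unfolded removable_def, rule_format, of "V - B"] adj_V[OF that(2)]
      by (auto simp: double_diff)
    then show "cut_size B \<noteq> 4" using cut_size_compl[of B] B by simp
  qed
  note f = square_nbrs_flip[OF sq]
  note t = square_nbrs_transpose[OF sq]
  note tf = square_nbrs_flip[OF t]
  consider "\<not> adj a b" "\<not> adj a c" | "\<not> adj a b" "\<not> adj b e" | "\<not> adj c e" "\<not> adj a c"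
    | "\<not> adj c e" "\<not> adj b e" using n by blast
  then show False
  proof cases
    case 1
    then have "\<not> removable u1 v1" "\<not> removable u1 u2" using nr1[OF sq] nr1[OF t] adjs by auto
    then show False using square_two_cuts[OF sq] 1 by blast
  next
    case 2
    then have "\<not> removable u1 v1" "\<not> removable v1 v2" using nr1[OF sq] nr1[OF tf] adjs adj_sym by auto
    moreover have "square_nbrs v1 v2 u1 u2 b a e c"
      using square_nbrs_flip[OF t] square_nbrs_transpose by blast
    ultimately show False using square_two_cuts[of v1 v2 u1 u2 b a e c] 2 adjs adj_sym rs by blast
  next
    case 3
    then have "\<not> removable u2 v2" "\<not> removable u1 u2" using nr1[OF f] nr1[OF t] adjs adj_sym by auto
    then show False using square_two_cuts[OF f] 3 adjs adj_sym rs by blast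
  next
    case 4
    then have "\<not> removable u2 v2" "\<not> removable v1 v2" using nr1[OF f] nr1[OF tf] adjs adj_sym by auto
    moreover have "square_nbrs v2 v1 u2 u1 e c b a"
      using square_nbrs_flip[OF tf[THEN square_nbrs_transpose]] by blast
    ultimately show False using square_two_cuts[of v2 v1 u2 u1 e c b a] 4 adjs adj_sym rs by blast
  qed
qed

end

section \<open>Strips of squares\<close>

lemma card3_eq:
  assumes "card S = 3" "{x, y, z} \<subseteq> S" "distinct [x, y, z]"
  shows "S = {x, y, z}"
proof -
  have "finite S" using assms(1) by (intro card_ge_0_finite) simp
  moreover have "card {x, y, z} = 3" using assms(3) by simp
  ultimately show ?thesis using card_subset_eq[of S "{x, y, z}"] assms by simp
qed

context cyc4_adj8
begin

text \<open>The rows are infinite sequences that keep running around the finite graph. Distinctness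
  is demanded only for three consecutive rungs; how the strip closes up is derived
  afterwards.\<close>

definition strip :: "(nat \<Rightarrow> 'a) \<Rightarrow> (nat \<Rightarrow> 'a) \<Rightarrow> bool" where
  "strip U W \<longleftrightarrow> (\<forall>n. adj (U n) (U (Suc n)) \<and> adj (W n) (W (Suc n)) \<and> adj (U n) (W n) \<and>
     distinct [U n, U (Suc n), W n, W (Suc n), U (Suc (Suc n)), W (Suc (Suc n))])"

text \<open>The rung \<open>c e\<close> completes a new square on \<open>u1 v1\<close>, whose
  backward outer neighbours are \<open>u0\<close> and \<open>v0\<close>. The point is that it is
  continued in the same direction again.\<close>

lemma strip_step:
  assumes sq: "square_nbrs u0 u1 v0 v1 a b c e" and ab: "adj a b" and ce: "adj c e"
    and ng: "\<And>x y. \<not> good x y"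
  obtains c' e' where "square_nbrs u1 c v1 e u0 v0 c' e'" "adj u0 v0" "adj c' e'"
proof -
  note dst = square_nbrsD(1)[OF sq] and nb = square_nbrsD(3-6)[OF sq]
  have A: "adj u0 w \<longleftrightarrow> w \<in> {u1, v0, a}" "adj v0 w \<longleftrightarrow> w \<in> {u0, v1, b}"
    "adj u1 w \<longleftrightarrow> w \<in> {u0, v1, c}" "adj v1 w \<longleftrightarrow> w \<in> {u1, v0, e}" for w
    using nb by blast+
  have "square u1 c e v1"
    using A ce dst adj_sym unfolding square_def by auto
  then obtain a' b' c' e' where o: "{w. adj u1 w} = {c, v1, a'}" "{w. adj v1 w} = {u1, e, b'}"
    "{w. adj c w} = {u1, e, c'}" "{w. adj e w} = {c, v1, e'}"
    "distinct [u1, c, v1, e, a', b', c', e']" "set [u1, c, v1, e, a', b', c', e'] \<subseteq> V"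
    by (rule square_outer)
  have "adj u1 a'" "adj v1 b'" using o(1,2) by blast+
  then have a': "a' = u0" and b': "b' = v0" using A o(5) by auto
  have sq': "square_nbrs u1 c v1 e u0 v0 c' e'"
    unfolding square_nbrs_def using o unfolding a' b' by simp
  have "adj c' e'"
  proof (rule disjE[OF square_extends[OF sq' ng]])
    \<comment> \<open>If the new square is instead continued sideways, then \<open>c'\<close> and
      \<open>e'\<close> are the third neighbours of \<open>u0\<close> and \<open>v0\<close>, that is
      \<open>a\<close> and \<open>b\<close>, which are adjacent.\<close>
    assume "adj u0 c' \<and> adj v0 e'"
    then have "c' = a" "e' = b" using A o(5) a' b' by auto
    then show ?thesis using ab by simp
  qed simp
  then show ?thesis using that[OF sq'] A by simp
qed

lemma strip_exists:
  assumes "square p q r s" and ng: "\<And>x y. \<not> good x y"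
  obtains U W where "strip U W"
proof -
  obtain a b c e where o: "{w. adj p w} = {q, s, a}" "{w. adj s w} = {p, r, b}"
    "{w. adj q w} = {p, r, c}" "{w. adj r w} = {q, s, e}"
    "distinct [p, q, s, r, a, b, c, e]" "set [p, q, s, r, a, b, c, e] \<subseteq> V"
    using square_outer[OF assms(1)] .
  have sq: "square_nbrs p q s r a b c e"
    unfolding square_nbrs_def using o by simp
  \<comment> \<open>A state is a square with its forward rung \<open>c e\<close>; the backward rung
    is existentially quantified. \<open>Q\<close> glues consecutive states along a rung, so that the
    states reduce to two sequences.\<close>
  define P where "P = (\<lambda>(n::nat) (u0, u1, v0, v1, c, e).
     \<exists>a b. square_nbrs u0 u1 v0 v1 a b c e \<and> adj a b \<and> adj c e)"
  define Q where "Q = (\<lambda>(n::nat) (u0::'a, u1::'a, v0::'a, v1::'a, c::'a, e::'a)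
     (u0', u1', v0', v1', c'::'a, e'::'a). u0' = u1 \<and> v0' = v1 \<and> u1' = c \<and> v1' = e)"
  have "\<exists>f. \<forall>n. P n (f n) \<and> Q n (f n) (f (Suc n))"
  proof (rule dependent_nat_choice)
    show "\<exists>x. P 0 x"
    proof (rule disjE[OF square_extends[OF sq ng]])
      assume "adj a b \<and> adj c e"
      then have "P 0 (p, q, s, r, c, e)" using sq unfolding P_def by auto
      then show ?thesis by blast
    next
      assume "adj a c \<and> adj b e"
      then have "P 0 (p, s, q, r, b, e)" using square_nbrs_transpose[OF sq] unfolding P_def by auto
      then show ?thesis by blast
    qed
  next
    fix x n assume "P n x"
    obtain u0 u1 v0 v1 c e where x: "x = (u0, u1, v0, v1, c, e)" by (metis prod_cases6)
    obtain a b where "square_nbrs u0 u1 v0 v1 a b c e" "adj a b" "adj c e"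
      using \<open>P n x\<close> unfolding x P_def by auto
    then obtain c' e' where "square_nbrs u1 c v1 e u0 v0 c' e'" "adj u0 v0" "adj c' e'"
      using strip_step ng by metis
    then have "P (Suc n) (u1, c, v1, e, c', e')" unfolding P_def by auto
    then show "\<exists>y. P (Suc n) y \<and> Q n x y" unfolding x Q_def by auto
  qed
  then obtain f where f: "P n (f n)" "Q n (f n) (f (Suc n))" for n by blast
  define U W where "U n = fst (f n)" and "W n = fst (snd (snd (f n)))" for n
  have eq: "f n = (U n, U (Suc n), W n, W (Suc n), U (Suc (Suc n)), W (Suc (Suc n)))" for n
    using f(2)[of n] f(2)[of "Suc n"] unfolding Q_def U_def W_def
    by (auto simp: split_beta prod_eq_iff)
  have "strip U W"
    unfolding strip_def
  proof
    fix n
    obtain a b where s: "square_nbrs (U n) (U (Suc n)) (W n) (W (Suc n)) a b (U (Suc (Suc n))) (W (Suc (Suc n)))"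
      using f(1)[of n] unfolding P_def eq by auto
    have "distinct [U n, U (Suc n), W n, W (Suc n), a, b, U (Suc (Suc n)), W (Suc (Suc n))]"
      using square_nbrsD(1)[OF s] .
    moreover have "adj (U n) (U (Suc n))" "adj (U n) (W n)" using square_nbrsD(3)[OF s] by blast+
    moreover have "adj (W n) (W (Suc n))" using square_nbrsD(4)[OF s] by blast
    ultimately show "adj (U n) (U (Suc n)) \<and> adj (W n) (W (Suc n)) \<and> adj (U n) (W n) \<and>
     distinct [U n, U (Suc n), W n, W (Suc n), U (Suc (Suc n)), W (Suc (Suc n))]" by simp
  qed
  then show ?thesis using that by blast
qed

lemma strip_nbrs:
  assumes "strip U W"
  shows "{w. adj (U (Suc n)) w} = {U n, U (Suc (Suc n)), W (Suc n)}"
    "{w. adj (W (Suc n)) w} = {W n, W (Suc (Suc n)), U (Suc n)}"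
proof -
  have A: "adj (U n) (U (Suc n))" "adj (W n) (W (Suc n))" "adj (U n) (W n)"
    "distinct [U n, U (Suc n), W n, W (Suc n), U (Suc (Suc n)), W (Suc (Suc n))]" for n
    using assms unfolding strip_def by blast+
  have V: "U (Suc n) \<in> V" "W (Suc n) \<in> V" using A(1)[of "Suc n"] A(2)[of "Suc n"] adj_V by auto
  show "{w. adj (U (Suc n)) w} = {U n, U (Suc (Suc n)), W (Suc n)}"
    by (rule card3_eq[OF deg3[OF V(1)]])
      (use A(1)[of n] A(1)[of "Suc n"] A(3)[of "Suc n"] A(4)[of n] A(4)[of "Suc n"] adj_sym in auto)
  show "{w. adj (W (Suc n)) w} = {W n, W (Suc (Suc n)), U (Suc n)}"
    by (rule card3_eq[OF deg3[OF V(2)]])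
      (use A(2)[of n] A(2)[of "Suc n"] A(3)[of "Suc n"] A(4)[of n] A(4)[of "Suc n"] adj_sym in auto)
qed

text \<open>How rung \<open>k\<close> is identified with rung 0 is left open, since the strip may
  close up straight, as a ladder, or with a twist, as a Moebius ladder.\<close>

definition closed_strip :: "nat \<Rightarrow> (nat \<Rightarrow> 'a) \<Rightarrow> (nat \<Rightarrow> 'a) \<Rightarrow> bool" where
  "closed_strip k U W \<longleftrightarrow> 4 \<le> k \<and> card V = 2 * k \<and>
     inj_on U {..<k} \<and> inj_on W {..<k} \<and> U ` {..<k} \<inter> W ` {..<k} = {} \<and>
     V = U ` {..<k} \<union> W ` {..<k} \<and>
     (\<forall>i. adj (U i) (U (Suc i)) \<and> adj (W i) (W (Suc i)) \<and> adj (U i) (W i))"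

text \<open>Take the first rung \<open>L k\<close> that meets an earlier one. Inner rungs have no
  free neighbour left, so it meets \<open>L 0\<close>, and in fact equals it. The rungs up to there
  are then closed under adjacency and exhaust the graph, because a proper part would be separated by
  an empty cut.\<close>

lemma strip_closes:
  assumes st: "strip U W"
  obtains k where "closed_strip k U W" "U k = U 0 \<and> W k = W 0 \<or> U k = W 0 \<and> W k = U 0"
proof -
  have A: "adj (U n) (U (Suc n))" "adj (W n) (W (Suc n))" "adj (U n) (W n)"
    "distinct [U n, U (Suc n), W n, W (Suc n), U (Suc (Suc n)), W (Suc (Suc n))]" for n
    using st unfolding strip_def by blast+
  note N = strip_nbrs[OF st]
  define L where "L n = {U n, W n}" for n
  have LV: "L n \<subseteq> V" for n using A(1,2)[of n] adj_V by (auto simp: L_def)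
  have nbL: "w \<in> L n \<union> L (Suc n) \<union> L (Suc (Suc n))" if "x \<in> L (Suc n)" "adj x w" for x w n
    using that N[of n] by (auto simp: L_def)
  have succ: "\<exists>z\<in>L (Suc n). adj x z" if "x \<in> L n" for x n
    using that A(1,2)[of n] by (auto simp: L_def)
  have pred: "\<exists>z\<in>L n. adj x z" if "x \<in> L (Suc n)" for x n
    using that A(1,2)[of n] adj_sym by (auto simp: L_def)
  have partner: "\<exists>z\<in>L n. adj x z \<and> L n = {x, z}" if "x \<in> L n" for x n
    using that A(3)[of n] adj_sym by (auto simp: L_def)
  have L1: "L n \<inter> L (Suc n) = {}" and L2: "L n \<inter> L (Suc (Suc n)) = {}" for n
    using A(4)[of n] by (auto simp: L_def)
  have "\<exists>n. \<exists>j<n. L n \<inter> L j \<noteq> {}"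
  proof (rule ccontr)
    assume no: "\<not> ?thesis"
    have "inj U"
    proof (rule injI, rule ccontr)
      fix i j assume "U i = U j" "i \<noteq> j"
      then have "L i \<inter> L j \<noteq> {}" "L j \<inter> L i \<noteq> {}" by (auto simp: L_def)
      then show False using no \<open>i \<noteq> j\<close> by (metis linorder_neqE_nat)
    qed
    moreover have "range U \<subseteq> V" using LV by (auto simp: L_def)
    ultimately show False using finV by (meson finite_subset range_inj_infinite)
  qed
  then obtain k where k: "\<exists>j<k. L k \<inter> L j \<noteq> {}" and
    kmin: "\<And>n. n < k \<Longrightarrow> \<not> (\<exists>j<n. L n \<inter> L j \<noteq> {})"
    using exists_least_iff[of "\<lambda>n. \<exists>j<n. L n \<inter> L j \<noteq> {}"] by auto
  have disj: "L i \<inter> L j = {}" if "i < k" "j < k" "i \<noteq> j" for i j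
    using kmin that by (metis Int_commute linorder_neqE_nat)
  have far: "Suc (Suc (Suc j)) \<le> k" if "j < k" "L k \<inter> L j \<noteq> {}" for j
    using that L1[of j] L2[of j] by (metis Int_commute Suc_leI le_neq_implies_less)
  \<comment> \<open>A vertex of \<open>L j\<close> with \<open>j > 0\<close> has all its neighbours
    in the rungs \<open>j - 1\<close>, \<open>j\<close>, \<open>j + 1\<close>, which by
    \<open>far\<close> come before rung \<open>k - 1\<close>; but as a vertex of \<open>L k\<close>
    it has a neighbour in rung \<open>k - 1\<close>.\<close>
  have j0: "j = 0" if jx: "j < k" "x \<in> L k" "x \<in> L j" for j x
  proof (rule ccontr)
    assume "j \<noteq> 0"
    then obtain i where i: "j = Suc i" by (cases j) auto
    have f: "Suc (Suc (Suc j)) \<le> k" using far[of j] that by auto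
    then obtain k' where k': "k = Suc k'" by (cases k) auto
    obtain z where "z \<in> L k'" "adj x z" using pred[of x k'] jx k' by auto
    moreover from this have "z \<in> L i \<union> L (Suc i) \<union> L (Suc (Suc i))" using nbL[of x i z] jx i by auto
    ultimately show False
      using disj[of k' i] disj[of k' "Suc i"] disj[of k' "Suc (Suc i)"] f i k' by auto
  qed
  obtain x where x: "x \<in> L k" "x \<in> L 0" using k j0 by blast
  then have "L k \<inter> L 0 \<noteq> {}" by blast
  moreover have "0 < k" using k by auto
  ultimately have k3: "3 \<le> k" using far[of 0] by auto
  then obtain k' where k': "k = Suc k'" "k' \<ge> 2" by (cases k) auto
  have N0: "\<exists>y z x1. L 0 = {x, y} \<and> x1 \<in> L 1 \<and> z \<in> L k' \<and> {w. adj x w} = {y, x1, z}"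
    if x: "x \<in> L k" "x \<in> L 0" for x
  proof -
    obtain y where y: "y \<in> L 0" "adj x y" "L 0 = {x, y}" using partner[OF x(2)] by auto
    obtain x1 where x1: "x1 \<in> L 1" "adj x x1" using succ[OF x(2)] by auto
    obtain z where z: "z \<in> L k'" "adj x z" using pred[of x k'] x k' by auto
    have "distinct [y, x1, z]"
      using y x1 z disj[of 0 1] disj[of 0 k'] disj[of 1 k'] k' by auto
    then have "{w. adj x w} = {y, x1, z}"
      using y x1 z x LV by (intro card3_eq[OF deg3]) auto
    then show ?thesis using y x1 z by blast
  qed
  \<comment> \<open>The partner \<open>y'\<close> of \<open>x\<close> in rung \<open>k\<close> is
    one of its three neighbours: the partner \<open>y\<close> in rung 0, one in rung 1, one in rung
    \<open>k - 1\<close>. The last two would make rung \<open>k\<close> meet a forbidden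
    rung.\<close>
  have Lk: "L k = L 0"
  proof -
    obtain y z x1 where n: "L 0 = {x, y}" "x1 \<in> L 1" "z \<in> L k'" "{w. adj x w} = {y, x1, z}"
      using N0[OF x] by blast
    obtain y' where y': "y' \<in> L k" "adj x y'" "L k = {x, y'}" using partner[OF x(1)] by auto
    have "y' \<noteq> x1" using j0[of 1 y'] y' n k3 by auto
    moreover have "y' \<noteq> z" using y' n L1[of k'] k' by auto
    ultimately have "y' = y" using y' n by auto
    then show ?thesis using n y' by simp
  qed
  let ?L = "\<Union>i<k. L i"
  have LU: "?L = U ` {..<k} \<union> W ` {..<k}" by (auto simp: L_def)
  have closed: "w \<in> ?L" if yw: "y \<in> ?L" "adj y w" for y w
  proof -
    obtain i where i: "i < k" "y \<in> L i" using yw(1) by auto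
    show ?thesis
    proof (cases i)
      case 0
      then obtain y' z x1 where n: "L 0 = {y, y'}" "x1 \<in> L 1" "z \<in> L k'" "{w. adj y w} = {y', x1, z}"
        using N0[of y] i Lk by blast
      then have "w \<in> L 0 \<union> L 1 \<union> L k'" using yw(2) by blast
      moreover have "0 < k" "1 < k" "k' < k" using k' by auto
      ultimately show ?thesis by blast
    next
      case (Suc j)
      then have "w \<in> L j \<union> L (Suc j) \<union> L (Suc (Suc j))" using nbL[of y j w] i yw(2) by blast
      moreover have "j < k" "Suc j < k" using Suc i(1) by auto
      moreover have "L (Suc (Suc j)) \<subseteq> ?L"
      proof (cases "Suc (Suc j) = k")
        case True
        moreover have "0 < k" using i(1) by simp
        ultimately show ?thesis using Lk by blast
      next
        case False
        then have "Suc (Suc j) < k" using Suc i(1) by simp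
        then show ?thesis by blast
      qed
      ultimately show ?thesis by blast
    qed
  qed
  have injU: "inj_on U {..<k}" "inj_on W {..<k}" "U ` {..<k} \<inter> W ` {..<k} = {}"
  proof -
    show "inj_on U {..<k}"
      using disj by (force simp: inj_on_def L_def)
    show "inj_on W {..<k}"
      using disj by (force simp: inj_on_def L_def)
    have "U i \<noteq> W j" if "i < k" "j < k" for i j
      using disj[of i j] that A(4)[of i] by (cases "i = j") (auto simp: L_def)
    then show "U ` {..<k} \<inter> W ` {..<k} = {}" by auto
  qed
  have cL: "card ?L = 2 * k"
    unfolding LU using injU by (simp add: card_Un_disjoint card_image)
  have LV': "?L \<subseteq> V" using LV by auto
  \<comment> \<open>By \<open>cut4\<close> at most one vertex lies outside, and a single one would
    need neighbours in the closed set.\<close>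
  have "cut_size ?L = 0"
    unfolding cut_size_def using fin[OF LV'] finV closed by (subst links_0) auto
  then have "\<not> 2 \<le> card (V - ?L)" using cut4[OF LV'] cL k3 by auto
  moreover have "card (V - ?L) \<noteq> 1"
  proof
    assume "card (V - ?L) = 1"
    then obtain w where w: "V - ?L = {w}" using card_1_singletonE by blast
    then have "card {z. adj w z} = 3" using deg3 by auto
    then obtain z where "adj w z" by fastforce
    moreover from this have "z \<noteq> w" "z \<in> V" using adj_neq adj_V2 by auto
    ultimately show False using closed[of z w] adj_sym w by blast
  qed
  ultimately have "card (V - ?L) = 0" by linarith
  then have VL: "V = ?L" using LV' finV by auto
  then have cV: "card V = 2 * k" using cL by simp
  have "closed_strip k U W"
    unfolding closed_strip_def using cV card8 injU VL LU A(1-3) by auto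
  moreover have "U k = U 0 \<and> W k = W 0 \<or> U k = W 0 \<and> W k = U 0"
    using Lk A(4)[of 0] A(4)[of k] unfolding L_def by (auto simp: doubleton_eq_iff)
  ultimately show ?thesis using that by blast
qed

end

section \<open>Graphs without squares\<close>

context cyc4_adj8
begin

text \<open>A smallest side \<open>A\<close> of a 4-edge-cut: an edge inside \<open>A\<close> that is crossed by another such cut
  \<open>B\<close> has an end on the boundary of \<open>A\<close>, because in the non-trivial case the four corners of the
  two cuts have degrees 5, 3, 5, 3.\<close>

lemma crossing_edge_boundary_aux:
  assumes A: "A \<subseteq> V" "cut_size A = 4" "6 \<le> card A" "4 \<le> card (V - A)"
    and min: "\<And>X. X \<subseteq> V \<Longrightarrow> cut_size X = 4 \<Longrightarrow> 4 \<le> card X \<Longrightarrow> 4 \<le> card (V - X) \<Longrightarrow> card A \<le> card X"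
    and B: "B \<subseteq> V" "cut_size B = 4" "4 \<le> card B" "4 \<le> card (V - B)"
    and y: "y \<in> A" "y \<notin> B" and P3: "3 \<le> card (A \<inter> B)"
  shows "A - B = {y} \<and> 1 \<le> links {y} (V - A)"
proof -
  define P Q R S where "P = A \<inter> B" and "Q = A - B" and "R = B - A" and "S = V - A - B"
  note defs = P_def Q_def R_def S_def
  have sub: "P \<subseteq> V" "Q \<subseteq> V" "R \<subseteq> V" "S \<subseteq> V" using A B by (auto simp: defs)
  note f = fin[OF sub(1)] fin[OF sub(2)] fin[OF sub(3)] fin[OF sub(4)]
  have dj: "P \<inter> Q = {}" "P \<inter> R = {}" "P \<inter> S = {}" "Q \<inter> R = {}" "Q \<inter> S = {}" "R \<inter> S = {}"
    by (auto simp: defs)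
  have eA: "A = P \<union> Q" "V - A = R \<union> S" and eB: "B = P \<union> R" "V - B = Q \<union> S"
    using A B by (auto simp: defs)
  have cards: "card A = card P + card Q" "card (V - A) = card R + card S"
    "card B = card P + card R" "card (V - B) = card Q + card S"
    unfolding eA(2) eB(2) using f dj by (simp_all add: eA(1) eB(1) card_Un_disjoint)
  have split4: "links (X1 \<union> X2) (Y1 \<union> Y2) = links X1 Y1 + links X1 Y2 + links X2 Y1 + links X2 Y2"
    if "finite X1" "finite X2" "finite Y1" "finite Y2" "X1 \<inter> X2 = {}" "Y1 \<inter> Y2 = {}" for X1 X2 Y1 Y2
    using that by (simp add: links_Un_left links_Un_right)
  have "cut_size A = links (P \<union> Q) (R \<union> S)" unfolding cut_size_def eA(2) by (simp flip: eA(1))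
  then have dA: "links P R + links P S + links Q R + links Q S = 4" using A(2) split4 f dj by simp
  have "cut_size B = links (P \<union> R) (Q \<union> S)" unfolding cut_size_def eB(2) by (simp flip: eB(1))
  then have dB: "links P Q + links P S + links Q R + links R S = 4" using B(2) split4 f dj links_sym[of R Q] by simp
  have parts: "cut_size X = links X Y1 + links X Y2 + links X Y3"
    if "X \<subseteq> V" "V - X = Y1 \<union> (Y2 \<union> Y3)" "Y1 \<inter> (Y2 \<union> Y3) = {}" "Y2 \<inter> Y3 = {}" "finite Y2" "finite Y3"
    for X Y1 Y2 Y3
    using cut_size_parts[OF that(1-3)] links_Un_right[of Y2 Y3 X] that by simp
  have dP: "cut_size P = links P Q + links P R + links P S"
    using A B by (intro parts) (auto simp: defs f[unfolded defs])
  have "cut_size Q = links Q P + links Q R + links Q S"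
    using A B by (intro parts) (auto simp: defs f[unfolded defs])
  then have dQ: "cut_size Q = links P Q + links Q R + links Q S" using links_sym[of Q P] by linarith
  have "cut_size R = links R P + links R Q + links R S"
    using A B by (intro parts) (auto simp: defs f[unfolded defs])
  then have dR: "cut_size R = links P R + links Q R + links R S" using links_sym[of R P] links_sym[of R Q] by linarith
  have "cut_size S = links S P + links S Q + links S R"
    using A B by (intro parts) (auto simp: defs f[unfolded defs])
  then have dS: "cut_size S = links P S + links Q S + links R S"
    using links_sym[of S P] links_sym[of S Q] links_sym[of S R] by linarith
  have par: "even (cut_size P) = even (card P)" "even (cut_size Q) = even (card Q)"
      "even (cut_size R) = even (card R)" "even (cut_size S) = even (card S)" "even (card A)" "even (card B)"
      "even (card (V - A))" "even (card (V - B))"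
    using even_cut_size[OF sub(1)] even_cut_size[OF sub(2)] even_cut_size[OF sub(3)] even_cut_size[OF sub(4)]
      even_cut_size[OF A(1)] even_cut_size[OF B(1)] A(2) B(2) cut_size_compl[OF A(1)] cut_size_compl[OF B(1)]
      even_cut_size[of "V - A"] even_cut_size[of "V - B"] by simp_all
  have Q1: "card Q \<ge> 1" using y f by (auto simp: Q_def Suc_le_eq card_gt_0_iff)
  have P3': "3 \<le> card P" using P3 by (simp add: P_def)
  have cPV: "card P + card (V - P) = card V" "card Q + card (V - Q) = card V"
    "card R + card (V - R) = card V" "card S + card (V - S) = card V" "card A + card (V - A) = card V"
    using card_compl sub A(1) by auto
  \<comment> \<open>\<open>P\<close> is a proper part of \<open>A\<close>, so a cut size of four
    contradicts minimality, once parity has raised its three vertices to four.\<close>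
  have smallP: "cut_size P \<noteq> 4"
  proof
    assume P4: "cut_size P = 4"
    then have "even (card P)" using par(1) by simp
    then have "4 \<le> card P" using P3' by presburger
    moreover have "4 \<le> card (V - P)" using cPV(1,5) cards(1) A(4) by linarith
    ultimately show False using min[OF sub(1) P4] cards(1) Q1 by linarith
  qed
  have dP5: "cut_size P \<ge> 5" using cut4[OF sub(1)] smallP P3' cPV cards A by linarith
  have Rne: "card R \<ge> 1"
  proof (rule ccontr)
    assume "\<not> ?thesis"
    then have "card R = 0" by linarith
    then have "R = {}" using f(3) by simp
    then have "B \<subseteq> A" by (auto simp: R_def)
    then have "card B < card A" using y fin[OF A(1)] by (intro psubset_card_mono) auto
    then show False using min[of B] B by linarith
  qed
  have Sne: "card S \<ge> 1"
  proof (rule ccontr)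
    assume "\<not> ?thesis"
    then have "card (V - B) < card A" using cards P3' by linarith
    then show False using min[of "V - B"] B cut_size_compl[OF B(1)] cPV card_compl[of B]
      by (simp add: double_diff)
  qed
  have g: "card X \<ge> 1 \<Longrightarrow> card (V - X) \<ge> 2 \<Longrightarrow> X \<subseteq> V \<Longrightarrow> cut_size X \<ge> 3 \<and> (card X \<ge> 2 \<longrightarrow> cut_size X \<ge> 4)" for X
    using cut_size_ge3[of X] cut4[of X] by (cases "X = {}") auto
  have gS: "cut_size S \<ge> 3 \<and> (card S \<ge> 2 \<longrightarrow> cut_size S \<ge> 4)" using g[OF Sne _ sub(4)] cPV cards A P3' by linarith
  have gQ: "cut_size Q \<ge> 3 \<and> (card Q \<ge> 2 \<longrightarrow> cut_size Q \<ge> 4)" using g[OF Q1 _ sub(2)] cPV cards A P3' by linarith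
  have gR: "cut_size R \<ge> 3 \<and> (card R \<ge> 2 \<longrightarrow> cut_size R \<ge> 4)" using g[OF Rne _ sub(3)] cPV cards A P3' by linarith
  \<comment> \<open>Submodularity of cuts with its exact defect. The bounds 5 for \<open>P\<close>
    and 3 for \<open>S\<close> already exhaust the 8 here.\<close>
  have s1: "cut_size P + cut_size S + 2 * links Q R = 8" using dA dB dP dS by linarith
  have s2: "cut_size Q + cut_size R + 2 * links P S = 8" using dA dB dQ dR by linarith
  have "cut_size S = 3" "cut_size P = 5" "links Q R = 0" using s1 gS dP5 by linarith+
  then have cS: "card S = 1" using gS Sne by linarith
  then have "card R \<ge> 3" using cards A by linarith
  then have "cut_size R \<ge> 4" using gR by linarith
  then have "cut_size Q \<le> 4" using s2 by linarith
  moreover have "odd (card Q)" using par(1,5) \<open>cut_size P = 5\<close> cards(1) by simp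
  then have "odd (cut_size Q)" using par(2) by simp
  moreover have "3 \<le> cut_size Q" using gQ by simp
  moreover from \<open>odd (cut_size Q)\<close> have "cut_size Q \<noteq> 4" by auto
  ultimately have "cut_size Q = 3" by linarith
  then have "card Q = 1" using gQ Q1 by linarith
  then obtain z where "Q = {z}" using card_1_singletonE by blast
  moreover have "y \<in> Q" using y by (simp add: Q_def)
  ultimately have Qy: "Q = {y}" by simp
  \<comment> \<open>In \<open>cut_size Q + cut_size S = 6\<close> the term \<open>links Q S\<close>
    occurs twice and the remaining terms are those of \<open>dB\<close>, so
    \<open>4 + 2 * links Q S = 6\<close>.\<close>
  have "links Q S \<ge> 1"
    using dB dQ dS \<open>cut_size Q = 3\<close> \<open>cut_size S = 3\<close> \<open>links Q R = 0\<close> by linarith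
  moreover have "links {y} (V - A) = links Q R + links Q S" unfolding eA(2) Qy[symmetric]
    using f dj by (simp add: links_Un_right)
  ultimately show ?thesis using Qy by (simp add: Q_def)
qed

text \<open>Six vertices put at least three of \<open>A\<close> on one side of \<open>B\<close>.
  Replacing \<open>B\<close> by its complement exchanges the roles of \<open>x\<close> and
  \<open>y\<close>.\<close>

lemma crossing_edge_boundary:
  assumes A: "A \<subseteq> V" "cut_size A = 4" "6 \<le> card A" "4 \<le> card (V - A)"
    and min: "\<And>X. X \<subseteq> V \<Longrightarrow> cut_size X = 4 \<Longrightarrow> 4 \<le> card X \<Longrightarrow> 4 \<le> card (V - X) \<Longrightarrow> card A \<le> card X"
    and xy: "x \<in> A" "y \<in> A" and nr: "\<not> removable x y"
  shows "1 \<le> links {x} (V - A) \<or> 1 \<le> links {y} (V - A)"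
proof -
  obtain B where B: "B \<subseteq> V" "x \<in> B" "y \<notin> B" "4 \<le> card B" "4 \<le> card (V - B)" "cut_size B = 4"
    using nr unfolding removable_def by blast
  have "A = (A \<inter> B) \<union> (A - B)" "(A \<inter> B) \<inter> (A - B) = {}" by auto
  then have "card A = card (A \<inter> B) + card (A - B)"
    using fin[OF A(1)] by (metis card_Int_Diff)
  then consider "3 \<le> card (A \<inter> B)" | "3 \<le> card (A - B)" using A(3) by linarith
  then show ?thesis
  proof cases
    case 1
    then show ?thesis
      using crossing_edge_boundary_aux[OF A min B(1,6,4,5) xy(2) B(3)] by blast
  next
    case 2
    have e: "A \<inter> (V - B) = A - B" "V - (V - B) = B" using A(1) B(1) by auto
    have "A - (V - B) = {x} \<and> 1 \<le> links {x} (V - A)"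
      using B 2 xy cut_size_compl[OF B(1)] by (intro crossing_edge_boundary_aux[OF A min]) (auto simp: e)
    then show ?thesis by blast
  qed
qed

text \<open>Dominoes need squares, so without good edges no edge is removable, which yields a 4-cut;
  let \<open>A\<close> be a smallest side. With four vertices \<open>A\<close> spans four edges and
  no triangle, hence a square. Otherwise the vertices \<open>I\<close> of \<open>A\<close> off its
  boundary \<open>D\<close> are independent, since an edge among them would be crossed by a 4-cut
  and so reach the boundary. Counting leaves two vertices in \<open>I\<close> and four in
  \<open>D\<close>; two triples of neighbours among four vertices share two, and that is a
  square.\<close>

lemma good_of_no_square:
  assumes no: "\<And>p q r s. \<not> square p q r s"
  shows "\<exists>x y. good x y"
proof (rule ccontr)
  assume ng: "\<not> ?thesis"
  have nd: "\<not> domino_rung x y" if "adj x y" for x y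
  proof
    assume "domino_rung x y"
    then obtain p r where "adj x p" "p \<noteq> y" "adj y r" "r \<noteq> x" "adj p r"
      unfolding domino_rung_def by blast
    then have "square x p r y" using that adj_sym unfolding square_def by blast
    then show False using no by blast
  qed
  then have nr: "\<not> removable x y" if "adj x y" for x y
    using ng that unfolding good_def by blast
  have "V \<noteq> {}" using card8 by auto
  then obtain x where "x \<in> V" by blast
  then have "card {w. adj x w} = 3" by (rule deg3)
  then obtain y where "adj x y" by fastforce
  then obtain B where "B \<subseteq> V" "4 \<le> card B" "4 \<le> card (V - B)" "cut_size B = 4"
    using nr[of x y] unfolding removable_def by blast
  then have ex: "\<exists>X. X \<subseteq> V \<and> cut_size X = 4 \<and> 4 \<le> card X \<and> 4 \<le> card (V - X)" by blast
  obtain A where A: "A \<subseteq> V" "cut_size A = 4" "4 \<le> card A" "4 \<le> card (V - A)"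
    and min: "\<And>X. X \<subseteq> V \<Longrightarrow> cut_size X = 4 \<Longrightarrow> 4 \<le> card X \<Longrightarrow> 4 \<le> card (V - X) \<Longrightarrow> card A \<le> card X"
    using ex_has_least_nat[of "\<lambda>X. X \<subseteq> V \<and> cut_size X = 4 \<and> 4 \<le> card X \<and> 4 \<le> card (V - X)" _ card] ex
    by (metis (no_types, lifting))
  have even_A: "even (card A)" using even_cut_size[OF A(1)] A(2) by simp
  have fA: "finite A" by (rule fin[OF A(1)])
  define D I where "D = {v \<in> A. 1 \<le> links {v} (V - A)}" and "I = A - D"
  have DI: "A = D \<union> I" "D \<inter> I = {}" "D \<subseteq> A" "I \<subseteq> A" "finite D" "finite I" "D \<subseteq> V" "I \<subseteq> V"
    using fA A(1) by (auto simp: D_def I_def)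
  have msum: "links X Y = (\<Sum>x\<in>X. links {x} Y)" for X Y by (simp add: links_def)
  have I0: "links I (V - A) = 0" unfolding msum[of I] by (rule sum.neutral) (auto simp: I_def D_def)
  have "links D (V - A) + links I (V - A) = 4"
    using A(2) DI links_Un_left[of D I] unfolding cut_size_def by simp
  then have D4: "links D (V - A) = 4" using I0 by simp
  have "card D \<le> links D (V - A)"
    unfolding msum[of D] using sum_bounded_below[of D 1 "\<lambda>x. links {x} (V - A)"] by (auto simp: D_def)
  then have cD: "card D \<le> 4" using D4 by simp
  have VA: "V = D \<union> (I \<union> (V - A))" "D \<inter> (I \<union> (V - A)) = {}" "I \<inter> (V - A) = {}"
    using DI A(1) by auto
  have mV: "links X V = links X D + links X I + links X (V - A)" for X
    using links_Un_right[of D "I \<union> (V - A)" X] links_Un_right[of I "V - A" X] VA DI finV by simp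
  have a1: "links D D + links D I + 4 = 3 * card D" using mV[of D] links_V[OF DI(7)] D4 by simp
  have a2: "links I D + links I I = 3 * card I" using mV[of I] links_V[OF DI(8)] I0 by simp
  have cA: "card A = card D + card I" using DI by (metis card_Un_disjoint)
  show False
  proof (cases "6 \<le> card A")
    case True
    have "links I I = 0"
    proof (subst links_0[OF DI(6,6)], intro ballI notI)
      fix x y assume xy: "x \<in> I" "y \<in> I" "adj x y"
      then have "1 \<le> links {x} (V - A) \<or> 1 \<le> links {y} (V - A)"
        using crossing_edge_boundary[OF A(1,2) True A(4) min _ _ nr[of x y]] DI by blast
      then show False using xy by (auto simp: I_def D_def)
    qed
    then have "links I D = 3 * card I" "3 * card I \<le> 3 * card D - 4"
      using a1 a2 links_sym[of D I] by linarith+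
    \<comment> \<open>The bound reads \<open>3 * card I <= 3 * card D - 4 <= 8\<close>, while
      \<open>card D + card I\<close> is at least six.\<close>
    then have c: "card D = 4" "card I = 2" using cD cA True by linarith+
    then obtain p q where pq: "I = {p, q}" "p \<noteq> q" by (meson card_2_iff)
    have nb: "{w. adj v w} \<subseteq> D" if "v \<in> I" for v
    proof
      fix w assume "w \<in> {w. adj v w}"
      then have vw: "adj v w" by simp
      have "w \<notin> I" using \<open>links I I = 0\<close> links_0[OF DI(6,6)] that vw by blast
      moreover have "w \<notin> V - A" using I0 links_0[OF DI(6), of "V - A"] finV that vw by blast
      ultimately show "w \<in> D" using VA(1) adj_V2[OF vw] by blast
    qed
    have "card ({w. adj p w} \<inter> {w. adj q w}) \<ge> 2"
    proof -
      have "card ({w. adj p w} \<union> {w. adj q w}) \<le> 4"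
        using card_mono[OF DI(5), of "{w. adj p w} \<union> {w. adj q w}"] nb pq c by auto
      moreover have "card {w. adj p w} = 3" "card {w. adj q w} = 3" using deg3 pq DI by auto
      ultimately show ?thesis
        using card_Un_Int[OF finite_nbrs[of p] finite_nbrs[of q]] by linarith
    qed
    then obtain r s where "r \<noteq> s" "{r, s} \<subseteq> {w. adj p w} \<inter> {w. adj q w}"
      by (metis card_2_iff obtain_subset_with_card_n)
    then have "square p r q s" using pq adj_sym unfolding square_def by auto
    then show False using no by blast
  next
    case False
    then have c: "card A = 4" using A(3) even_A by presburger
    then have "links A A = 8" using cut_size_plus_links[OF A(1)] A(2) by simp
    have "\<exists>p q r s. square p q r s"
    proof -
      obtain l where l: "A = set l" "distinct l" "length l = 4"
        using finite_distinct_list[OF fA] c distinct_card by metis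
      obtain w x y z where w: "l = [w, x, y, z]"
        using l(3) by (auto simp: numeral_eq_Suc length_Suc_conv)
      have dst: "distinct [w, x, y, z]" using l w by simp
      let ?b = "\<lambda>u v. of_bool (adj u v) :: nat"
      have S: "?b u v = ?b v u" for u v using adj_sym[of u v] adj_sym[of v u] by (auto simp: of_bool_def)
      have "links A A = 2 * (?b w x + ?b w y + ?b w z + ?b x y + ?b x z + ?b y z)"
        unfolding l(1) w links_def using dst S[of x w] S[of y w] S[of z w] S[of y x] S[of z x] S[of z y]
        by (simp add: adj_irrefl del: sum_of_bool_eq)
      then have e: "?b w x + ?b w y + ?b w z + ?b x y + ?b x z + ?b y z = 4" using \<open>links A A = 8\<close> by simp
      have t: "\<not> (adj w x \<and> adj x y \<and> adj w y)" "\<not> (adj w x \<and> adj x z \<and> adj w z)"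
        "\<not> (adj w y \<and> adj y z \<and> adj w z)" "\<not> (adj x y \<and> adj y z \<and> adj x z)"
        using no_triangle adj_sym by blast+
      \<comment> \<open>A graph with four vertices and four edges is a 4-cycle or a triangle with a
        pendant edge. The disjuncts are the three 4-cycles on four labelled vertices.\<close>
      have "(adj w x \<and> adj x y \<and> adj y z \<and> adj w z) \<or> (adj w x \<and> adj x z \<and> adj y z \<and> adj w y)
        \<or> (adj w y \<and> adj x y \<and> adj x z \<and> adj w z)"
        using e t by (simp add: of_bool_def split: if_splits)
      then show ?thesis using dst adj_sym unfolding square_def by (metis distinct_length_2_or_more)
    qed
    then show False using no by blast
  qed
qed

end

section \<open>Cycles as lists and cycle spread\<close>

fun ledges :: "'a list \<Rightarrow> 'a set set" where
  "ledges (u # v # xs) = insert {u, v} (ledges (v # xs))"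
| "ledges _ = {}"

lemma ledges_append: "ledges (xs @ y # ys) = ledges (xs @ [y]) \<union> ledges (y # ys)"
proof (induction xs rule: ledges.induct)
  case ("2_2" v)
  then show ?case by (cases ys) auto
qed auto

lemma ledges_rev: "ledges (rev xs) = ledges xs"
proof (induction xs rule: ledges.induct)
  case (1 u v xs)
  have "ledges (rev (u # v # xs)) = ledges (rev xs @ v # [u])" by simp
  also have "\<dots> = ledges (rev xs @ [v]) \<union> ledges [v, u]" by (rule ledges_append)
  also have "\<dots> = ledges (u # v # xs)" using 1 by (simp add: insert_commute)
  finally show ?case .
qed auto

lemma ledges_conv_nth: "ledges xs = {{xs ! i, xs ! Suc i} | i. Suc i < length xs}"
proof (induction xs rule: ledges.induct)
  case (1 u v xs)
  have "{{(u # v # xs) ! i, (u # v # xs) ! Suc i} | i. Suc i < length (u # v # xs)}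
    = insert {u, v} {{(v # xs) ! i, (v # xs) ! Suc i} | i. Suc i < length (v # xs)}" (is "?A = ?B")
  proof
    show "?A \<subseteq> ?B"
    proof
      fix e assume "e \<in> ?A"
      then obtain i where i: "Suc i < length (u # v # xs)" "e = {(u # v # xs) ! i, (u # v # xs) ! Suc i}"
        by blast
      then show "e \<in> ?B" by (cases i) auto
    qed
    show "?B \<subseteq> ?A"
    proof
      fix e assume "e \<in> ?B"
      then consider "e = {u, v}" | i where "Suc i < length (v # xs)" "e = {(v # xs) ! i, (v # xs) ! Suc i}"
        by blast
      then show "e \<in> ?A"
      proof cases
        case 1
        then show ?thesis by (auto intro!: exI[of _ 0])
      next
        case (2 i)
        then show ?thesis by (auto intro!: exI[of _ "Suc i"])
      qed
    qed
  qed
  then show ?case using 1 by simp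
qed auto

lemma ledges_subset_set: "e \<in> ledges xs \<Longrightarrow> e \<subseteq> set xs"
  by (induction xs rule: ledges.induct) auto

lemma ledges_split:
  "f \<in> ledges xs \<Longrightarrow> \<exists>ys u v zs. xs = ys @ u # v # zs \<and> f = {u, v}"
proof (induction xs rule: ledges.induct)
  case (1 u v xs)
  show ?case
  proof (cases "f = {u, v}")
    case True
    then show ?thesis by (metis append_Nil)
  next
    case False
    then obtain ys u' v' zs where "v # xs = ys @ u' # v' # zs" "f = {u', v'}" using 1 by auto
    then show ?thesis by (metis append_Cons)
  qed
qed auto

lemma ledges_map: "ledges (map g xs) = (`) g ` ledges xs"
  by (induction xs rule: ledges.induct) auto

text \<open>Repeating the head at the end unrolls the cycle into a walk, so that structural
  induction on \<open>ledges\<close> replaces indices modulo the length.\<close>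

lemma cycle_edges_Cons: "cycle_edges (x # xs) = ledges (x # xs @ [x])"
proof -
  have "{{(x # xs) ! i, (x # xs) ! (Suc i mod length (x # xs))} | i. i < length (x # xs)}
     = {{(x # xs @ [x]) ! i, (x # xs @ [x]) ! Suc i} | i. Suc i < length (x # xs @ [x])}"
  proof -
    have "(x # xs) ! i = (x # xs @ [x]) ! i \<and>
        (x # xs) ! (Suc i mod length (x # xs)) = (x # xs @ [x]) ! Suc i"
      if "i < length (x # xs)" for i
      using that nth_append[of "x # xs" "[x]" i] nth_append[of xs "[x]" i]
      by (cases "i = length xs") auto
    then have "{(x # xs) ! i, (x # xs) ! (Suc i mod length (x # xs))} = {(x # xs @ [x]) ! i, (x # xs @ [x]) ! Suc i}"
      if "i < length (x # xs)" for i using that by metis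
    moreover have "i < length (x # xs) \<longleftrightarrow> Suc i < length (x # xs @ [x])" for i by simp
    ultimately show ?thesis by blast
  qed
  then show ?thesis unfolding cycle_edges_def ledges_conv_nth .
qed

lemma cycle_edges_Nil [simp]: "cycle_edges [] = {}"
  by (simp add: cycle_edges_def)

lemma cycle_edges_rotate1: "cycle_edges (rotate1 xs) = cycle_edges xs"
proof (cases xs)
  case (Cons x ys)
  show ?thesis
  proof (cases ys)
    case (Cons y zs)
    have "cycle_edges (rotate1 (x # y # zs)) = ledges ((y # zs) @ x # [y])"
      by (simp add: cycle_edges_Cons)
    also have "\<dots> = ledges ((y # zs) @ [x]) \<union> ledges [x, y]" by (rule ledges_append)
    also have "\<dots> = cycle_edges (x # y # zs)" by (auto simp: cycle_edges_Cons)
    finally show ?thesis using \<open>xs = x # ys\<close> Cons by simp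
  qed (use Cons in simp)
qed simp

lemma cycle_edges_rotate: "cycle_edges (rotate n xs) = cycle_edges xs"
  by (induction n) (simp_all add: cycle_edges_rotate1)

lemma cycle_edges_rev: "cycle_edges (rev xs) = cycle_edges xs"
proof (cases xs)
  case (Cons x ys)
  have "rotate1 (x # rev ys) = rev xs" using Cons by simp
  then have "cycle_edges (rev xs) = cycle_edges (x # rev ys)"
    using cycle_edges_rotate1 by metis
  also have "\<dots> = ledges (rev (x # ys @ [x]))" by (simp add: cycle_edges_Cons)
  also have "\<dots> = cycle_edges xs" using Cons by (simp only: ledges_rev cycle_edges_Cons)
  finally show ?thesis .
qed simp

lemma cycle_edges_alt:
  assumes "xs \<noteq> []"
  shows "cycle_edges xs = insert {last xs, hd xs} (ledges xs)"
proof -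
  obtain x ys where xs: "xs = x # ys" using assms by (cases xs) auto
  obtain zs z where z: "xs = zs @ [z]" using assms by (metis append_butlast_last_id)
  have "xs @ [x] = zs @ z # [x]" using z by simp
  then have "cycle_edges xs = ledges (zs @ z # [x])"
    unfolding xs cycle_edges_Cons by (metis append_Cons xs)
  also have "\<dots> = ledges (zs @ [z]) \<union> ledges [z, x]" by (rule ledges_append)
  finally show ?thesis using xs z by (metis insert_is_Un last_snoc ledges.simps(1,3) list.sel(1) sup_commute)
qed

lemma is_cycle_rotate: "is_cycle G (rotate n xs) \<longleftrightarrow> is_cycle G xs"
  by (simp add: is_cycle_def cycle_edges_rotate)

lemma is_cycle_rev: "is_cycle G (rev xs) \<longleftrightarrow> is_cycle G xs"
  by (simp add: is_cycle_def cycle_edges_rev)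

text \<open>Rotate the cycle until \<open>e\<close> is its closing edge; then \<open>f\<close> cuts
  the list into \<open>P\<close> and \<open>R\<close>. If \<open>P\<close> is the longer part,
  reversing the whole list exchanges the two.\<close>

lemma cycle_through_two_edges_split:
  assumes "e \<in> cycle_edges ws" "f \<in> cycle_edges ws" "e \<noteq> f" "is_cycle G ws"
  obtains P R where "P \<noteq> []" "R \<noteq> []" "is_cycle G (P @ R)" "cycle_edges (P @ R) = cycle_edges ws"
    "length (P @ R) = length ws" "e = {hd P, last R}" "f = {last P, hd R}" "length P \<le> length R"
proof -
  obtain i where i: "i < length ws" "e = {ws ! i, ws ! (Suc i mod length ws)}"
    using assms(1) unfolding cycle_edges_def by blast
  define vs where "vs = rotate (Suc i) ws"
  have ne: "vs \<noteq> []" "ws \<noteq> []" using i by (auto simp: vs_def)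
  have h: "hd vs = ws ! (Suc i mod length ws)" unfolding vs_def by (rule hd_rotate_conv_nth[OF ne(2)])
  have "last vs = vs ! (length ws - 1)" using ne by (simp add: last_conv_nth vs_def)
  also have "\<dots> = ws ! ((Suc i + (length ws - 1)) mod length ws)"
    unfolding vs_def using ne by (intro nth_rotate) auto
  also have "Suc i + (length ws - 1) = i + length ws" using i by simp
  also have "(i + length ws) mod length ws = i" using i by simp
  finally have l: "last vs = ws ! i" .
  have e: "e = {hd vs, last vs}" using i h l by (simp add: insert_commute)
  have ce: "cycle_edges vs = cycle_edges ws" by (simp only: vs_def cycle_edges_rotate)
  have cy: "is_cycle G vs" using assms(4) unfolding vs_def by (simp only: is_cycle_rotate)
  have "f \<in> ledges vs"
    using assms(2,3) cycle_edges_alt[OF ne(1)] e unfolding ce[symmetric] by (simp add: insert_commute)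
  then obtain ys u v zs where s: "vs = ys @ u # v # zs" "f = {u, v}" using ledges_split by metis
  define P R where "P = ys @ [u]" and "R = v # zs"
  have PR: "vs = P @ R" "P \<noteq> []" "R \<noteq> []" "f = {last P, hd R}" using s by (auto simp: P_def R_def)
  have e': "e = {hd P, last R}" using e PR by simp
  have len: "length vs = length ws" by (simp add: vs_def)
  show ?thesis
  proof (cases "length P \<le> length R")
    case True
    then show ?thesis using that[of P R] PR e' cy ce len by simp
  next
    case False
    have r: "rev R @ rev P = rev vs" using PR by simp
    show ?thesis
    proof (rule that[of "rev R" "rev P"])
      show "is_cycle G (rev R @ rev P)" unfolding r is_cycle_rev by (rule cy)
      show "cycle_edges (rev R @ rev P) = cycle_edges ws" unfolding r cycle_edges_rev by (rule ce)
      show "length (rev R @ rev P) = length ws" using r len by (metis length_rev)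
      show "e = {hd (rev R), last (rev P)}" using e' PR by (simp add: hd_rev last_rev insert_commute)
      show "f = {last (rev R), hd (rev P)}" using PR by (simp add: hd_rev last_rev insert_commute)
    qed (use PR False in auto)
  qed
qed

text \<open>A spread below (1,2) is (0,j), where the edges share an end, or (1,1), where the
  smallest cycle has length four and its other two edges are those excluded by \<open>no\<close>.
  The given cycle ensures that a smallest one exists.\<close>

lemma cycle_spread_at_least_1_2:
  assumes cyc: "is_cycle G ws" "{a, b} \<in> cycle_edges ws" "{c, d} \<in> cycle_edges ws"
    and disj: "{a, b} \<inter> {c, d} = {}"
    and no: "\<And>p q r s. {a, b} = {p, s} \<Longrightarrow> {c, d} = {q, r} \<Longrightarrow> {p, q} \<in> edges G \<Longrightarrow> {r, s} \<in> edges G \<Longrightarrow> False"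
  shows "cycle_spread_at_least G {a, b} {c, d} (1, 2)"
proof -
  let ?e = "{a, b}" and ?f = "{c, d}"
  have ne: "?e \<noteq> ?f" using disj by blast
  define Q where "Q ws \<longleftrightarrow> is_cycle G ws \<and> ?e \<in> cycle_edges ws \<and> ?f \<in> cycle_edges ws" for ws
  obtain vs where vs: "Q vs" "\<And>us. Q us \<Longrightarrow> length vs \<le> length us"
    using ex_has_least_nat[of Q ws length] cyc unfolding Q_def by blast
  obtain P R where PR: "P \<noteq> []" "R \<noteq> []" "is_cycle G (P @ R)" "cycle_edges (P @ R) = cycle_edges vs"
    "length (P @ R) = length vs" "?e = {hd P, last R}" "?f = {last P, hd R}" "length P \<le> length R"
    using cycle_through_two_edges_split[of ?e vs ?f G] vs(1) ne unfolding Q_def by blast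
  have "smallest_cycle_through G ?e ?f (P @ R)"
    unfolding smallest_cycle_through_def using PR vs unfolding Q_def by metis
  then have "is_cycle_spread G ?e ?f (length P - 1, length R - 1)"
    unfolding is_cycle_spread_def using PR by blast
  moreover have "((1, 2), s) \<in> pair_leq" if s: "is_cycle_spread G ?e ?f s" for s
  proof -
    obtain P R where PR: "P \<noteq> []" "R \<noteq> []" "smallest_cycle_through G ?e ?f (P @ R)"
      "?e = {hd P, last R}" "?f = {last P, hd R}" "s = (length P - 1, length R - 1)" "length P \<le> length R"
      using s unfolding is_cycle_spread_def by blast
    have E: "cycle_edges (P @ R) \<subseteq> edges G"
      using PR(3) unfolding smallest_cycle_through_def is_cycle_def by blast
    have n1: "length P \<noteq> 1"
    proof
      assume "length P = 1"
      then have "hd P = last P" by (cases P) auto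
      then show False using PR(4,5) disj by blast
    qed
    have n0: "length P \<noteq> 0" using PR(1) by simp
    have n2: False if l2: "length P = 2" "length R = 2"
    proof -
      obtain p q where P: "P = [p, q]" using l2(1) by (auto simp: numeral_2_eq_2 length_Suc_conv)
      obtain r t where R: "R = [r, t]" using l2(2) by (auto simp: numeral_2_eq_2 length_Suc_conv)
      have "{p, q} \<in> edges G" "{r, t} \<in> edges G"
        using E P R cycle_edges_alt[of "P @ R"] by auto
      then show False using no[of p t q r] PR(4,5) P R by simp
    qed
    have "length P > 2 \<or> length P = 2 \<and> length R > 2"
    proof (cases "length P = 2")
      case True
      then have "length R \<noteq> 2" using n2 by blast
      then show ?thesis using True PR(7) by linarith
    qed (use n0 n1 in linarith)
    then show ?thesis unfolding PR(6) pair_leq_def pair_less_def by auto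
  qed
  ultimately show ?thesis unfolding cycle_spread_at_least_def by blast
qed

section \<open>Cyclic connectivity as a condition on cuts\<close>

abbreviation gadj :: "'a ugraph \<Rightarrow> 'a \<Rightarrow> 'a \<Rightarrow> bool" where
  "gadj G u v \<equiv> {u, v} \<in> edges G"

lemma simple_graph_edge:
  assumes "simple_graph G" "e \<in> edges G"
  obtains u v where "e = {u, v}" "u \<noteq> v" "u \<in> verts G" "v \<in> verts G"
proof -
  have "card e = 2" "e \<subseteq> verts G" using assms by (auto simp: simple_graph_def)
  then obtain u v where "e = {u, v}" "u \<noteq> v" by (meson card_2_iff)
  then show ?thesis using that \<open>e \<subseteq> verts G\<close> by auto
qed

lemma incident_edges_card:
  assumes "simple_graph G"
  shows "card {e \<in> edges G. v \<in> e} = card {w. gadj G v w}"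
proof -
  have "bij_betw (\<lambda>w. {v, w}) {w. gadj G v w} {e \<in> edges G. v \<in> e}"
  proof (rule bij_betw_imageI)
    show "inj_on (\<lambda>w. {v, w}) {w. gadj G v w}"
      by (auto intro!: inj_onI simp: doubleton_eq_iff)
    show "(\<lambda>w. {v, w}) ` {w. gadj G v w} = {e \<in> edges G. v \<in> e}"
    proof
      show "{e \<in> edges G. v \<in> e} \<subseteq> (\<lambda>w. {v, w}) ` {w. gadj G v w}"
      proof
        fix e assume e: "e \<in> {e \<in> edges G. v \<in> e}"
        then have "e \<in> edges G" by simp
        then obtain p q where "e = {p, q}" by (rule simple_graph_edge[OF assms])
        then have "e = {v, q} \<or> e = {v, p}" using e by auto
        then show "e \<in> (\<lambda>w. {v, w}) ` {w. gadj G v w}" using e by auto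
      qed
    qed auto
  qed
  then show ?thesis by (simp add: bij_betw_same_card)
qed

lemma gadj_verts:
  assumes "simple_graph G" "gadj G u v"
  shows "u \<noteq> v" "u \<in> verts G" "v \<in> verts G"
proof -
  have e: "{u, v} \<subseteq> verts G" "card {u, v} = 2" using assms by (auto simp: simple_graph_def)
  then show "u \<noteq> v" "u \<in> verts G" "v \<in> verts G" by auto
qed

lemma cubic_adj_gadj:
  assumes "simple_graph G" "cubic G"
  shows "cubic_adj (verts G) (gadj G)"
proof
  show "finite (verts G)" using assms(1) by (simp add: simple_graph_def)
  show "gadj G v u" if "gadj G u v" for u v using that by (simp add: insert_commute)
  show "\<not> gadj G u u" for u using gadj_verts(1)[OF assms(1)] by blast
  show "u \<in> verts G" if "gadj G u v" for u v using gadj_verts(2)[OF assms(1) that] .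
  show "card {w. gadj G v w} = 3" if "v \<in> verts G" for v
    using assms(2) that incident_edges_card[OF assms(1)] by (simp add: cubic_def)
qed

definition cut_edges :: "'a ugraph \<Rightarrow> 'a set \<Rightarrow> 'a set set" where
  "cut_edges G X = {{x, y} | x y. x \<in> X \<and> y \<in> verts G - X \<and> gadj G x y}"

section \<open>Small cuts leave a cycle on either side\<close>

context cubic_adj
begin

lemma links_card: "finite X \<Longrightarrow> finite Y \<Longrightarrow> links X Y = card {(x, y) \<in> X \<times> Y. adj x y}"
proof -
  assume f: "finite X" "finite Y"
  have "links X Y = (\<Sum>p\<in>X \<times> Y. of_bool (adj (fst p) (snd p)))"
    unfolding links_def by (simp add: sum.cartesian_product case_prod_unfold del: sum_of_bool_eq)
  also have "\<dots> = card ((X \<times> Y) \<inter> {p. adj (fst p) (snd p)})" using f by simp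
  also have "(X \<times> Y) \<inter> {p. adj (fst p) (snd p)} = {(x, y) \<in> X \<times> Y. adj x y}" by auto
  finally show ?thesis .
qed

text \<open>A vertex with at most one neighbour in \<open>X\<close> can be dropped from \<open>X\<close>: this makes the cut smaller.\<close>

lemma prune:
  assumes "X \<subseteq> V" "cut_size X \<le> 3" "3 \<le> card X"
  shows "\<exists>Y\<subseteq>X. Y \<noteq> {} \<and> (\<forall>v\<in>Y. 2 \<le> card ({w. adj v w} \<inter> Y))"
proof -
  define Q where "Q Y \<longleftrightarrow> Y \<subseteq> X \<and> cut_size Y \<le> 3 \<and> 2 \<le> card Y" for Y
  have "Q X" using assms by (simp add: Q_def)
  then obtain Y where Y: "Q Y" "\<And>Z. Q Z \<Longrightarrow> card Y \<le> card Z"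
    using ex_has_least_nat[of Q X card] by blast
  have YX: "Y \<subseteq> X" "cut_size Y \<le> 3" "2 \<le> card Y" and YV: "Y \<subseteq> V" using Y(1) assms(1) by (auto simp: Q_def)
  have f: "finite Y" by (rule fin[OF YV])
  have "card Y \<noteq> 2"
  proof
    assume c: "card Y = 2"
    then obtain p q where pq: "Y = {p, q}" "p \<noteq> q" by (meson card_2_iff)
    have "links Y Y \<le> 2" unfolding links_def pq(1) using pq(2)
      by (simp add: adj_irrefl del: sum_of_bool_eq)
    then show False using cut_size_plus_links[OF YV] c YX(2) by linarith
  qed
  then have Y3: "3 \<le> card Y" using YX by linarith
  have "2 \<le> card ({w. adj v w} \<inter> Y)" if v: "v \<in> Y" for v
  proof (rule ccontr)
    assume "\<not> ?thesis"
    then have small: "links {v} Y \<le> 1" using links_nbrs[OF f, of v] by simp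
    let ?Z = "Y - {v}"
    have Z: "?Z \<subseteq> V" "finite ?Z" "insert v ?Z = Y" "v \<notin> ?Z" using YV f v by auto
    have "links Y Y = links {v} Y + links ?Z Y" using links_insert[OF Z(2,4), of Y] Z(3) by simp
    moreover have "links ?Z Y = links ?Z ?Z + links {v} ?Z"
      using links_Un_right[of "{v}" ?Z ?Z] Z links_sym[of ?Z "{v}"] by simp
    moreover have "links {v} ?Z \<le> links {v} Y"
      using links_Un_right[of "{v}" ?Z "{v}"] Z by simp
    ultimately have "links Y Y \<le> links ?Z ?Z + 2" using small by linarith
    moreover have "card Y = Suc (card ?Z)" using Z by (metis card_insert_disjoint)
    ultimately have "cut_size ?Z \<le> 3" using cut_size_plus_links[OF Z(1)] cut_size_plus_links[OF YV] YX(2) by linarith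
    moreover have "card ?Z = card Y - 1" using v by simp
    ultimately have "Q ?Z" using YX Y3 by (auto simp: Q_def)
    then show False using Y(2)[of ?Z] \<open>card Y = Suc (card ?Z)\<close> by simp
  qed
  then show ?thesis using YX Y3 by (intro exI[of _ Y]) auto
qed

text \<open>On a longest path in \<open>Y\<close> all neighbours in \<open>Y\<close> of the first
  vertex lie on the path. One of them is not its successor, and the edge to it closes a cycle of
  length at least three.\<close>

lemma min_degree_2_cycle:
  assumes Y: "Y \<subseteq> V" "Y \<noteq> {}" "\<And>v. v \<in> Y \<Longrightarrow> 2 \<le> card ({w. adj v w} \<inter> Y)"
  obtains vs where "3 \<le> length vs" "distinct vs" "set vs \<subseteq> Y"
    "\<forall>e\<in>cycle_edges vs. \<exists>u v. e = {u, v} \<and> adj u v"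
proof -
  define Q where "Q p \<longleftrightarrow> p \<noteq> [] \<and> distinct p \<and> set p \<subseteq> Y \<and> successively adj p" for p
  have f: "finite Y" by (rule fin[OF Y(1)])
  obtain y where "y \<in> Y" using Y(2) by blast
  then have "Q [y]" by (simp add: Q_def)
  moreover have "length p < Suc (card Y)" if "Q p" for p
    using that card_mono[OF f, of "set p"] by (auto simp: Q_def distinct_card less_Suc_eq_le)
  ultimately obtain p where p: "Q p" "\<And>q. Q q \<Longrightarrow> length q \<le> length p"
    using ex_has_greatest_nat[of Q "[y]" length "Suc (card Y)"] by auto
  obtain v ps where vp: "p = v # ps" using p(1) by (cases p) (auto simp: Q_def)
  let ?N = "{w. adj v w} \<inter> Y"
  have "?N \<subseteq> set p"
  proof
    fix w assume w: "w \<in> ?N"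
    show "w \<in> set p"
    proof (rule ccontr)
      assume "w \<notin> set p"
      then have "Q (w # p)" using p(1) w adj_sym unfolding Q_def vp by auto
      then show False using p(2) by fastforce
    qed
  qed
  then have N: "?N \<subseteq> set ps" using vp adj_irrefl by auto
  have "2 \<le> card ?N" using Y(3) p(1) vp by (auto simp: Q_def)
  then have "\<not> ?N \<subseteq> {hd ps}" using card_mono[of "{hd ps}" ?N] by auto
  then obtain w where w: "adj v w" "w \<in> set ps" "w \<noteq> hd ps" using N by blast
  then obtain p1 p2 where ps: "ps = p1 @ w # p2" by (meson split_list)
  have p1: "p1 \<noteq> []" using w(3) ps by auto
  let ?vs = "v # p1 @ [w]"
  have succ: "successively adj ?vs"
  proof -
    have "successively adj ((v # p1 @ [w]) @ p2)" using p(1) unfolding Q_def vp ps by simp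
    then show ?thesis unfolding successively_append_iff[of _ "v # p1 @ [w]" p2] by blast
  qed
  have L: "\<exists>u v. e = {u, v} \<and> adj u v" if "e \<in> ledges xs" "successively adj xs" for e xs
    using that by (induction xs rule: ledges.induct) auto
  show ?thesis
  proof (rule that[of ?vs])
    show "3 \<le> length ?vs" using p1 by (cases p1) auto
    show "distinct ?vs" "set ?vs \<subseteq> Y" using p(1) unfolding Q_def vp ps by auto
    show "\<forall>e\<in>cycle_edges ?vs. \<exists>u v. e = {u, v} \<and> adj u v"
    proof
      fix e assume "e \<in> cycle_edges ?vs"
      then have "e = {w, v} \<or> e \<in> ledges ?vs" by (subst (asm) cycle_edges_alt) auto
      then show "\<exists>u v. e = {u, v} \<and> adj u v" using L[OF _ succ] w(1) adj_sym by blast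
    qed
  qed
qed

end

lemma card_cut_edges:
  assumes "cubic_adj (verts G) (gadj G)" "X \<subseteq> verts G"
  shows "card (cut_edges G X) = cubic_adj.cut_size (verts G) (gadj G) X"
proof -
  interpret cubic_adj "verts G" "gadj G" by fact
  let ?S = "{(x, y) \<in> X \<times> (verts G - X). gadj G x y}"
  have "inj_on (\<lambda>(x, y). {x, y}) ?S"
    using assms(2) by (auto intro!: inj_onI simp: doubleton_eq_iff)
  moreover have "cut_edges G X = (\<lambda>(x, y). {x, y}) ` ?S"
    by (auto simp: cut_edges_def)
  ultimately have "card (cut_edges G X) = card ?S" by (simp add: card_image)
  then show ?thesis
    unfolding cut_size_def using links_card[OF fin[OF assms(2)], of "verts G - X"] finV by simp
qed

lemma reach_closed:
  assumes "reach H u v" "u \<in> X" "\<And>x y. x \<in> X \<Longrightarrow> {x, y} \<in> edges H \<Longrightarrow> y \<in> X"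
  shows "v \<in> X"
  using assms(1) unfolding reach_def
  by (induction rule: rtranclp_induct) (use assms in auto)

lemma reach_trans: "reach H u v \<Longrightarrow> reach H v w \<Longrightarrow> reach H u w"
  unfolding reach_def by (rule rtranclp_trans)

lemma reach_edge: "{u, v} \<in> edges H \<Longrightarrow> reach H u v"
  unfolding reach_def by blast

lemma reach_ledges:
  "ledges (x # xs) \<subseteq> edges H \<Longrightarrow> y \<in> set (x # xs) \<Longrightarrow> reach H x y"
proof (induction xs arbitrary: x)
  case Nil
  then show ?case by (simp add: reach_def)
next
  case (Cons z xs)
  show ?case
  proof (cases "y = x")
    case True
    then show ?thesis by (simp add: reach_def)
  next
    case False
    then have "reach H z y" using Cons by simp
    then show ?thesis using reach_trans[OF reach_edge] Cons.prems(1) by auto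
  qed
qed

text \<open>If at most three edges leave \<open>X\<close>, pruning \<open>X\<close> and its
  complement gives a cycle on each side. Deleting the cut edges makes \<open>X\<close> closed under
  reachability, so the two cycles lie in different components.\<close>

lemma cyc4_adj8_if_cyclically_4_connected:
  assumes sg: "simple_graph G" and c4: "cyclically_4_connected G"
  shows "cyc4_adj8 (verts G) (gadj G)"
proof -
  have cub: "cubic G" and c8: "8 \<le> card (verts G)" using c4 by (auto simp: cyclically_4_connected_def)
  interpret cubic_adj "verts G" "gadj G" by (rule cubic_adj_gadj[OF sg cub])
  let ?V = "verts G"
  show ?thesis
  proof
    show "8 \<le> card ?V" "6 \<le> card ?V" using c8 by auto
    fix X assume X: "X \<subseteq> ?V" "2 \<le> card X" "2 \<le> card (?V - X)"
    show "4 \<le> cut_size X"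
    proof (rule ccontr)
      assume "\<not> 4 \<le> cut_size X"
      then have d3: "cut_size X \<le> 3" by simp
      let ?F = "cut_edges G X" and ?H = "del_edges G (cut_edges G X)"
      have eH: "edges ?H = edges G - ?F" and vH: "verts ?H = ?V" by (auto simp: del_edges_def)
      have cF: "card ?F < 4" using card_cut_edges[OF cubic_adj_axioms X(1)] d3 by simp
      have c3: "3 \<le> card Z" if Z: "Z \<subseteq> ?V" "2 \<le> card Z" "cut_size Z \<le> 3" for Z
      proof (rule ccontr)
        assume "\<not> 3 \<le> card Z"
        then have c: "card Z = 2" using Z by linarith
        then obtain p q where pq: "Z = {p, q}" "p \<noteq> q" by (meson card_2_iff)
        have "links Z Z \<le> 2" unfolding links_def pq(1) using pq(2) adj_irrefl
          by (simp del: sum_of_bool_eq)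
        then show False using cut_size_plus_links[OF Z(1)] c Z(3) by linarith
      qed
      have cl0: "{x, y} \<in> ?F" if "x \<in> X" "y \<in> ?V - X" "{x, y} \<in> edges G" for x y
        using that unfolding cut_edges_def by blast
      have cl: "y \<in> X" if "x \<in> X" "{x, y} \<in> edges ?H" for x y
        using that cl0[of x y] gadj_verts(3)[OF sg, of x y] unfolding eH by blast
      have cyc: "\<exists>vs u. is_cycle ?H vs \<and> u \<in> Z \<and> set vs \<subseteq> {v \<in> ?V. reach ?H u v}"
        if Z: "Z = X \<or> Z = ?V - X" for Z
      proof -
        have ZV: "Z \<subseteq> ?V" "2 \<le> card Z" "cut_size Z \<le> 3" using Z X d3 cut_size_compl[OF X(1)] by auto
        obtain Y where Y: "Y \<subseteq> Z" "Y \<noteq> {}" "\<And>v. v \<in> Y \<Longrightarrow> 2 \<le> card ({w. gadj G v w} \<inter> Y)"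
          using prune[OF ZV(1,3) c3[OF ZV]] by blast
        obtain vs where vs: "3 \<le> length vs" "distinct vs" "set vs \<subseteq> Y"
          "\<forall>e\<in>cycle_edges vs. \<exists>u v. e = {u, v} \<and> gadj G u v"
          by (rule min_degree_2_cycle[OF order_trans[OF Y(1) ZV(1)] Y(2,3)])
        obtain u us where us: "vs = u # us" using vs(1) by (cases vs) auto
        have E: "cycle_edges vs \<subseteq> edges ?H"
        proof
          fix e assume e: "e \<in> cycle_edges vs"
          obtain x y where "e = {x, y}" "gadj G x y" using vs(4) e by meson
          then have "e \<in> edges G" by simp
          moreover have "e \<subseteq> Z"
          proof -
            have "e \<in> ledges (u # us @ [u])" using e unfolding us cycle_edges_Cons .
            then have "e \<subseteq> set vs" using ledges_subset_set us by fastforce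
            then show ?thesis using vs(3) Y(1) by (meson order_trans)
          qed
          then have "e \<notin> ?F" using Z unfolding cut_edges_def by auto
          ultimately show "e \<in> edges ?H" by (simp add: eH)
        qed
        then have "is_cycle ?H vs" using vs Y ZV(1) unfolding is_cycle_def vH by blast
        moreover have "ledges (u # us) \<subseteq> edges ?H"
          using E cycle_edges_alt[of vs] us by auto
        then have "set vs \<subseteq> {v \<in> ?V. reach ?H u v}"
          using reach_ledges[of u us ?H] us vs(3) Y(1) ZV(1) by auto
        moreover have "u \<in> Z" using us vs(3) Y(1) by auto
        ultimately show ?thesis by blast
      qed
      obtain vs u where 1: "is_cycle ?H vs" "u \<in> X" "set vs \<subseteq> {v \<in> ?V. reach ?H u v}"
        using cyc[of X] by blast
      obtain ws w where 2: "is_cycle ?H ws" "w \<in> ?V - X" "set ws \<subseteq> {v \<in> ?V. reach ?H w v}"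
        using cyc[of "?V - X"] by blast
      have nr: "\<not> reach ?H u w" using reach_closed[of ?H u w X] cl 1(2) 2(2) by blast
      have "edge_cut G ?F"
        unfolding edge_cut_def
      proof
        show "?F \<subseteq> edges G" by (auto simp: cut_edges_def)
        show "\<not> graph_connected ?H"
          using nr 1(2) 2(2) X(1) unfolding graph_connected_def vH by blast
      qed
      moreover have "cycle_separating G ?F"
        unfolding cycle_separating_def
      proof (intro bexI conjI)
        have "w \<in> {v \<in> ?V. reach ?H w v}" using 2(2) by (simp add: reach_def)
        then show "{v \<in> ?V. reach ?H u v} \<noteq> {v \<in> ?V. reach ?H w v}" using nr by blast
        show "\<exists>vs. is_cycle ?H vs \<and> set vs \<subseteq> {v \<in> ?V. reach ?H u v}" using 1 by blast
        show "\<exists>vs. is_cycle ?H vs \<and> set vs \<subseteq> {v \<in> ?V. reach ?H w v}" using 2 by blast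
        show "{v \<in> ?V. reach ?H u v} \<in> graph_components ?H"
          using 1(2) X(1) unfolding graph_components_def vH by blast
        show "{v \<in> ?V. reach ?H w v} \<in> graph_components ?H"
          using 2(2) unfolding graph_components_def vH by blast
      qed
      ultimately show False using c4 cF unfolding cyclically_4_connected_def by blast
    qed
  qed
qed

section \<open>Crossing chords of a simple closed curve\<close>

text \<open>The chord \<open>k\<close> divides the inside into a region bounded by \<open>c1\<close>
  and \<open>k\<close> and one bounded by \<open>c2\<close> and \<open>k\<close>. A connected
  \<open>L\<close> off \<open>k\<close> stays in one of them, whose closure misses the open arc of
  the other. \<open>L\<close> stands for a second chord without its ends, hence the closures in the
  assumptions.\<close>

lemma inside_chords_cross:
  fixes c1 c2 k :: "real \<Rightarrow> complex" and L :: "complex set"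
  assumes arcs: "arc c1" "arc c2" "arc k"
    and ends: "pathstart c1 = a" "pathfinish c1 = b" "pathstart c2 = a" "pathfinish c2 = b"
      "pathstart k = a" "pathfinish k = b"
    and int: "path_image c1 \<inter> path_image c2 = {a, b}" "path_image c1 \<inter> path_image k = {a, b}"
      "path_image c2 \<inter> path_image k = {a, b}"
    and k: "path_image k \<inter> inside (path_image c1 \<union> path_image c2) \<noteq> {}"
    and L: "connected L" "L \<subseteq> inside (path_image c1 \<union> path_image c2)" "L \<inter> path_image k = {}"
    and uv: "u \<in> closure L" "v \<in> closure L" "u \<in> path_image c1 - {a, b}" "v \<in> path_image c2 - {a, b}"
  shows False
proof -
  have ab: "a \<noteq> b" using arcs(1) ends(1,2) arc_distinct_ends by blast
  have sp: "simple_path c1" "simple_path c2" "simple_path k" using arcs arc_imp_simple_path by auto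
  let ?I1 = "inside (path_image c1 \<union> path_image k)" and ?I2 = "inside (path_image c2 \<union> path_image k)"
  obtain d: "?I1 \<inter> ?I2 = {}" and
    un: "?I1 \<union> ?I2 \<union> (path_image k - {a, b}) = inside (path_image c1 \<union> path_image c2)"
    using split_inside_simple_closed_curve[OF sp(1) ends(1,2) sp(2) ends(3,4) sp(3) ends(5,6) ab int k]
    by blast
  have cl: "closed (path_image c1 \<union> path_image k)" "closed (path_image c2 \<union> path_image k)"
    using arcs by (auto intro!: closed_Un closed_arc_image)
  have op: "open ?I1" "open ?I2" using cl open_inside by auto
  have clI: "closure ?I1 \<subseteq> ?I1 \<union> (path_image c1 \<union> path_image k)"
    "closure ?I2 \<subseteq> ?I2 \<union> (path_image c2 \<union> path_image k)"
    using cl closure_inside_subset by (simp_all add: Un_commute)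
  have "L \<subseteq> ?I1 \<union> ?I2" using L(2,3) un by blast
  then have "L \<inter> ?I1 = {} \<or> L \<inter> ?I2 = {}"
    using connectedD[OF L(1) op] d by blast
  then have "L \<subseteq> ?I1 \<or> L \<subseteq> ?I2" using \<open>L \<subseteq> ?I1 \<union> ?I2\<close> by blast
  then have *: "closure L \<subseteq> closure ?I1 \<or> closure L \<subseteq> closure ?I2" using closure_mono by blast
  have no: "inside (path_image c1 \<union> path_image c2) \<inter> (path_image c1 \<union> path_image c2) = {}"
    by (rule inside_no_overlap)
  have "v \<notin> closure ?I1" using clI(1) uv(4) un no int by blast
  moreover have "u \<notin> closure ?I2" using clI(2) uv(3) un no int by blast
  ultimately show False using * uv(1,2) by blast
qed

text \<open>Inversion at a point \<open>p\<close> inside the curve moves the outside of the curve to the inside of its image.\<close>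

lemma outside_chords_cross:
  fixes c1 c2 k :: "real \<Rightarrow> complex" and L :: "complex set"
  assumes arcs: "arc c1" "arc c2" "arc k"
    and ends: "pathstart c1 = a" "pathfinish c1 = b" "pathstart c2 = a" "pathfinish c2 = b"
      "pathstart k = a" "pathfinish k = b"
    and int: "path_image c1 \<inter> path_image c2 = {a, b}" "path_image c1 \<inter> path_image k = {a, b}"
      "path_image c2 \<inter> path_image k = {a, b}"
    and k: "path_image k - {a, b} \<subseteq> outside (path_image c1 \<union> path_image c2)"
    and L: "connected L" "L \<subseteq> outside (path_image c1 \<union> path_image c2)" "L \<inter> path_image k = {}"
    and uv: "u \<in> closure L" "v \<in> closure L" "u \<in> path_image c1 - {a, b}" "v \<in> path_image c2 - {a, b}"
  shows False
proof -
  let ?C = "path_image c1 \<union> path_image c2"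
  let ?c = "c1 +++ reversepath c2"
  have C: "path_image ?c = ?C" using ends by (simp add: path_image_join)
  have spc: "simple_path ?c"
    using arcs ends int by (intro simple_path_join_loop) (auto simp: arc_reversepath)
  have "pathfinish ?c = pathstart ?c" using ends by simp
  from Jordan_inside_outside[OF spc this] C
  have J: "inside ?C \<noteq> {}" "open (inside ?C)" "connected (inside ?C)" "connected (outside ?C)"
    "inside ?C \<inter> outside ?C = {}" "inside ?C \<union> outside ?C = - ?C" "outside ?C \<noteq> {}"
    by auto
  obtain p where p: "p \<in> inside ?C" using J(1) by blast
  \<comment> \<open>Since \<open>inverse 0 = 0\<close>, the value at \<open>p\<close> is 0 and
    \<open>f\<close> is injective on the whole plane, so images under \<open>f\<close> commute with
    intersections.\<close>
  define f where "f z = inverse (z - p)" for z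
  have cf: "continuous_on S f" if "p \<notin> S" for S
    unfolding f_def using that by (intro continuous_intros) auto
  have injf: "inj f" unfolding f_def by (auto intro!: injI)
  have pC: "p \<notin> ?C" using p inside_no_overlap by blast
  have pk: "p \<notin> path_image k" using p k J(5) pC int by blast
  have pL: "p \<notin> L" using p L(2) J(5) by blast
  have arcf: "arc (f \<circ> g)" if "arc g" "p \<notin> path_image g" for g
    unfolding arc_def
  proof
    show "path (f \<circ> g)" using that by (intro path_continuous_image cf) (auto simp: arc_def)
    show "inj_on (f \<circ> g) {0..1}" using that injf by (auto simp: arc_def inj_on_def inj_def)
  qed
  have im: "path_image (f \<circ> g) = f ` path_image g" for g by (simp add: path_image_compose)
  have imI: "f ` A \<inter> f ` B = f ` (A \<inter> B)" for A B using injf by (simp add: image_Int)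
  have A1: "arc (f \<circ> c1)" "arc (f \<circ> c2)" "arc (f \<circ> k)" using arcf arcs pC pk by auto
  let ?fC = "path_image (f \<circ> c1) \<union> path_image (f \<circ> c2)"
  have fC: "?fC = f ` ?C" by (simp add: im image_Un)
  let ?fc = "(f \<circ> c1) +++ reversepath (f \<circ> c2)"
  have E: "pathstart (f \<circ> c1) = f a" "pathfinish (f \<circ> c1) = f b" "pathstart (f \<circ> c2) = f a"
    "pathfinish (f \<circ> c2) = f b" "pathstart (f \<circ> k) = f a" "pathfinish (f \<circ> k) = f b"
    using ends by (simp_all add: pathstart_compose pathfinish_compose)
  have I: "path_image (f \<circ> c1) \<inter> path_image (f \<circ> c2) = {f a, f b}"
    "path_image (f \<circ> c1) \<inter> path_image (f \<circ> k) = {f a, f b}"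
    "path_image (f \<circ> c2) \<inter> path_image (f \<circ> k) = {f a, f b}"
    unfolding im imI using int by auto
  have C': "path_image ?fc = ?fC" using E by (simp add: path_image_join)
  have sp': "simple_path ?fc"
    using A1 E I by (intro simple_path_join_loop) (auto simp: arc_reversepath)
  have "pathfinish ?fc = pathstart ?fc" using E by simp
  from Jordan_inside_outside[OF sp' this] C'
  have J': "inside ?fC \<noteq> {}" "open (inside ?fC)" "open (outside ?fC)" "connected (outside ?fC)"
    "inside ?fC \<inter> outside ?fC = {}" "inside ?fC \<union> outside ?fC = - ?fC" "bounded (inside ?fC)"
    by auto
  \<comment> \<open>The images of the outside and of the punctured inside are connected and avoid
    the new curve, so each lies on one side of it. Near \<open>p\<close> the image is unbounded, so
    the punctured inside goes outside. If the outside went there too, only 0, the value at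
    \<open>p\<close>, could remain inside, but the inside is open and nonempty.\<close>
  have out_in: "f ` outside ?C \<subseteq> inside ?fC"
  proof -
    have pO: "p \<notin> outside ?C" using p J(5) by blast
    have "connected (f ` outside ?C)" by (intro connected_continuous_image cf J(4) pO)
    moreover have "f ` outside ?C \<subseteq> - ?fC"
    proof -
      have "f ` outside ?C \<inter> f ` ?C = {}" unfolding imI using outside_no_overlap[of ?C] by simp
      then show ?thesis unfolding fC by blast
    qed
    ultimately have "f ` outside ?C \<inter> inside ?fC = {} \<or> f ` outside ?C \<inter> outside ?fC = {}"
      using connectedD[OF _ J'(2,3)] J'(5,6) by blast
    then have 1: "f ` outside ?C \<subseteq> inside ?fC \<or> f ` outside ?C \<subseteq> outside ?fC"
      using \<open>f ` outside ?C \<subseteq> - ?fC\<close> J'(6) by blast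
    let ?D = "inside ?C - {p}"
    have conD: "connected ?D"
      using J(2,3) by (intro connected_open_delete) auto
    have "connected (f ` ?D)" by (intro connected_continuous_image cf conD) auto
    moreover have D1: "f ` ?D \<subseteq> - ?fC"
    proof -
      have "?D \<inter> ?C = {}" using inside_no_overlap[of ?C] by blast
      then have "f ` ?D \<inter> f ` ?C = {}" unfolding imI by simp
      then show ?thesis unfolding fC by blast
    qed
    ultimately have "f ` ?D \<inter> inside ?fC = {} \<or> f ` ?D \<inter> outside ?fC = {}"
      using connectedD[OF _ J'(2,3)] J'(5,6) by blast
    moreover have "\<not> f ` ?D \<subseteq> inside ?fC"
    proof
      assume "f ` ?D \<subseteq> inside ?fC"
      then obtain M where M: "M > 0" "\<And>z. z \<in> ?D \<Longrightarrow> norm (f z) \<le> M"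
        using J'(7) unfolding bounded_pos by blast
      obtain r where r: "r > 0" "ball p r \<subseteq> inside ?C" using J(2) p openE by blast
      \<comment> \<open>\<open>p + s\<close> stays in the ball of radius \<open>r\<close> around
        \<open>p\<close>, and its image has norm \<open>1 / s\<close>, which exceeds
        \<open>M\<close>.\<close>
      define s where "s = min (r / 2) (1 / (2 * M))"
      have s: "0 < s" "s < r" "s < 1 / M" using r(1) M(1) by (auto simp: s_def min_less_iff_disj field_simps)
      have "p + of_real s \<in> ?D" using r(2) s by (auto simp: dist_norm subset_iff)
      then have "norm (f (p + of_real s)) \<le> M" using M(2) by blast
      moreover have "norm (f (p + of_real s)) = 1 / s" using s(1) by (simp add: f_def norm_inverse divide_inverse)
      moreover have "1 / s > M" using s(1,3) M(1) by (simp add: field_simps)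
      ultimately show False by linarith
    qed
    ultimately have 2: "f ` ?D \<subseteq> outside ?fC" using D1 J'(6) by blast
    have "\<not> f ` outside ?C \<subseteq> outside ?fC"
    proof
      assume 3: "f ` outside ?C \<subseteq> outside ?fC"
      have "inside ?fC \<subseteq> {0}"
      proof
        fix w assume w: "w \<in> inside ?fC"
        show "w \<in> {0}"
        proof (rule ccontr)
          assume "w \<notin> {0}"
          define z where "z = p + inverse w"
          have z: "f z = w" "z \<noteq> p" using \<open>w \<notin> {0}\<close> by (auto simp: f_def z_def)
          then have "z \<notin> ?C" using w inside_no_overlap[of ?fC] unfolding fC by blast
          then have "z \<in> ?D \<or> z \<in> outside ?C" using z(2) J(6) by blast
          then have "w \<in> outside ?fC" using 2 3 z(1) by blast
          then show False using w J'(5) by blast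
        qed
      qed
      then have "interior (inside ?fC) \<subseteq> {}" by (metis interior_mono interior_singleton)
      then show False using J'(1,2) by (simp add: interior_open)
    qed
    then show ?thesis using 1 by blast
  qed
  show False
  proof (rule inside_chords_cross[OF A1 E I])
    obtain g where g: "g \<in> path_image k - {a, b}"
    proof
      have "inj_on k {0..1}" using arcs(3) by (simp add: arc_def)
      then have "k (1/2) \<noteq> k 0" "k (1/2) \<noteq> k 1" by (auto dest: inj_onD)
      then show "k (1/2) \<in> path_image k - {a, b}"
        using ends(5,6) by (auto simp: path_image_def pathstart_def pathfinish_def)
    qed
    then have "f g \<in> inside ?fC" using k out_in by blast
    moreover have "f g \<in> path_image (f \<circ> k)" using g by (simp add: im)
    ultimately show "path_image (f \<circ> k) \<inter> inside ?fC \<noteq> {}" by blast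
    show "connected (f ` L)" by (intro connected_continuous_image cf L pL)
    show "f ` L \<subseteq> inside ?fC" using out_in L(2) by blast
    show "f ` L \<inter> path_image (f \<circ> k) = {}" unfolding im imI using L(3) by simp
    have cl: "f w \<in> closure (f ` L)" if w: "w \<in> closure L" "w \<noteq> p" for w
    proof -
      obtain x where x: "\<And>n::nat. x n \<in> L" "x \<longlonglongrightarrow> w"
        using w(1) unfolding closure_sequential by blast
      have "(\<lambda>n. f (x n)) \<longlonglongrightarrow> f w"
        unfolding f_def using x(2) w(2) by (intro tendsto_intros) auto
      then show ?thesis unfolding closure_sequential using x(1) by (intro exI[of _ "\<lambda>n. f (x n)"]) auto
    qed
    have up: "u \<noteq> p" "v \<noteq> p" using uv pC by auto
    show "f u \<in> closure (f ` L)" "f v \<in> closure (f ` L)" using cl uv up by auto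
    show "f u \<in> path_image (f \<circ> c1) - {f a, f b}" "f v \<in> path_image (f \<circ> c2) - {f a, f b}"
      using uv injf by (auto simp: im dest: injD)
  qed
qed

section \<open>Drawings of twisted strips\<close>

definition drawing :: "'a ugraph \<Rightarrow> ('a \<Rightarrow> complex) \<Rightarrow> ('a set \<Rightarrow> real \<Rightarrow> complex) \<Rightarrow> bool" where
  "drawing G p \<gamma> \<longleftrightarrow> inj_on p (verts G) \<and>
     (\<forall>e\<in>edges G. arc (\<gamma> e) \<and> {pathstart (\<gamma> e), pathfinish (\<gamma> e)} = p ` e) \<and>
     (\<forall>e\<in>edges G. \<forall>v\<in>verts G. p v \<in> path_image (\<gamma> e) \<longrightarrow> v \<in> e) \<and>
     (\<forall>e\<in>edges G. \<forall>f\<in>edges G. e \<noteq> f \<longrightarrow>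
         path_image (\<gamma> e) \<inter> path_image (\<gamma> f) \<subseteq> p ` (e \<inter> f))"

lemma planar_drawing: "planar G \<longleftrightarrow> (\<exists>p \<gamma>. drawing G p \<gamma>)"
  unfolding planar_def drawing_def by blast

lemma drawingD:
  assumes "drawing G p \<gamma>"
  shows "inj_on p (verts G)"
    "e \<in> edges G \<Longrightarrow> arc (\<gamma> e)"
    "e \<in> edges G \<Longrightarrow> {pathstart (\<gamma> e), pathfinish (\<gamma> e)} = p ` e"
    "e \<in> edges G \<Longrightarrow> v \<in> verts G \<Longrightarrow> p v \<in> path_image (\<gamma> e) \<Longrightarrow> v \<in> e"
    "e \<in> edges G \<Longrightarrow> f \<in> edges G \<Longrightarrow> e \<noteq> f \<Longrightarrow>
      path_image (\<gamma> e) \<inter> path_image (\<gamma> f) \<subseteq> p ` (e \<inter> f)"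
  using assms by (simp_all add: drawing_def)

lemma drawing_arc:
  assumes "drawing G p \<gamma>" "{u, v} \<in> edges G"
  obtains g where "arc g" "pathstart g = p u" "pathfinish g = p v" "path_image g = path_image (\<gamma> {u, v})"
proof -
  have a: "arc (\<gamma> {u, v})" "{pathstart (\<gamma> {u, v}), pathfinish (\<gamma> {u, v})} = {p u, p v}"
    using drawingD(2,3)[OF assms] by simp_all
  show ?thesis
  proof (cases "pathstart (\<gamma> {u, v}) = p u \<and> pathfinish (\<gamma> {u, v}) = p v")
    case True
    then show ?thesis using that[of "\<gamma> {u, v}"] a by simp
  next
    case False
    then have "pathstart (\<gamma> {u, v}) = p v" "pathfinish (\<gamma> {u, v}) = p u"
      using a(2) by (auto simp: doubleton_eq_iff)
    then show ?thesis using that[of "reversepath (\<gamma> {u, v})"] a(1) by (simp add: arc_reversepath)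
  qed
qed

definition drawn :: "('a set \<Rightarrow> real \<Rightarrow> complex) \<Rightarrow> 'a set set \<Rightarrow> complex set" where
  "drawn \<gamma> F = (\<Union>e\<in>F. path_image (\<gamma> e))"

lemma drawn_simps [simp]:
  "drawn \<gamma> {} = {}" "drawn \<gamma> (insert e F) = path_image (\<gamma> e) \<union> drawn \<gamma> F"
  "drawn \<gamma> (F \<union> F') = drawn \<gamma> F \<union> drawn \<gamma> F'"
  by (auto simp: drawn_def)

lemma drawn_Int:
  assumes "drawing G p \<gamma>" "F \<subseteq> edges G" "F' \<subseteq> edges G" "F \<inter> F' = {}"
  shows "drawn \<gamma> F \<inter> drawn \<gamma> F' \<subseteq> p ` (\<Union>F \<inter> \<Union>F')"
proof
  fix z assume "z \<in> drawn \<gamma> F \<inter> drawn \<gamma> F'"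
  then obtain e f where ef: "e \<in> F" "f \<in> F'" "z \<in> path_image (\<gamma> e) \<inter> path_image (\<gamma> f)"
    by (auto simp: drawn_def)
  then have "e \<noteq> f" using assms(4) by blast
  moreover have "e \<in> edges G" "f \<in> edges G" using ef assms(2,3) by blast+
  ultimately have "path_image (\<gamma> e) \<inter> path_image (\<gamma> f) \<subseteq> p ` (e \<inter> f)"
    using drawingD(5)[OF assms(1)] by blast
  then have "z \<in> p ` (e \<inter> f)" using ef(3) by blast
  then show "z \<in> p ` (\<Union>F \<inter> \<Union>F')" using ef by blast
qed

lemma drawn_vertex:
  assumes "drawing G p \<gamma>" "F \<subseteq> edges G" "e \<in> F" "v \<in> e"
  shows "p v \<in> drawn \<gamma> F"
proof -
  have "e \<in> edges G" using assms(2,3) by blast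
  then have "p v \<in> {pathstart (\<gamma> e), pathfinish (\<gamma> e)}"
    using drawingD(3)[OF assms(1), of e] assms(4) by blast
  then have "p v \<in> path_image (\<gamma> e)" using pathstart_in_path_image pathfinish_in_path_image by auto
  then show ?thesis using assms(3) by (auto simp: drawn_def)
qed

lemma arc_along_path:
  assumes D: "drawing G p \<gamma>"
  shows "distinct xs \<Longrightarrow> 2 \<le> length xs \<Longrightarrow> ledges xs \<subseteq> edges G \<Longrightarrow>
    \<exists>g. arc g \<and> pathstart g = p (hd xs) \<and> pathfinish g = p (last xs) \<and> path_image g = drawn \<gamma> (ledges xs)"
proof (induction xs rule: ledges.induct)
  case (1 u v xs)
  obtain h where h: "arc h" "pathstart h = p u" "pathfinish h = p v" "path_image h = path_image (\<gamma> {u, v})"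
    using drawing_arc[OF D, of u v] 1(4) by auto
  show ?case
  proof (cases xs)
    case Nil
    then show ?thesis using h by auto
  next
    case (Cons w ys)
    then obtain g where g: "arc g" "pathstart g = p v" "pathfinish g = p (last (v # xs))"
      "path_image g = drawn \<gamma> (ledges (v # xs))" using 1 by auto
    have "{u, v} \<notin> ledges (v # xs)" using ledges_subset_set[of "{u, v}" "v # xs"] 1(2) by auto
    then have "drawn \<gamma> {{u, v}} \<inter> drawn \<gamma> (ledges (v # xs)) \<subseteq> p ` (\<Union>{{u, v}} \<inter> \<Union>(ledges (v # xs)))"
      using 1(4) by (intro drawn_Int[OF D]) auto
    moreover have "u \<notin> \<Union>(ledges (v # xs))" using ledges_subset_set[of _ "v # xs"] 1(2) by fastforce
    ultimately have "path_image h \<inter> path_image g \<subseteq> {pathstart g}" using h g by auto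
    then have "arc (h +++ g)" using h g by (intro arc_join) auto
    then show ?thesis using h g by (intro exI[of _ "h +++ g"]) (auto simp: path_image_join)
  qed
qed auto

lemma ledges_map_upt: "ledges (map f [a..<b]) = {{f n, f (Suc n)} | n. a \<le> n \<and> Suc n < b}"
proof -
  have "ledges (map f [a..<b]) = {{f (a + i), f (a + Suc i)} | i. Suc i < b - a}"
    unfolding ledges_conv_nth by (intro Collect_cong ex_cong1) auto
  also have "\<dots> = {{f n, f (Suc n)} | n. a \<le> n \<and> Suc n < b}"
  proof safe
    fix i assume "Suc i < b - a"
    then show "\<exists>n. {f (a + i), f (a + Suc i)} = {f n, f (Suc n)} \<and> a \<le> n \<and> Suc n < b"
      by (intro exI[of _ "a + i"]) auto
  next
    fix n assume "a \<le> n" "Suc n < b"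
    then show "\<exists>i. {f n, f (Suc n)} = {f (a + i), f (a + Suc i)} \<and> Suc i < b - a"
      by (intro exI[of _ "n - a"]) auto
  qed
  finally show ?thesis .
qed

text \<open>This supplies the closure assumptions of the two crossing lemmas when \<open>L\<close>
  is a chord without its ends.\<close>

lemma endpoints_in_closure_endless:
  fixes c :: "real \<Rightarrow> complex"
  assumes "arc c"
  shows "{pathstart c, pathfinish c} \<subseteq> closure (path_image c - {pathstart c, pathfinish c})"
proof -
  have inj: "inj_on c {0..1}" and cont: "continuous_on {0..1} c"
    using assms by (auto simp: arc_def path_def)
  have "c ` closure {0<..<1} \<subseteq> closure (c ` {0<..<1})"
    using cont by (intro image_closure_subset) (auto intro: closure_subset[THEN subsetD])
  moreover have "c ` {0<..<1} \<subseteq> path_image c - {pathstart c, pathfinish c}"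
    using inj by (auto simp: path_image_def pathstart_def pathfinish_def dest!: inj_onD)
  ultimately have "c ` closure {0<..<1} \<subseteq> closure (path_image c - {pathstart c, pathfinish c})"
    using closure_mono by (meson order_trans)
  moreover have "closure {0<..<1::real} = {0..1}" by (simp add: closure_greaterThanLessThan)
  ultimately show ?thesis by (auto simp: pathstart_def pathfinish_def)
qed

text \<open>\<open>S\<close> winds periodically around a cycle of length \<open>2 * m\<close> whose
  chords join antipodal vertices, so any two chords cross. With indices running over all naturals,
  the cycle can be read from the start of any chord, and one argument serves all pairs.\<close>

lemma twisted_strip_not_planar:
  fixes S :: "nat \<Rightarrow> 'a"
  assumes pl: "planar G" and m: "3 \<le> m"
    and per: "\<And>i j. S i = S j \<longleftrightarrow> i mod (2 * m) = j mod (2 * m)"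
    and rim: "\<And>i. {S i, S (Suc i)} \<in> edges G" and rung: "\<And>i. {S i, S (i + m)} \<in> edges G"
    and vert: "\<And>i. S i \<in> verts G"
  shows False
proof -
  obtain p \<gamma> where D: "drawing G p \<gamma>" using pl planar_drawing by blast
  have injp: "p (S i) = p (S j) \<longleftrightarrow> S i = S j" for i j
    using inj_on_eq_iff[OF drawingD(1)[OF D] vert vert] .
  \<comment> \<open>\<open>S\<close> is injective on every window of \<open>2 * m\<close>
    consecutive indices.\<close>
  have win0: "a = b" if "S a = S b" "a \<le> b" "b < a + 2 * m" for a b
  proof -
    have "2 * m dvd b - a" using that per by (metis mod_eq_dvd_iff_nat)
    moreover have "b - a < 2 * m" using that by linarith
    ultimately have "b - a = 0" by (metis dvd_imp_le leD neq0_conv)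
    then show ?thesis using that by simp
  qed
  have win: "a = b" if "S a = S b" "i \<le> a" "i \<le> b" "a < i + 2 * m" "b < i + 2 * m" for a b i
    using win0[of a b] win0[of b a] that by (cases "a \<le> b") auto
  have wrap: "S (i + 2 * m) = S i" for i using per by simp
  have repr: "\<exists>n'. i \<le> n' \<and> n' < i + 2 * m \<and> S n' = S n \<and> S (Suc n') = S (Suc n)" for i n
  proof -
    \<comment> \<open>The representative of \<open>n\<close> in the window that starts at
      \<open>i\<close>. Adding a multiple of the period first keeps the natural subtraction from
      truncating.\<close>
    let ?n = "i + (n + 2 * m * i - i) mod (2 * m)"
    have "i \<le> 2 * m * i" using m by simp
    then have "i + (n + 2 * m * i - i) = n + 2 * m * i" by linarith
    then have "?n mod (2 * m) = n mod (2 * m)" by (metis mod_add_right_eq mod_mult_self2)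
    moreover from this have "Suc ?n mod (2 * m) = Suc n mod (2 * m)" by (metis mod_Suc_eq)
    moreover have "(n + 2 * m * i - i) mod (2 * m) < 2 * m" using m by simp
    ultimately show ?thesis using per by (intro exI[of _ ?n]) auto
  qed
  have four: "S i \<noteq> S (i + j)" "S i \<noteq> S (i + j + m)" "S (i + m) \<noteq> S (i + j)" "S (i + m) \<noteq> S (i + j + m)"
    if "0 < j" "j < m" for i j
    using that win[of i "i + j" i] win[of i "i + j + m" i] win[of "i + m" "i + j" i]
      win[of "i + m" "i + j + m" i] by auto
  \<comment> \<open>\<open>L i\<close> is the half of the cycle from \<open>S i\<close> to
    \<open>S (i + m)\<close>, and \<open>L (i + m)\<close> the other half. \<open>C\<close> is the
    drawn cycle, \<open>e i\<close> a chord and \<open>Op i\<close> its drawing without the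
    ends.\<close>
  define L where "L i = {{S n, S (Suc n)} | n. i \<le> n \<and> n < i + m}" for i
  define R where "R = range (\<lambda>n. {S n, S (Suc n)})"
  define C where "C = drawn \<gamma> R"
  define e where "e i = {S i, S (i + m)}" for i
  define Op where "Op i = path_image (\<gamma> (e i)) - {p (S i), p (S (i + m))}" for i
  have LE: "L i \<subseteq> edges G" for i using rim by (auto simp: L_def)
  have eE: "e i \<in> edges G" for i using rung by (simp add: e_def)
  have RL: "R = L i \<union> L (i + m)" for i
  proof
    show "R \<subseteq> L i \<union> L (i + m)"
    proof
      fix f assume "f \<in> R"
      then obtain n where "f = {S n, S (Suc n)}" by (auto simp: R_def)
      moreover obtain n' where "i \<le> n'" "n' < i + 2 * m" "S n' = S n" "S (Suc n') = S (Suc n)"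
        using repr by blast
      ultimately show "f \<in> L i \<union> L (i + m)"
        unfolding L_def by (cases "n' < i + m") (auto intro!: exI[of _ n'])
    qed
    show "L i \<union> L (i + m) \<subseteq> R" by (auto simp: L_def R_def)
  qed
  have Ldisj: "L i \<inter> L (i + m) = {}" for i
  proof (rule ccontr)
    assume "\<not> ?thesis"
    then obtain n k where nk: "i \<le> n" "n < i + m" "i + m \<le> k" "k < i + m + m"
      "{S n, S (Suc n)} = {S k, S (Suc k)}" unfolding L_def by blast
    have "S n \<noteq> S k" using win[of n k i] nk by auto
    then have eq: "S n = S (Suc k)" "S (Suc n) = S k" using nk(5) by (auto simp: doubleton_eq_iff)
    have "Suc n = k" using win[OF eq(2), of i] nk by auto
    then show False using win0[of n "Suc k"] eq(1) m by auto
  qed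
  have UL: "\<Union>(L i) = S ` {i..i + m}" for i
  proof
    show "\<Union>(L i) \<subseteq> S ` {i..i + m}" by (auto simp: L_def)
    show "S ` {i..i + m} \<subseteq> \<Union>(L i)"
    proof
      fix v assume "v \<in> S ` {i..i + m}"
      then obtain n where n: "v = S n" "i \<le> n" "n \<le> i + m" by auto
      show "v \<in> \<Union>(L i)"
      proof (cases "n = i + m")
        case True
        then have "{S (n - 1), S (Suc (n - 1))} \<in> L i" using m unfolding L_def
          by (intro CollectI exI[of _ "n - 1"]) auto
        moreover have "Suc (n - 1) = n" using True m by simp
        ultimately show ?thesis using n(1) by auto
      next
        case False
        then have "{S n, S (Suc n)} \<in> L i" using n unfolding L_def by auto
        then show ?thesis using n(1) by auto
      qed
    qed
  qed
  have ULL: "\<Union>(L i) \<inter> \<Union>(L (i + m)) \<subseteq> {S i, S (i + m)}" for i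
  proof
    fix v assume "v \<in> \<Union>(L i) \<inter> \<Union>(L (i + m))"
    then have v: "v \<in> S ` {i..i + m}" "v \<in> S ` {i + m..i + m + m}" by (simp_all only: UL Int_iff)
    obtain n where "v = S n" "i \<le> n" "n \<le> i + m" using v(1) by auto
    moreover obtain k where "v = S k" "i + m \<le> k" "k \<le> i + m + m" using v(2) by auto
    ultimately have nk: "v = S n" "v = S k" "i \<le> n" "n \<le> i + m" "i + m \<le> k" "k \<le> i + m + m" by auto
    show "v \<in> {S i, S (i + m)}"
    proof (cases "k = i + 2 * m")
      case True
      then show ?thesis using nk(2) wrap by simp
    next
      case False
      then have "n = k" using win[of n k i] nk m by auto
      then show ?thesis using nk by simp
    qed
  qed
  have eR: "e i \<notin> R" for i
  proof
    assume "e i \<in> R"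
    then obtain n' where n': "{S i, S (i + m)} = {S n', S (Suc n')}"
      unfolding R_def e_def by (rule imageE)
    obtain n where "i \<le> n" "n < i + 2 * m" "S n = S n'" "S (Suc n) = S (Suc n')"
      using repr[of i n'] by (elim exE conjE)
    then have n: "i \<le> n" "n < i + 2 * m" "{S i, S (i + m)} = {S n, S (Suc n)}" using n' by simp_all
    then consider "S i = S n" "S (i + m) = S (Suc n)" | "S i = S (Suc n)" "S (i + m) = S n"
      by (auto simp: doubleton_eq_iff)
    then show False
    proof cases
      case 1
      then have "n = i" using win0[of i n] n by simp
      then show False using win[of "i + m" "Suc n" i] 1 m by auto
    next
      case 2
      then have "n = i + m" using win[of "i + m" n i] n by auto
      then show False using win0[of i "Suc n"] 2 m by auto
    qed
  qed
  have seg: "\<exists>g. arc g \<and> pathstart g = p (S i) \<and> pathfinish g = p (S (i + m)) \<and> path_image g = drawn \<gamma> (L i)" for i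
  proof -
    let ?xs = "map S [i..<Suc (i + m)]"
    have "ledges ?xs = L i" unfolding ledges_map_upt L_def by auto
    moreover have "distinct ?xs"
      unfolding distinct_map using m by (auto intro!: inj_onI win[where i = i] simp del: upt_Suc)
    moreover have "2 \<le> length ?xs" using m by simp
    moreover have "hd ?xs = S i" "last ?xs = S (i + m)" by (simp_all add: hd_map last_map del: upt_Suc)
    ultimately show ?thesis using arc_along_path[OF D, of ?xs] LE by metis
  qed
  have ab: "p (S i) \<in> drawn \<gamma> (L i)" "p (S (i + m)) \<in> drawn \<gamma> (L i)"
    "p (S i) \<in> drawn \<gamma> (L (i + m))" "p (S (i + m)) \<in> drawn \<gamma> (L (i + m))" for i
  proof -
    have dv: "p v \<in> drawn \<gamma> (L j)" if "v \<in> \<Union>(L j)" for v j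
      using that drawn_vertex[OF D LE] by blast
    show "p (S i) \<in> drawn \<gamma> (L i)" "p (S (i + m)) \<in> drawn \<gamma> (L i)" "p (S (i + m)) \<in> drawn \<gamma> (L (i + m))"
      by (rule dv, unfold UL, force)+
    have "S i \<in> \<Union>(L (i + m))" unfolding UL using wrap[of i] by (auto intro!: image_eqI[of _ _ "i + 2 * m"])
    then show "p (S i) \<in> drawn \<gamma> (L (i + m))" by (rule dv)
  qed
  have CL: "C = drawn \<gamma> (L i) \<union> drawn \<gamma> (L (i + m))" for i
    unfolding C_def RL[of i] by simp
  have LL: "drawn \<gamma> (L i) \<inter> drawn \<gamma> (L (i + m)) = {p (S i), p (S (i + m))}" for i
    using drawn_Int[OF D LE LE Ldisj, of i] ULL[of i] ab[of i] by blast
  have Le: "drawn \<gamma> (L j) \<inter> path_image (\<gamma> (e i)) \<subseteq> {p (S i), p (S (i + m))}" if "L j \<subseteq> R" for i j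
  proof -
    have "drawn \<gamma> (L j) \<inter> drawn \<gamma> {e i} \<subseteq> p ` (\<Union>(L j) \<inter> \<Union>{e i})"
      using eR[of i] that eE by (intro drawn_Int[OF D LE]) auto
    then show ?thesis by (auto simp: e_def)
  qed
  have LR: "L i \<subseteq> R" for i using RL by blast
  have ee: "path_image (\<gamma> (e i)) \<inter> path_image (\<gamma> (e (i + j))) = {}" if "0 < j" "j < m" for i j
  proof -
    have n: "S i \<noteq> S (i + j)" "S i \<noteq> S (i + j + m)" "S (i + m) \<noteq> S (i + j)" "S (i + m) \<noteq> S (i + j + m)"
      using that by (rule four)+
    then have "e i \<inter> e (i + j) = {}" by (auto simp: e_def)
    moreover from this have "e i \<noteq> e (i + j)" by (auto simp: e_def)
    ultimately show ?thesis using drawingD(5)[OF D eE[of i] eE[of "i + j"]] by simp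
  qed
  have chord: "\<exists>k. arc k \<and> pathstart k = p (S i) \<and> pathfinish k = p (S (i + m)) \<and> path_image k = path_image (\<gamma> (e i))" for i
    using drawing_arc[OF D rung[of i]] unfolding e_def by metis
  have opn: "connected (Op i) \<and> p (S i) \<in> closure (Op i) \<and> p (S (i + m)) \<in> closure (Op i) \<and> Op i \<noteq> {}" for i
  proof -
    obtain k where k: "arc k" "pathstart k = p (S i)" "pathfinish k = p (S (i + m))"
      "path_image k = path_image (\<gamma> (e i))" using chord by blast
    have "Op i = path_image k - {pathstart k, pathfinish k}" unfolding Op_def k ..
    moreover have "connected (path_image k - {pathstart k, pathfinish k})"
      using connected_simple_path_endless[OF arc_imp_simple_path[OF k(1)]] .
    ultimately have 1: "connected (Op i)" "p (S i) \<in> closure (Op i)" "p (S (i + m)) \<in> closure (Op i)"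
      using endpoints_in_closure_endless[OF k(1)] k by auto
    then have "Op i \<noteq> {}" by auto
    then show ?thesis using 1 by blast
  qed
  have OC: "Op i \<inter> C = {}" for i
    unfolding CL[of i] Op_def using Le[OF LR[of i], of i] Le[OF LR[of "i + m"], of i] by blast
  obtain g h where g: "arc g" "pathstart g = p (S 0)" "pathfinish g = p (S (0 + m))" "path_image g = drawn \<gamma> (L 0)"
    and h: "arc h" "pathstart h = p (S (0 + m))" "pathfinish h = p (S (0 + m + m))" "path_image h = drawn \<gamma> (L (0 + m))"
    using seg by meson
  have w0: "S (0 + m + m) = S 0" using wrap[of 0] by (simp add: mult_2)
  have "simple_path (g +++ h)"
    using g h LL[of 0] w0 by (intro simple_path_join_loop) auto
  moreover have "pathfinish (g +++ h) = pathstart (g +++ h)" using g h w0 by simp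
  moreover have "path_image (g +++ h) = C" using g h CL[of 0] by (simp add: path_image_join)
  ultimately have J: "open (inside C)" "open (outside C)" "inside C \<inter> outside C = {}" "inside C \<union> outside C = - C"
    using Jordan_inside_outside[of "g +++ h"] by auto
  have side: "Op i \<subseteq> inside C \<or> Op i \<subseteq> outside C" for i
  proof -
    have "Op i \<inter> inside C = {} \<or> Op i \<inter> outside C = {}"
      using connectedD[of "Op i" "inside C" "outside C"] opn J OC[of i] by blast
    then show ?thesis using J(4) OC[of i] by blast
  qed
  have cross: "\<not> (Op i \<subseteq> inside C \<and> Op (i + j) \<subseteq> inside C)" "\<not> (Op i \<subseteq> outside C \<and> Op (i + j) \<subseteq> outside C)"
    if j: "0 < j" "j < m" for i j
  proof -
    let ?a = "p (S i)" and ?b = "p (S (i + m))"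
    obtain c1 where c1: "arc c1" "pathstart c1 = ?a" "pathfinish c1 = ?b" "path_image c1 = drawn \<gamma> (L i)"
      using seg by blast
    obtain c where c: "arc c" "pathstart c = ?b" "pathfinish c = p (S (i + m + m))" "path_image c = drawn \<gamma> (L (i + m))"
      using seg by blast
    \<comment> \<open>By periodicity \<open>c\<close> ends at \<open>S i\<close>. Reversed, it runs
      from \<open>?a\<close> to \<open>?b\<close> like \<open>c1\<close> and
      \<open>k\<close>.\<close>
    define c2 where "c2 = reversepath c"
    have c2: "arc c2" "pathstart c2 = ?a" "pathfinish c2 = ?b" "path_image c2 = drawn \<gamma> (L (i + m))"
      using c wrap[of i] by (simp_all add: c2_def arc_reversepath mult_2 add.assoc)
    obtain k where k: "arc k" "pathstart k = ?a" "pathfinish k = ?b" "path_image k = path_image (\<gamma> (e i))"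
      using chord by blast
    have kab: "?a \<in> path_image k" "?b \<in> path_image k"
      using k(2,3) pathstart_in_path_image pathfinish_in_path_image by metis+
    have int: "path_image c1 \<inter> path_image c2 = {?a, ?b}" "path_image c1 \<inter> path_image k = {?a, ?b}"
      "path_image c2 \<inter> path_image k = {?a, ?b}"
      using LL[of i] Le[OF LR[of i], of i] Le[OF LR[of "i + m"], of i] ab[of i] kab
      unfolding c1(4) c2(4) k(4) by blast+
    have C12: "path_image c1 \<union> path_image c2 = C" using c1 c2 CL[of i] by simp
    have Lk: "Op (i + j) \<inter> path_image k = {}" unfolding Op_def k(4) using ee[OF j, of i] by blast
    have u: "p (S (i + j)) \<in> path_image c1 - {?a, ?b}"
    proof -
      have "S (i + j) \<in> \<Union>(L i)" unfolding UL using j by auto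
      then have "p (S (i + j)) \<in> drawn \<gamma> (L i)" using drawn_vertex[OF D LE] by blast
      then show ?thesis using c1(4) injp four[OF j, of i] by auto
    qed
    have v: "p (S (i + j + m)) \<in> path_image c2 - {?a, ?b}"
    proof -
      have "S (i + j + m) \<in> \<Union>(L (i + m))" unfolding UL using j by auto
      then have "p (S (i + j + m)) \<in> drawn \<gamma> (L (i + m))" using drawn_vertex[OF D LE] by blast
      then show ?thesis using c2(4) injp four[OF j, of i] by auto
    qed
    have kO: "path_image k - {?a, ?b} = Op i" using k(4) by (simp add: Op_def)
    show "\<not> (Op i \<subseteq> inside C \<and> Op (i + j) \<subseteq> inside C)"
    proof
      assume A: "Op i \<subseteq> inside C \<and> Op (i + j) \<subseteq> inside C"
      show False
        by (rule inside_chords_cross[OF c1(1) c2(1) k(1) c1(2,3) c2(2,3) k(2,3) int, unfolded C12,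
              of "Op (i + j)" "p (S (i + j))" "p (S (i + j + m))"])
          (use A opn[of i] opn[of "i + j"] Lk u v kO in auto)
    qed
    show "\<not> (Op i \<subseteq> outside C \<and> Op (i + j) \<subseteq> outside C)"
    proof
      assume A: "Op i \<subseteq> outside C \<and> Op (i + j) \<subseteq> outside C"
      show False
        by (rule outside_chords_cross[OF c1(1) c2(1) k(1) c1(2,3) c2(2,3) k(2,3) int, unfolded C12,
              of "Op (i + j)" "p (S (i + j))" "p (S (i + j + m))"])
          (use A opn[of i] opn[of "i + j"] Lk u v kO in auto)
    qed
  qed
  \<comment> \<open>The chords at 0, 1 and 2 occupy two sides; \<open>3 <= m\<close> makes the
    offset 2 admissible in \<open>cross\<close>.\<close>
  show False
    using cross[of 1 0] cross[of 1 1] cross[of 2 0] side[of 0] side[of 1] side[of 2] m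
    by (auto simp: numeral_2_eq_2)
qed

section \<open>Removing an edge, and cycles through two edges\<close>

text \<open>The contribution of one added edge \<open>ab\<close> to \<open>links X Y\<close>, with
  its two orientations.\<close>

lemma sum_pair_indicator:
  assumes "finite X" "finite Y" "a \<noteq> b"
  shows "(\<Sum>u\<in>X. \<Sum>v\<in>Y. of_bool ({u, v} = {a, b})) =
    (of_bool (a \<in> X \<and> b \<in> Y) + of_bool (b \<in> X \<and> a \<in> Y) :: nat)"
proof -
  have one: "(\<Sum>u\<in>X. \<Sum>v\<in>Y. if u = p \<and> v = q then 1 else 0) = (of_bool (p \<in> X \<and> q \<in> Y) :: nat)" for p q
  proof -
    have "(\<Sum>v\<in>Y. if u = p \<and> v = q then 1 else 0) = (if u = p then of_bool (q \<in> Y) else (0::nat))" for u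
      using assms(2) by simp
    then show ?thesis using assms(1) by simp
  qed
  have "of_bool ({u, v} = {a, b}) = (if u = a \<and> v = b then 1 else 0) + (if u = b \<and> v = a then 1 else (0::nat))" for u v
    using assms(3) by (auto simp: doubleton_eq_iff)
  then show ?thesis by (simp only: sum.distrib one)
qed

definition suppress_adj :: "('a \<Rightarrow> 'a \<Rightarrow> bool) \<Rightarrow> 'a \<Rightarrow> 'a \<Rightarrow> 'a \<Rightarrow> 'a \<Rightarrow> 'a \<Rightarrow> 'a \<Rightarrow> 'a \<Rightarrow> 'a \<Rightarrow> bool" where
  "suppress_adj adj x y a b c e u v \<longleftrightarrow>
     adj u v \<and> {u, v} \<inter> {x, y} = {} \<or> {u, v} = {a, b} \<or> {u, v} = {c, e}"

context cyc4_adj8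
begin

text \<open>To bound the cut of \<open>X\<close> after suppression, put \<open>x\<close> back on the
  side of \<open>a\<close> or \<open>b\<close>, and \<open>y\<close> on the side of \<open>c\<close>
  or \<open>e\<close>. The cut in the old graph is then larger by one if \<open>x\<close> and
  \<open>y\<close> are separated, and equal otherwise. It is at least four in any case, and at least
  five when they are separated, because a 4-cut between them contradicts
  \<open>removable\<close>.\<close>

lemma cyc4_adj_suppress:
  assumes rem: "removable x y" and Nx: "{w. adj x w} = {y, a, b}" and Ny: "{w. adj y w} = {x, c, e}"
    and dist: "distinct [x, y, a, b, c, e]"
  shows "cyc4_adj (V - {x, y}) (suppress_adj adj x y a b c e)"
proof -
  let ?V = "V - {x, y}" and ?adj = "suppress_adj adj x y a b c e"
  have Ax: "adj x w \<longleftrightarrow> w = y \<or> w = a \<or> w = b" "adj w x \<longleftrightarrow> w = y \<or> w = a \<or> w = b" for w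
    using Nx adj_sym by blast+
  have Ay: "adj y w \<longleftrightarrow> w = x \<or> w = c \<or> w = e" "adj w y \<longleftrightarrow> w = x \<or> w = c \<or> w = e" for w
    using Ny adj_sym by blast+
  \<comment> \<open>The absence of triangles keeps the new edges \<open>ab\<close> and
    \<open>ce\<close> from duplicating old ones, which the degrees and the cut count rely
    on.\<close>
  have nab: "\<not> adj a b" "\<not> adj b a" using no_triangle[of x a b] no_triangle[of x b a] Ax by blast+
  have nce: "\<not> adj c e" "\<not> adj e c" using no_triangle[of y c e] no_triangle[of y e c] Ay by blast+
  have adjs: "adj a x" "adj b x" "adj c y" "adj e y" "adj x y" "adj y x" using Ax Ay by simp_all
  have xyV: "x \<in> V" "y \<in> V" using adj_V[OF adjs(5)] adj_V[OF adjs(6)] .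
  have inV: "a \<in> ?V" "b \<in> ?V" "c \<in> ?V" "e \<in> ?V"
    using adj_V[OF adjs(1)] adj_V[OF adjs(2)] adj_V[OF adjs(3)] adj_V[OF adjs(4)] dist by auto
  have swap: "card (insert w (N - {z})) = 3" if "card N = 3" "z \<in> N" "w \<notin> N" for N :: "'a set" and w z
  proof -
    have "finite N" using that(1) by (intro card_ge_0_finite) simp
    then show ?thesis using that by (simp add: card_insert_if)
  qed
  interpret H: cubic_adj ?V ?adj
  proof
    show "finite ?V" using finV by simp
    show "?adj v u" if "?adj u v" for u v
      using that adj_sym unfolding suppress_adj_def by (auto simp: insert_commute)
    show "\<not> ?adj u u" for u using adj_irrefl dist unfolding suppress_adj_def by auto
    show "u \<in> ?V" if "?adj u v" for u v
      using that adj_V inV unfolding suppress_adj_def by (auto simp: doubleton_eq_iff)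
    fix v assume v: "v \<in> ?V"
    have c3: "card {w. adj v w} = 3" using deg3 v by simp
    consider "v = a" | "v = b" | "v = c" | "v = e" | "v \<notin> {a, b, c, e}" by blast
    then show "card {w. ?adj v w} = 3"
    proof cases
      case 1
      have "{w. ?adj v w} = insert b ({w. adj v w} - {x})"
        using 1 dist Ax Ay v unfolding suppress_adj_def by (auto simp: doubleton_eq_iff)
      then show ?thesis using swap[OF c3, of x b] 1 Ax nab by simp
    next
      case 2
      have "{w. ?adj v w} = insert a ({w. adj v w} - {x})"
        using 2 dist Ax Ay v unfolding suppress_adj_def by (auto simp: doubleton_eq_iff)
      then show ?thesis using swap[OF c3, of x a] 2 Ax nab by simp
    next
      case 3
      have "{w. ?adj v w} = insert e ({w. adj v w} - {y})"
        using 3 dist Ax Ay v unfolding suppress_adj_def by (auto simp: doubleton_eq_iff)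
      then show ?thesis using swap[OF c3, of y e] 3 Ay nce by simp
    next
      case 4
      have "{w. ?adj v w} = insert c ({w. adj v w} - {y})"
        using 4 dist Ax Ay v unfolding suppress_adj_def by (auto simp: doubleton_eq_iff)
      then show ?thesis using swap[OF c3, of y c] 4 Ay nce by simp
    next
      case 5
      have "{w. ?adj v w} = {w. adj v w}"
        using 5 dist Ax Ay v unfolding suppress_adj_def by (auto simp: doubleton_eq_iff)
      then show ?thesis using c3 by simp
    qed
  qed
  have cV: "card ?V = card V - 2" using xyV dist by (simp add: card_Diff_subset)
  show ?thesis
  proof
    show "6 \<le> card ?V" using cV card8 by simp
    fix X assume X: "X \<subseteq> ?V" "2 \<le> card X" "2 \<le> card (?V - X)"
    let ?Y = "?V - X"
    have f: "finite X" "finite ?Y" using X(1) finV finite_subset[of X ?V] by auto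
    have nx: "x \<notin> X" "y \<notin> X" "x \<notin> ?Y" "y \<notin> ?Y" "X \<inter> ?Y = {}" using X(1) by auto
    have mem: "a \<in> ?Y \<longleftrightarrow> a \<notin> X" "b \<in> ?Y \<longleftrightarrow> b \<notin> X" "c \<in> ?Y \<longleftrightarrow> c \<notin> X" "e \<in> ?Y \<longleftrightarrow> e \<notin> X"
      using inV by auto
    have ind: "of_bool (?adj u v) = of_bool (adj u v) + of_bool ({u, v} = {a, b}) + (of_bool ({u, v} = {c, e}) :: nat)"
      if "u \<in> X" "v \<in> ?Y" for u v
    proof -
      have "{u, v} \<inter> {x, y} = {}" using that nx(1-4) by blast
      moreover have "{u, v} = {a, b} \<Longrightarrow> \<not> adj u v" using nab by (simp add: doubleton_eq_iff) blast
      moreover have "{u, v} = {c, e} \<Longrightarrow> \<not> adj u v" using nce by (simp add: doubleton_eq_iff) blast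
      moreover have "{a, b} \<noteq> {c, e}" using dist by (simp add: doubleton_eq_iff)
      ultimately show ?thesis unfolding suppress_adj_def
        by (cases "{u, v} = {a, b}"; cases "{u, v} = {c, e}"; cases "adj u v") simp_all
    qed
    have "H.cut_size X = (\<Sum>u\<in>X. \<Sum>v\<in>?Y. of_bool (adj u v) + of_bool ({u, v} = {a, b}) + of_bool ({u, v} = {c, e}))"
      unfolding H.cut_size_def H.links_def by (intro sum.cong refl ind) auto
    also have "\<dots> = links X ?Y + (of_bool (a \<in> X \<and> b \<in> ?Y) + of_bool (b \<in> X \<and> a \<in> ?Y)) +
      (of_bool (c \<in> X \<and> e \<in> ?Y) + of_bool (e \<in> X \<and> c \<in> ?Y))"
      using dist by (simp only: sum.distrib links_def sum_pair_indicator[OF f, of a b]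
          sum_pair_indicator[OF f, of c e] distinct_length_2_or_more simp_thms)
    finally have dH: "H.cut_size X = links X ?Y + (of_bool (a \<in> X \<and> b \<notin> X) + of_bool (b \<in> X \<and> a \<notin> X)) +
      (of_bool (c \<in> X \<and> e \<notin> X) + of_bool (e \<in> X \<and> c \<notin> X))" unfolding mem .
    have XV: "X \<subseteq> V" "?Y \<subseteq> V" using X(1) by auto
    have mx: "links {x} Z = of_bool (y \<in> Z) + of_bool (a \<in> Z) + of_bool (b \<in> Z)" if "finite Z" for Z
      using links_single[OF Nx] dist that by simp
    have my: "links {y} Z = of_bool (x \<in> Z) + of_bool (c \<in> Z) + of_bool (e \<in> Z)" if "finite Z" for Z
      using links_single[OF Ny] dist that by simp
    have mxX: "links X {x} = of_bool (a \<in> X) + of_bool (b \<in> X)" "links {x} ?Y = of_bool (a \<notin> X) + of_bool (b \<notin> X)"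
      "links X {y} = of_bool (c \<in> X) + of_bool (e \<in> X)" "links {y} ?Y = of_bool (c \<notin> X) + of_bool (e \<notin> X)"
      unfolding links_sym[of X] mx[OF f(1)] mx[OF f(2)] my[OF f(1)] my[OF f(2)] mem using nx by simp_all
    have mxy: "links {x} {y} = 1" "links {y} {x} = 1" using Ax Ay by (simp_all add: links_single_single)
    have D0: "cut_size X = links X ?Y + links X {x} + links X {y}"
    proof -
      have "cut_size X = links X ?Y + links X {x, y}"
        by (rule cut_size_parts[OF XV(1)]) (use nx xyV in auto)
      moreover have "links X {x, y} = links X {x} + links X {y}"
      proof -
        have "{x, y} = {x} \<union> {y}" by auto
        moreover have "links X ({x} \<union> {y}) = links X {x} + links X {y}" using dist by (intro links_Un_right) auto
        ultimately show ?thesis by (simp only:)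
      qed
      ultimately show ?thesis by simp
    qed
    have Dxy: "cut_size (X \<union> {x, y}) = links X ?Y + links {x} ?Y + links {y} ?Y"
    proof -
      have "cut_size (X \<union> {x, y}) = links (X \<union> {x, y}) ?Y + links (X \<union> {x, y}) {}"
        by (rule cut_size_parts) (use XV xyV in auto)
      moreover have "links (X \<union> {x, y}) ?Y = links X ?Y + links {x, y} ?Y"
        using f nx by (intro links_Un_left) auto
      moreover have "links {x, y} ?Y = links {x} ?Y + links {y} ?Y" using dist by (intro links_insert) auto
      ultimately show ?thesis by simp
    qed
    have Done: "cut_size (insert z X) = links X ?Y + links X {w} + links {z} ?Y + links {z} {w}"
      if "{z, w} = {x, y}" "z \<noteq> w" for z w
    proof -
      have zw: "z \<notin> X" "w \<notin> X" "z \<in> V" "w \<in> V" "w \<notin> ?Y" using that nx xyV by auto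
      have "cut_size (insert z X) = links (insert z X) ?Y + links (insert z X) {w}"
        by (rule cut_size_parts) (use XV zw that nx in auto)
      moreover have "links (insert z X) Z = links {z} Z + links X Z" for Z using f(1) zw(1) by (rule links_insert)
      ultimately show ?thesis by simp
    qed
    have dX: "cut_size (insert x X) = links X ?Y + links X {y} + links {x} ?Y + 1"
      "cut_size (insert y X) = links X ?Y + links X {x} + links {y} ?Y + 1"
      using Done[of x y] Done[of y x] mxy dist by auto
    have c: "card (insert x X) = Suc (card X)" "card (insert y X) = Suc (card X)"
      "card (X \<union> {x, y}) = Suc (Suc (card X))" using f nx dist by auto
    have cY: "card (V - X) = card ?Y + 2" "card (V - insert x X) = card ?Y + 1"
      "card (V - insert y X) = card ?Y + 1" "V - (X \<union> {x, y}) = ?Y"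
    proof -
      have "V - X = insert x (insert y ?Y)" "V - insert x X = insert y ?Y" "V - insert y X = insert x ?Y"
        using nx xyV dist by auto
      then show "card (V - X) = card ?Y + 2" "card (V - insert x X) = card ?Y + 1"
        "card (V - insert y X) = card ?Y + 1" using f nx dist by auto
      show "V - (X \<union> {x, y}) = ?Y" by auto
    qed
    have g0: "4 \<le> cut_size X" using cut4[OF XV(1)] X cY by simp
    have g2: "4 \<le> cut_size (X \<union> {x, y})" using cut4[of "X \<union> {x, y}"] X c cY XV xyV by simp
    \<comment> \<open>A 4-cut here has three or more vertices on each side; parity makes it four,
      the size that \<open>removable\<close> forbids.\<close>
    have g1: "5 \<le> cut_size (insert z X)" if zw: "z \<in> {x, y}" for z
    proof (rule ccontr)
      assume lt: "\<not> ?thesis"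
      have sub: "insert z X \<subseteq> V" using zw XV xyV by auto
      have cc: "card (insert z X) = Suc (card X)" "card (V - insert z X) = card ?Y + 1"
        using zw c cY by auto
      have "4 \<le> cut_size (insert z X)" using cut4[OF sub] X cc by simp
      then have d4: "cut_size (insert z X) = 4" using lt by simp
      have "even (card (insert z X))" using even_cut_size[OF sub] d4 by simp
      then have big: "4 \<le> card (insert z X)" using X(2) cc by presburger
      have "even (card (V - insert z X))"
        using even_cut_size[of "V - insert z X"] cut_size_compl[OF sub] d4 by simp
      then have big': "4 \<le> card (V - insert z X)" using X(3) cc by presburger
      show False
      proof (cases "z = x")
        case True
        then show False using rem[unfolded removable_def, rule_format, of "insert x X"] sub big big' d4 nx dist by auto
      next
        case False
        then have z: "z = y" using zw by simp
        show False
          using rem[unfolded removable_def, rule_format, of "V - insert y X"] sub big big' d4 nx dist xyV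
            cut_size_compl[OF sub] unfolding z by (auto simp: double_diff)
      qed
    qed
    note all = g0[unfolded D0 mxX] g2[unfolded Dxy mxX] g1[of x, unfolded dX mxX] g1[of y, unfolded dX mxX]
    show "4 \<le> H.cut_size X"
      unfolding dH using all
      by (cases "a \<in> X"; cases "b \<in> X"; cases "c \<in> X"; cases "e \<in> X") simp_all
  qed
qed

lemma good_nbrs:
  assumes "good x y"
  obtains a b c e where "{w. adj x w} = {y, a, b}" "{w. adj y w} = {x, c, e}"
    "distinct [x, y, a, b, c, e]" "removable x y"
    "\<not> (adj a c \<and> adj b e)" "\<not> (adj a e \<and> adj b c)"
proof -
  have xy: "adj x y" "removable x y" "\<not> domino_rung x y" using assms by (auto simp: good_def)
  obtain a b where ab: "{w. adj x w} = {y, a, b}" "y \<noteq> a" "y \<noteq> b" "a \<noteq> b" "adj x a" "adj x b"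
    using other_nbrs[OF xy(1)] .
  obtain c e where ce: "{w. adj y w} = {x, c, e}" "x \<noteq> c" "x \<noteq> e" "c \<noteq> e" "adj y c" "adj y e"
    using other_nbrs[OF adj_sym[OF xy(1)]] .
  have "p \<noteq> q" if "adj x p" "adj y q" for p q
    using no_triangle[of x p y] that xy(1) adj_sym by blast
  then have "a \<noteq> c" "a \<noteq> e" "b \<noteq> c" "b \<noteq> e" using ab ce by auto
  moreover have "x \<noteq> y" "x \<noteq> a" "x \<noteq> b" "y \<noteq> c" "y \<noteq> e" using xy ab ce adj_neq by auto
  ultimately have d: "distinct [x, y, a, b, c, e]" using ab ce by auto
  have "\<not> (adj a c \<and> adj b e)"
    using xy(3) ab ce unfolding domino_rung_def by metis
  moreover have "\<not> (adj a e \<and> adj b c)"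
    using xy(3) ab ce unfolding domino_rung_def by metis
  ultimately show ?thesis using that[OF ab(1) ce(1) d xy(2)] by blast
qed

end

section \<open>Paths and cycles through prescribed edges\<close>

lemma first_hit:
  assumes "R\<^sup>*\<^sup>* w t" "w \<notin> P" "t \<in> P"
  shows "\<exists>q z. q \<noteq> [] \<and> hd q = w \<and> distinct q \<and> successively R (q @ [z]) \<and> set q \<inter> P = {} \<and> z \<in> P"
  using assms
proof (induction rule: converse_rtranclp_induct)
  case (step w w')
  show ?case
  proof (cases "w' \<in> P")
    case True
    then show ?thesis using step by (intro exI[of _ "[w]"] exI[of _ w']) auto
  next
    case False
    then obtain q z where q: "q \<noteq> []" "hd q = w'" "distinct q" "successively R (q @ [z])" "set q \<inter> P = {}" "z \<in> P"
      using step by blast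
    show ?thesis
    \<comment> \<open>If the path already visits \<open>w\<close>, it is shortened to start at that
      visit, which keeps it free of repetitions.\<close>
    proof (cases "w \<in> set q")
      case True
      then obtain q1 q2 where s: "q = q1 @ w # q2" by (meson split_list)
      have "successively R (q1 @ ((w # q2) @ [z]))" using q(4) s by simp
      then have "successively R ((w # q2) @ [z])" unfolding successively_append_iff[of _ q1] by blast
      then show ?thesis using q s by (intro exI[of _ "w # q2"] exI[of _ z]) auto
    next
      case False
      have "successively R (w # q @ [z])" using q(1,2,4) step(1) by (cases q) auto
      then show ?thesis using q False step(4) by (intro exI[of _ "w # q"] exI[of _ z]) auto
    qed
  qed
qed simp

context cyc4_adj
begin

text \<open>If deleting \<open>z\<close> separated \<open>X\<close> from \<open>Y\<close>, every
  edge leaving either set would end at \<open>z\<close>. The two cut sizes would sum to at most 3,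
  whereas each is at least 3.\<close>

lemma connected_avoiding:
  assumes "z \<in> V" "u \<in> V - {z}" "w \<in> V - {z}"
  shows "(\<lambda>s t. adj s t \<and> s \<noteq> z \<and> t \<noteq> z)\<^sup>*\<^sup>* u w"
proof (rule ccontr)
  let ?R = "\<lambda>s t. adj s t \<and> s \<noteq> z \<and> t \<noteq> z"
  assume nr: "\<not> ?R\<^sup>*\<^sup>* u w"
  define X Y where "X = {t \<in> V - {z}. ?R\<^sup>*\<^sup>* u t}" and "Y = V - {z} - X"
  have XY: "u \<in> X" "w \<in> Y" using assms nr by (auto simp: X_def Y_def)
  have sub: "X \<subseteq> V" "Y \<subseteq> V" by (auto simp: X_def Y_def)
  note f = fin[OF sub(1)] fin[OF sub(2)]
  have VX: "V - X = Y \<union> {z}" "V - Y = X \<union> {z}" using assms(1) by (auto simp: X_def Y_def)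
  have dj: "Y \<inter> {z} = {}" "X \<inter> {z} = {}" "X \<inter> Y = {}" by (auto simp: X_def Y_def)
  have m0: "links X Y = 0"
  proof (subst links_0[OF f], intro ballI notI)
    fix s t assume st: "s \<in> X" "t \<in> Y" "adj s t"
    then have "?R\<^sup>*\<^sup>* u s" "?R s t" by (auto simp: X_def Y_def)
    then have "?R\<^sup>*\<^sup>* u t" by (rule rtranclp.rtrancl_into_rtrancl)
    then show False using st(2) by (auto simp: X_def Y_def)
  qed
  have dX: "cut_size X = links X {z}" "cut_size Y = links Y {z}"
    using cut_size_parts[OF sub(1) VX(1) dj(1)] cut_size_parts[OF sub(2) VX(2) dj(2)] m0 links_sym[of Y X] by simp_all
  have "V = X \<union> (Y \<union> {z})" using VX sub by blast
  then have "links {z} V = links {z} X + links {z} Y + links {z} {z}"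
    using links_Un_right[of X "Y \<union> {z}" "{z}"] links_Un_right[of Y "{z}" "{z}"] f dj by (simp add: Int_Un_distrib)
  then have "cut_size X + cut_size Y \<le> 3" using links_V[of "{z}"] assms(1) dX links_sym[of X "{z}"] links_sym[of Y "{z}"] by simp
  moreover have "2 \<le> card (V - X)" "2 \<le> card (V - Y)"
  proof -
    have "card Y \<noteq> 0" "card X \<noteq> 0" using XY f by auto
    moreover have "card (V - X) = Suc (card Y)" "card (V - Y) = Suc (card X)" unfolding VX using f dj by auto
    ultimately show "2 \<le> card (V - X)" "2 \<le> card (V - Y)" by linarith+
  qed
  ultimately show False using cut_size_ge3[OF sub(1)] cut_size_ge3[OF sub(2)] XY by fastforce
qed

definition is_path :: "'a \<Rightarrow> 'a \<Rightarrow> 'a list \<Rightarrow> bool" where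
  "is_path a b p \<longleftrightarrow> p \<noteq> [] \<and> distinct p \<and> successively adj p \<and> hd p = a \<and> last p = b \<and> set p \<subseteq> V"

lemma is_path_rev: "is_path a b p \<Longrightarrow> is_path b a (rev p)"
proof -
  assume p: "is_path a b p"
  have "successively (\<lambda>x y. adj y x) p"
    using p adj_sym successively_mono[of adj p "\<lambda>x y. adj y x"] unfolding is_path_def by blast
  then show ?thesis using p by (auto simp: is_path_def hd_rev last_rev)
qed

text \<open>The segment \<open>q1\<close> between \<open>v\<close> and \<open>z\<close> is exchanged
  for \<open>q\<close>, whose first edge is the one that the path is meant to traverse. An empty
  \<open>q\<close> stands for a direct edge from \<open>v\<close> to \<open>z\<close>.\<close>

lemma is_path_detour:
  assumes p: "is_path a b (p1 @ v # q1 @ z # q2)" and q: "successively adj (v # q @ [z])" "distinct q"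
    "set q \<inter> set (p1 @ v # q1 @ z # q2) = {}" "set q \<subseteq> V"
  shows "is_path a b (p1 @ v # q @ z # q2)" "{v, hd (q @ [z])} \<in> ledges (p1 @ v # q @ z # q2)"
proof -
  have s: "successively adj (p1 @ v # q1 @ z # q2)" using p by (simp add: is_path_def)
  then have s1: "successively adj (p1 @ [v])"
    using successively_append_iff[of adj "p1 @ [v]" "q1 @ z # q2"] by simp
  have s2: "successively adj (z # q2)"
    using s successively_append_iff[of adj "p1 @ v # q1" "z # q2"] by simp
  have "successively adj (v # q)" using q(1) successively_append_iff[of adj "v # q" "[z]"] by simp
  have h: "p1 @ v # q @ z # q2 = (p1 @ [v]) @ (q @ z # q2)" by simp
  have qz: "successively adj (q @ [z])" using q(1) by (cases q) auto
  then have 1: "successively adj (q @ z # q2)"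
    using s2 unfolding successively_append_iff by auto
  have "adj v (hd (q @ [z]))" using q(1) by (cases q) auto
  then have 2: "adj v (hd (q @ z # q2))" by (cases q) auto
  have "successively adj (p1 @ v # q @ z # q2)"
    unfolding h successively_append_iff[of _ "p1 @ [v]"] using s1 1 2 by simp
  moreover have "hd (p1 @ v # q @ z # q2) = hd (p1 @ v # q1 @ z # q2)" by (cases p1) auto
  moreover have "last (p1 @ v # q @ z # q2) = last (p1 @ v # q1 @ z # q2)" by simp
  ultimately show "is_path a b (p1 @ v # q @ z # q2)"
    using p q(2-4) unfolding is_path_def by auto
  show "{v, hd (q @ [z])} \<in> ledges (p1 @ v # q @ z # q2)"
    by (subst ledges_append) (cases q, auto)
qed

text \<open>Leave the path at \<open>v\<close> along \<open>vw\<close> and go on, avoiding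
  \<open>v\<close>, until the path is met again at \<open>z\<close>; this detour replaces the
  segment between \<open>v\<close> and \<open>z\<close>. If \<open>z\<close> precedes
  \<open>v\<close>, the path is reversed first.\<close>

lemma path_through_edge_at:
  assumes p: "is_path a b p" "a \<noteq> b" and v: "v \<in> set p" and vw: "adj v w"
  shows "\<exists>p'. is_path a b p' \<and> {v, w} \<in> ledges p'"
proof -
  have "\<exists>q z. hd (q @ [z]) = w \<and> distinct q \<and> successively adj (v # q @ [z]) \<and>
      set q \<inter> set p = {} \<and> set q \<subseteq> V \<and> z \<in> set p \<and> z \<noteq> v"
  proof (cases "w \<in> set p")
    case True
    then show ?thesis using vw adj_neq by (intro exI[of _ "[]"] exI[of _ w]) auto
  next
    case False
    define t where "t = (if v = a then b else a)"
    have t: "t \<in> set p" "t \<noteq> v" using p unfolding t_def is_path_def by auto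
    let ?R = "\<lambda>s t. adj s t \<and> s \<noteq> v \<and> t \<noteq> v"
    have "?R\<^sup>*\<^sup>* w t"
      using p v t vw adj_V adj_V2 adj_neq[OF vw] by (intro connected_avoiding) (auto simp: is_path_def)
    then obtain q z where q: "q \<noteq> []" "hd q = w" "distinct q" "successively ?R (q @ [z])"
        "set q \<inter> set p = {}" "z \<in> set p"
      using first_hit[of ?R w t "set p"] False t by blast
    have R: "?R (last q) z" using q(1,4) unfolding successively_append_iff by simp
    have sa: "successively adj (q @ [z])" using q(4) by (rule successively_mono) auto
    have "s \<in> V" if s: "s \<in> set q" for s
    proof -
      obtain q1 q2 where "q = q1 @ s # q2" using s by (meson split_list)
      then have "successively adj (q1 @ (s # q2 @ [z]))" using sa by simp
      then have "successively adj (s # q2 @ [z])" unfolding successively_append_iff[of _ q1] by blast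
      then show ?thesis by (cases q2) (auto intro: adj_V)
    qed
    moreover have "successively adj (v # q @ [z])" using sa q(1,2) vw by (cases q) auto
    ultimately show ?thesis using q R by (intro exI[of _ q] exI[of _ z]) auto
  qed
  then obtain q z where q: "hd (q @ [z]) = w" "distinct q" "successively adj (v # q @ [z])"
      "set q \<inter> set p = {}" "set q \<subseteq> V" "z \<in> set p" "z \<noteq> v" by blast
  obtain p1 p2 where s: "p = p1 @ v # p2" using v by (meson split_list)
  then consider "z \<in> set p2" | "z \<in> set p1" using q(6,7) by auto
  then show ?thesis
  proof cases
    case 1
    then obtain q1 q2 where "p2 = q1 @ z # q2" by (meson split_list)
    then show ?thesis using is_path_detour[of a b p1 v q1 z q2 q] p(1) q s by auto
  next
    case 2
    then obtain q1 q2 where s2: "p1 = q1 @ z # q2" by (meson split_list)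
    have r: "rev p = rev p2 @ v # rev q2 @ z # rev q1" using s s2 by simp
    have "is_path b a (rev p2 @ v # rev q2 @ z # rev q1)" using is_path_rev[OF p(1)] r by simp
    moreover have "set q \<inter> set (rev p2 @ v # rev q2 @ z # rev q1) = {}" using q(4) unfolding r[symmetric] by simp
    ultimately have "is_path b a (rev p2 @ v # q @ z # rev q1)" "{v, w} \<in> ledges (rev p2 @ v # q @ z # rev q1)"
      using is_path_detour[of b a "rev p2" v "rev q2" z "rev q1" q] q by auto
    then show ?thesis using is_path_rev ledges_rev by blast
  qed
qed

lemma path_through_vertex:
  assumes ab: "adj a b" and z: "z \<in> V"
  shows "\<exists>p. is_path a b p \<and> z \<in> set p"
proof -
  have aV: "a \<in> V" "b \<in> V" "a \<noteq> b" using ab adj_V adj_V2 adj_neq by auto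
  have p0: "is_path a b [a, b]" using aV ab by (simp add: is_path_def)
  \<comment> \<open>Deleting any third vertex \<open>y\<close> yields a walk from \<open>a\<close>
    to \<open>z\<close> by \<open>connected_avoiding\<close>. Along it, each edge brings one more
    vertex onto some path from \<open>a\<close> to \<open>b\<close>.\<close>
  have "\<not> V \<subseteq> {a, z}" using card_mono[of "{a, z}" V] card6 by (auto simp: card_insert_if split: if_splits)
  then obtain y where y: "y \<in> V" "y \<noteq> a" "y \<noteq> z" by blast
  have "(\<lambda>s t. adj s t \<and> s \<noteq> y \<and> t \<noteq> y)\<^sup>*\<^sup>* a z"
    using y z aV by (intro connected_avoiding) auto
  then show ?thesis
  proof (induction rule: rtranclp_induct)
    case base
    then show ?case using p0 by (intro exI[of _ "[a, b]"]) simp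
  next
    case (step s t)
    then obtain p where "is_path a b p" "s \<in> set p" by blast
    then obtain p' where "is_path a b p'" "{s, t} \<in> ledges p'"
      using path_through_edge_at aV(3) step(2) by blast
    then show ?case using ledges_subset_set by fastforce
  qed
qed

lemma path_through_edge:
  assumes "adj a b" "adj c e"
  shows "\<exists>p. is_path a b p \<and> {c, e} \<in> ledges p"
  using path_through_vertex[OF assms(1)] path_through_edge_at adj_V[OF assms(2)] adj_neq[OF assms(1)] assms(2)
  by metis

end

text \<open>A path from \<open>a\<close> to \<open>b\<close> that traverses \<open>ce\<close> is
  closed by \<open>ab\<close>. It guarantees that the two edges to be bridged have a cycle
  spread.\<close>

lemma cycle_through_two_edges:
  assumes "cyc4_adj (verts G) (gadj G)" "{a, b} \<in> edges G" "{c, e} \<in> edges G" "{a, b} \<noteq> {c, e}"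
  obtains vs where "is_cycle G vs" "{a, b} \<in> cycle_edges vs" "{c, e} \<in> cycle_edges vs"
proof -
  interpret cyc4_adj "verts G" "gadj G" by fact
  obtain p where p: "is_path a b p" "{c, e} \<in> ledges p" using path_through_edge assms(2,3) by blast
  have ne: "p \<noteq> []" using p(1) by (simp add: is_path_def)
  have ce: "cycle_edges p = insert {a, b} (ledges p)"
    using cycle_edges_alt[OF ne] p(1) by (simp add: is_path_def insert_commute)
  have "ledges p \<subseteq> edges G"
  proof -
    have "successively (gadj G) xs \<Longrightarrow> ledges xs \<subseteq> edges G" for xs
      by (induction xs rule: ledges.induct) auto
    then show ?thesis using p(1) by (simp add: is_path_def)
  qed
  moreover have "3 \<le> length p"
  proof (rule ccontr)
    assume "\<not> 3 \<le> length p"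
    moreover obtain u v ps where "p = u # v # ps" using p(2) by (cases p rule: ledges.cases) auto
    ultimately have "p = [u, v]" by (cases ps) auto
    then show False using p assms(4) by (auto simp: is_path_def)
  qed
  ultimately have "is_cycle G p" using p(1) assms(2) ce unfolding is_cycle_def is_path_def by auto
  then show ?thesis using that ce p(2) by blast
qed

section \<open>Generation from the ladders\<close>

lemma planar_suppress:
  assumes pl: "planar G" and ax: "{a, x} \<in> edges G" and bx: "{b, x} \<in> edges G"
    and ab: "a \<noteq> b" "a \<noteq> x" "b \<noteq> x" and V: "V' \<subseteq> verts G - {x}"
    and E: "E' \<subseteq> insert {a, b} {f \<in> edges G. x \<notin> f}"
  shows "planar (UGraph V' E')"
proof -
  obtain p \<gamma> where D: "drawing G p \<gamma>" using pl planar_drawing by blast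
  obtain g where g: "arc g" "pathstart g = p a" "pathfinish g = p x" "path_image g = path_image (\<gamma> {a, x})"
    using drawing_arc[OF D ax] .
  obtain h where h: "arc h" "pathstart h = p x" "pathfinish h = p b" "path_image h = path_image (\<gamma> {b, x})"
    using drawing_arc[OF D, of x b] bx by (auto simp: insert_commute)
  have "{a, x} \<noteq> {b, x}" using ab by (auto simp: doubleton_eq_iff)
  then have "path_image g \<inter> path_image h \<subseteq> p ` ({a, x} \<inter> {b, x})"
    unfolding g h by (rule drawingD(5)[OF D ax bx])
  then have gh: "arc (g +++ h)" using g h ab by (intro arc_join) auto
  have im: "path_image (g +++ h) = path_image (\<gamma> {a, x}) \<union> path_image (\<gamma> {b, x})"
    using g h by (simp add: path_image_join)
  define \<gamma>' where "\<gamma>' f = (if f = {a, b} then g +++ h else \<gamma> f)" for f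
  have old: "f \<in> edges G \<and> x \<notin> f \<and> \<gamma>' f = \<gamma> f" if "f \<in> E'" "f \<noteq> {a, b}" for f
    using that E by (auto simp: \<gamma>'_def)
  have new: "path_image (\<gamma>' {a, b}) \<inter> path_image (\<gamma> f) \<subseteq> p ` ({a, b} \<inter> f)"
    if f: "f \<in> edges G" "x \<notin> f" for f
  proof -
    have "{a, x} \<noteq> f" "{b, x} \<noteq> f" using f(2) by auto
    then have "path_image (\<gamma> {a, x}) \<inter> path_image (\<gamma> f) \<subseteq> p ` ({a, x} \<inter> f)"
      "path_image (\<gamma> {b, x}) \<inter> path_image (\<gamma> f) \<subseteq> p ` ({b, x} \<inter> f)"
      using drawingD(5)[OF D ax f(1)] drawingD(5)[OF D bx f(1)] by simp_all
    moreover have "p ` ({a, x} \<inter> f) \<subseteq> p ` ({a, b} \<inter> f)" "p ` ({b, x} \<inter> f) \<subseteq> p ` ({a, b} \<inter> f)"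
      using f(2) by (intro image_mono; auto)+
    moreover have "path_image (\<gamma>' {a, b}) = path_image (\<gamma> {a, x}) \<union> path_image (\<gamma> {b, x})"
      by (simp add: \<gamma>'_def im)
    ultimately show ?thesis by blast
  qed
  have "drawing (UGraph V' E') p \<gamma>'"
    unfolding drawing_def ugraph.sel
  proof (intro conjI ballI impI)
    show "inj_on p V'" using drawingD(1)[OF D] V inj_on_subset by blast
    fix f assume f: "f \<in> E'"
    show "arc (\<gamma>' f)" "{pathstart (\<gamma>' f), pathfinish (\<gamma>' f)} = p ` f"
    proof -
      show "arc (\<gamma>' f)"
        using gh old[OF f] drawingD(2)[OF D, of f] by (cases "f = {a, b}") (auto simp: \<gamma>'_def)
      show "{pathstart (\<gamma>' f), pathfinish (\<gamma>' f)} = p ` f"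
      proof (cases "f = {a, b}")
        case True
        then show ?thesis using g h by (simp add: \<gamma>'_def)
      next
        case False
        then show ?thesis using old[OF f] drawingD(3)[OF D, of f] by simp
      qed
    qed
    {
      fix v assume v: "v \<in> V'" "p v \<in> path_image (\<gamma>' f)"
      have vG: "v \<in> verts G" "v \<noteq> x" using V v by auto
      show "v \<in> f"
      proof (cases "f = {a, b}")
        case True
        then have "p v \<in> path_image (\<gamma> {a, x}) \<or> p v \<in> path_image (\<gamma> {b, x})"
          using v(2) im by (auto simp: \<gamma>'_def)
        then show ?thesis using drawingD(4)[OF D ax vG(1)] drawingD(4)[OF D bx vG(1)] vG(2) True by auto
      next
        case False
        then show ?thesis using old[OF f] drawingD(4)[OF D, of f v] v vG by simp
      qed
    }
    fix f' assume f': "f' \<in> E'" "f \<noteq> f'"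
    show "path_image (\<gamma>' f) \<inter> path_image (\<gamma>' f') \<subseteq> p ` (f \<inter> f')"
    proof (cases "f = {a, b}")
      case True
      then show ?thesis using new[of f'] old[OF f'(1)] f'(2) by simp
    next
      case False
      note o = old[OF f False]
      show ?thesis
      proof (cases "f' = {a, b}")
        case True
        then show ?thesis using new[of f] o by (simp add: Int_commute)
      next
        case False
        then show ?thesis using old[OF f'(1) False] o drawingD(5)[OF D, of f f'] f'(2) by simp
      qed
    qed
  qed
  then show ?thesis using planar_drawing by blast
qed

section \<open>Non-planarity of Moebius ladders and of K_{3,3}\<close>

lemma inj_on_two_sequences:
  fixes U W :: "nat \<Rightarrow> 'a"
  assumes "inj_on U {..<m}" "inj_on W {..<m}" "U ` {..<m} \<inter> W ` {..<m} = {}"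
  shows "inj_on (\<lambda>r. if r < m then U r else W (r - m)) {..<2 * m}"
proof (rule inj_onI)
  let ?T = "\<lambda>r. if r < m then U r else W (r - m)"
  fix i j assume ij: "i \<in> {..<2 * m}" "j \<in> {..<2 * m}" "?T i = ?T j"
  have x: "U i' \<noteq> W j'" if "i' < m" "j' < m" for i' j' using assms(3) that by blast
  show "i = j"
  proof (cases "i < m"; cases "j < m")
    assume "i < m" "j < m"
    then show ?thesis using ij assms(1) by (simp add: inj_on_eq_iff)
  next
    assume "i < m" "\<not> j < m"
    then show ?thesis using ij x[of i "j - m"] by simp
  next
    assume "\<not> i < m" "j < m"
    then have "U j = W (i - m)" "i - m < m" using ij by auto
    then show ?thesis using x[of j "i - m"] \<open>j < m\<close> by simp
  next
    assume "\<not> i < m" "\<not> j < m"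
    then have "i - m = j - m" using ij assms(2) by (auto simp: inj_on_def)
    then show ?thesis using \<open>\<not> i < m\<close> \<open>\<not> j < m\<close> by simp
  qed
qed

text \<open>Because of the twist, the row \<open>U\<close> followed by the row \<open>W\<close> is a
  single cycle of length \<open>2 * m\<close>, on which \<open>U i\<close> and \<open>W i\<close>
  are antipodal.\<close>

lemma moebius_not_planar:
  assumes pl: "planar G" and sg: "simple_graph G" and m: "3 \<le> m"
    and inj: "inj_on U {..<m}" "inj_on W {..<m}" "U ` {..<m} \<inter> W ` {..<m} = {}"
    and rim: "\<And>i. i < m \<Longrightarrow> {U i, U (Suc i)} \<in> edges G" "\<And>i. i < m \<Longrightarrow> {W i, W (Suc i)} \<in> edges G"
    and rung: "\<And>i. i < m \<Longrightarrow> {U i, W i} \<in> edges G"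
    and twist: "U m = W 0" "W m = U 0"
  shows False
proof -
  define T where "T r = (if r < m then U r else W (r - m))" for r
  define S where "S n = T (n mod (2 * m))" for n
  have injT: "inj_on T {..<2 * m}"
    using inj_on_two_sequences[OF inj] unfolding T_def .
  show False
  proof (rule twisted_strip_not_planar[OF pl m, of S])
    show "S i = S j \<longleftrightarrow> i mod (2 * m) = j mod (2 * m)" for i j
      unfolding S_def using inj_on_eq_iff[OF injT, of "i mod (2 * m)" "j mod (2 * m)"] m by simp
    show r: "{S i, S (Suc i)} \<in> edges G" for i
    proof -
      define r where "r = i mod (2 * m)"
      have r: "r < 2 * m" using m by (simp add: r_def)
      have s: "Suc i mod (2 * m) = (if Suc r = 2 * m then 0 else Suc r)"
        by (simp add: r_def mod_Suc)
      have S: "S i = T r" "S (Suc i) = T (if Suc r = 2 * m then 0 else Suc r)"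
        unfolding S_def s by (simp_all add: r_def)
      consider "Suc r < m" | "Suc r = m" | "m \<le> r" "Suc r < 2 * m" | "Suc r = 2 * m" using r by linarith
      then show ?thesis
      proof cases
        case 1
        then show ?thesis using rim(1)[of r] S by (simp add: T_def)
      next
        case 2
        then show ?thesis using rim(1)[of r] S twist m by (auto simp: T_def)
      next
        case 3
        then show ?thesis using rim(2)[of "r - m"] S by (auto simp: T_def Suc_diff_le)
      next
        case 4
        then have "r - m < m" "Suc (r - m) = m" "\<not> r < m" using m by linarith+
        then show ?thesis using rim(2)[of "r - m"] S twist 4 m by (simp add: T_def)
      qed
    qed
    show "{S i, S (i + m)} \<in> edges G" for i
    proof -
      define r where "r = i mod (2 * m)"
      have r: "r < 2 * m" using m by (simp add: r_def)
      have s: "(i + m) mod (2 * m) = (r + m) mod (2 * m)" by (simp add: r_def mod_add_left_eq)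
      show ?thesis
      proof (cases "r < m")
        case True
        then have "(r + m) mod (2 * m) = r + m" by simp
        then show ?thesis using rung[OF True] True unfolding S_def s by (simp add: T_def r_def[symmetric])
      next
        case False
        have "(r + m) mod (2 * m) = (r - m + 2 * m) mod (2 * m)" using False by (simp add: mult_2)
        also have "\<dots> = (r - m) mod (2 * m)" by simp
        also have "\<dots> = r - m" using r by (intro mod_less) linarith
        finally have "(r + m) mod (2 * m) = r - m" .
        moreover have "r - m < m" using r False by linarith
        ultimately show ?thesis using rung[of "r - m"] False unfolding S_def s
          by (simp add: T_def r_def[symmetric] insert_commute)
      qed
    qed
    show "S i \<in> verts G" for i using gadj_verts(2)[OF sg r[of i]] .
  qed
qed

text \<open>Without triangles the three neighbours \<open>p\<close>, \<open>q\<close>,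
  \<open>r\<close> of \<open>x\<close> must all be joined to the other two vertices
  \<open>s\<close>, \<open>t\<close>, which gives K_{3,3}. This keeps the induction from dropping
  below eight vertices.\<close>

lemma cyc4_adj_6_not_planar:
  assumes c: "cyc4_adj (verts G) (gadj G)" and sg: "simple_graph G" and c6: "card (verts G) = 6"
  shows "\<not> planar G"
proof
  assume pl: "planar G"
  interpret cyc4_adj "verts G" "gadj G" by fact
  let ?V = "verts G"
  have "?V \<noteq> {}" using c6 by auto
  then obtain x where x: "x \<in> ?V" by blast
  have "card {w. gadj G x w} = 3" using deg3[OF x] .
  then obtain p0 where "gadj G x p0" by fastforce
  then obtain q r where N0: "{w. gadj G x w} = {p0, q, r}" "p0 \<noteq> q" "p0 \<noteq> r" "q \<noteq> r" "gadj G x q" "gadj G x r"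
    by (rule other_nbrs)
  define p where "p = p0"
  note N = N0[folded p_def]
  have xp: "gadj G x p" using N(1) by blast
  have d4: "x \<noteq> p" "x \<noteq> q" "x \<noteq> r" using xp N(5,6) adj_neq by auto
  have sub: "{x, p, q, r} \<subseteq> ?V" using x xp N(5,6) adj_V2 by auto
  have "card {x, p, q, r} = 4" using d4 N(2-4) by simp
  then have "card (?V - {x, p, q, r}) = 2" using c6 sub by (simp add: card_Diff_subset)
  then obtain s t where st: "?V - {x, p, q, r} = {s, t}" "s \<noteq> t" by (meson card_2_iff)
  have V: "?V = {x, p, q, r, s, t}" using st(1) sub by auto
  have dst: "s \<notin> {x, p, q, r}" "t \<notin> {x, p, q, r}" using st(1) by blast+
  have nbrs: "gadj G u s \<and> gadj G u t" if u: "u \<in> {p, q, r}" for u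
  proof -
    have xu: "gadj G x u" using u xp N by auto
    have "{w. gadj G u w} \<subseteq> {x, s, t}"
    proof
      fix w assume "w \<in> {w. gadj G u w}"
      then have uw: "gadj G u w" by simp
      then have "w \<in> {x, p, q, r, s, t}" using adj_V2 V by blast
      moreover have "\<not> gadj G x w" using no_triangle[OF xu uw] adj_sym by blast
      then have "w \<notin> {p, q, r}" using xp N by auto
      ultimately show "w \<in> {x, s, t}" by auto
    qed
    moreover have "card {w. gadj G u w} = 3" using deg3 u sub by auto
    moreover have "card {x, s, t} = 3" using dst st(2) by auto
    ultimately have "{w. gadj G u w} = {x, s, t}" by (simp add: card_subset_eq)
    then show ?thesis by blast
  qed
  \<comment> \<open>The Hamiltonian cycle \<open>x p s q t r\<close> cut into two rows, with rungs
    \<open>xq\<close>, \<open>pt\<close>, \<open>sr\<close>. The fourth entries record the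
    twist.\<close>
  define U where "U i = [x, p, s, q] ! i" for i
  define W where "W i = [q, t, r, x] ! i" for i
  have lt: "i < 3 \<longleftrightarrow> i = 0 \<or> i = Suc 0 \<or> i = Suc (Suc 0)" for i :: nat by auto
  have s3: "{..<3} = {0, Suc 0, Suc (Suc 0)}" by (auto simp: lt)
  have e: "gadj G p s" "gadj G s p" "gadj G s q" "gadj G q t" "gadj G t r" "gadj G r x" "gadj G q s" "gadj G p t"
    "gadj G r t" "gadj G s r" "gadj G r s"
    using nbrs N adj_sym by blast+
  show False
  proof (rule moebius_not_planar[OF pl sg, of 3 U W])
    show "inj_on U {..<3}" unfolding s3 using d4 N(2-4) dst by (auto simp: U_def)
    show "inj_on W {..<3}" unfolding s3 using d4 N(2-4) dst by (auto simp: W_def)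
    show "U ` {..<3} \<inter> W ` {..<3} = {}" unfolding s3 using d4 N(2-4) dst st(2) by (auto simp: U_def W_def)
    show "gadj G (U i) (U (Suc i))" if "i < 3" for i
      using that xp e unfolding lt U_def by (elim disjE) simp_all
    show "gadj G (W i) (W (Suc i))" if "i < 3" for i
      using that e unfolding lt W_def by (elim disjE) simp_all
    show "gadj G (U i) (W i)" if "i < 3" for i
      using that e N(5) unfolding lt U_def W_def by (elim disjE) simp_all
  qed (simp_all add: U_def W_def)
qed

section \<open>Recognising ladders, transport along isomorphisms, and the induction\<close>

lemma graph_iso_sym:
  assumes "graph_iso H G" "\<And>e. e \<in> edges H \<Longrightarrow> e \<subseteq> verts H"
  shows "graph_iso G H"
proof -
  obtain \<phi> where p: "bij_betw \<phi> (verts H) (verts G)" "edges G = (\<lambda>e. \<phi> ` e) ` edges H"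
    using assms(1) unfolding graph_iso_def by blast
  let ?i = "inv_into (verts H) \<phi>"
  have "?i ` \<phi> ` e = e" if "e \<in> edges H" for e
    using inv_into_image_cancel[of \<phi> "verts H" e] p(1) assms(2)[OF that] by (simp add: bij_betw_def)
  then have "edges H = (\<lambda>e. ?i ` e) ` edges G" unfolding p(2) image_image by force
  then show ?thesis unfolding graph_iso_def using bij_betw_inv_into[OF p(1)] by blast
qed

text \<open>\<open>T\<close> follows the numbering of \<open>ladder\<close>. No edge is left over
  because the two row neighbours and the rung already exhaust the degree of each vertex.\<close>

lemma closed_strip_ladder:
  assumes sg: "simple_graph G" and c: "cyc4_adj8 (verts G) (gadj G)"
    and cs: "cyc4_adj8.closed_strip (verts G) (gadj G) k U W" and cl: "U k = U 0" "W k = W 0"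
  shows "G \<cong>\<^sub>G ladder (2 * k)"
proof -
  interpret cyc4_adj8 "verts G" "gadj G" by fact
  note cs' = cs[unfolded closed_strip_def]
  have k: "4 \<le> k" and injU: "inj_on U {..<k}" and injW: "inj_on W {..<k}"
    and dj: "U ` {..<k} \<inter> W ` {..<k} = {}" and V: "verts G = U ` {..<k} \<union> W ` {..<k}"
    and adj: "\<And>i. gadj G (U i) (U (Suc i))" "\<And>i. gadj G (W i) (W (Suc i))" "\<And>i. gadj G (U i) (W i)"
    using cs' by auto
  have UW: "U i \<noteq> W j" if "i < k" "j < k" for i j using dj that by blast
  have Umod: "U (Suc i mod k) = U (Suc i)" "W (Suc i mod k) = W (Suc i)" if "i < k" for i
    using that cl by (cases "Suc i = k"; simp)+
  define T where "T r = (if r < k then U r else W (r - k))" for r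
  have bij: "bij_betw T {..<2 * k} (verts G)"
  proof (rule bij_betw_imageI)
    show "inj_on T {..<2 * k}"
      using inj_on_two_sequences[OF injU injW dj] unfolding T_def .
    show "T ` {..<2 * k} = verts G"
    proof
      show "T ` {..<2 * k} \<subseteq> verts G" unfolding V by (auto simp: T_def)
      show "verts G \<subseteq> T ` {..<2 * k}"
      proof
        fix v assume "v \<in> verts G"
        then consider i where "i < k" "v = U i" | i where "i < k" "v = W i" unfolding V by blast
        then show "v \<in> T ` {..<2 * k}"
        proof cases
          case (1 i)
          then show ?thesis by (intro image_eqI[of _ _ i]) (auto simp: T_def)
        next
          case (2 i)
          then show ?thesis by (intro image_eqI[of _ _ "k + i"]) (auto simp: T_def)
        qed
      qed
    qed
  qed
  let ?E = "{{U i, U (Suc i)} | i. i < k} \<union> {{W i, W (Suc i)} | i. i < k} \<union> {{U i, W i} | i. i < k}"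
  have lad: "edges (ladder (2 * k)) = {{i, Suc i mod k} | i. i < k} \<union>
      {{k + i, k + Suc i mod k} | i. i < k} \<union> {{i, k + i} | i. i < k}" "verts (ladder (2 * k)) = {..<2 * k}"
    by (simp_all add: ladder_def)
  have img: "(\<lambda>e. T ` e) ` {f i | i. i < k} = {T ` f i | i. i < k}" for f by auto
  have "(\<lambda>e. T ` e) ` edges (ladder (2 * k)) = {T ` {i, Suc i mod k} | i. i < k} \<union>
      {T ` {k + i, k + Suc i mod k} | i. i < k} \<union> {T ` {i, k + i} | i. i < k}"
    unfolding lad image_Un img ..
  also have "\<dots> = ?E"
  proof -
    have setc: "{f i | i. i < k} = {g i | i. i < k}" if "\<And>i. i < k \<Longrightarrow> f i = g i" for f g :: "nat \<Rightarrow> 'a set"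
      by (intro Collect_cong ex_cong1) (auto simp: that)
    have "T ` {i, Suc i mod k} = {U i, U (Suc i)}" "T ` {k + i, k + Suc i mod k} = {W i, W (Suc i)}"
      "T ` {i, k + i} = {U i, W i}" if "i < k" for i
      using that k Umod[OF that] by (auto simp: T_def)
    then show ?thesis by (intro arg_cong2[where f = "(\<union>)"] setc)
  qed
  also have "?E = edges G"
  proof
    show "?E \<subseteq> edges G" using adj by auto
    show "edges G \<subseteq> ?E"
    proof
      fix e assume e: "e \<in> edges G"
      then obtain u v where uv: "e = {u, v}" "u \<in> verts G" using simple_graph_edge[OF sg] by metis
      then have uv': "gadj G u v" using e by simp
      obtain i where i: "i < k" "u = U i \<or> u = W i" using uv(2) V by blast
      define j where "j = (if i = 0 then k - 1 else i - 1)"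
      have j: "j < k" "U (Suc j) = U i" "W (Suc j) = W i" using i k cl by (auto simp: j_def)
      have ne: "Suc i mod k \<noteq> j" "Suc i mod k < k" using i k by (auto simp: j_def mod_Suc)
      have d1: "distinct [U (Suc i), W i, U j]"
        using ne i(1) j(1) UW[of "Suc i mod k" i] UW[of j i] inj_on_eq_iff[OF injU, of "Suc i mod k" j] Umod[OF i(1)]
        by auto
      have d2: "distinct [W (Suc i), U i, W j]"
        using ne i(1) j(1) UW[of i "Suc i mod k"] UW[of i j] inj_on_eq_iff[OF injW, of "Suc i mod k" j] Umod[OF i(1)]
        by auto
      from i(2) show "e \<in> ?E"
      proof
        assume u: "u = U i"
        have "{w. gadj G (U i) w} = {U (Suc i), W i, U j}"
          by (rule card3_eq[OF deg3 _ d1]) (use u uv(2) adj[of i] adj(1)[of j] j adj_sym in auto)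
        then have "v = U (Suc i) \<or> v = W i \<or> v = U j" using uv' u by blast
        moreover have "{U i, U j} = {U j, U (Suc j)}" using j by auto
        ultimately show ?thesis using uv(1) u i(1) j(1) by auto
      next
        assume u: "u = W i"
        have "{w. gadj G (W i) w} = {W (Suc i), U i, W j}"
          by (rule card3_eq[OF deg3 _ d2]) (use u uv(2) adj[of i] adj(2)[of j] j adj_sym in auto)
        then have "v = W (Suc i) \<or> v = U i \<or> v = W j" using uv' u by blast
        moreover have "{W i, W j} = {W j, W (Suc j)}" "{W i, U i} = {U i, W i}" using j by auto
        ultimately show ?thesis using uv(1) u i(1) j(1) by auto
      qed
    qed
  qed
  finally have "graph_iso (ladder (2 * k)) G" unfolding graph_iso_def using bij lad(2) by metis
  moreover have "e \<subseteq> verts (ladder (2 * k))" if "e \<in> edges (ladder (2 * k))" for e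
    using that k unfolding lad by (auto simp: mult_2) (meson less_le_trans mod_less_divisor le_add1 zero_less_numeral order_less_le_trans)+
  ultimately show ?thesis by (rule graph_iso_sym)
qed

lemma cycle_edges_map: "cycle_edges (map g xs) = (`) g ` cycle_edges xs"
proof (cases xs)
  case (Cons x ys)
  have "cycle_edges (map g xs) = ledges (map g (x # ys @ [x]))"
    unfolding Cons by (simp add: cycle_edges_Cons)
  then show ?thesis unfolding Cons cycle_edges_Cons ledges_map .
qed simp

text \<open>By induction only an isomorphic copy \<open>K\<close> of \<open>G'\<close> on the
  naturals is at hand. The bridging is repeated in \<open>K\<close> with fresh naturals
  \<open>x'\<close>, \<open>y'\<close>, and the isomorphism is extended by \<open>x\<close> to
  \<open>x'\<close> and \<open>y\<close> to \<open>y'\<close>. The two conditions \<open>no\<close>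
  exclude both ways of completing the edges to a 4-cycle.\<close>

lemma bridging_iso_step:
  fixes G' :: "'a ugraph" and K :: "nat ugraph"
  assumes sg: "simple_graph G'" and c: "cyc4_adj (verts G') (gadj G')" and iso: "G' \<cong>\<^sub>G K"
    and ab: "{a, b} \<in> edges G'" and ce: "{c, e} \<in> edges G'" and dist: "distinct [a, b, c, e]"
    and no: "\<not> ({a, c} \<in> edges G' \<and> {b, e} \<in> edges G')" "\<not> ({a, e} \<in> edges G' \<and> {b, c} \<in> edges G')"
    and xy: "x \<notin> verts G'" "y \<notin> verts G'" "x \<noteq> y"
  shows "\<exists>H. bridging_step K H \<and> bridging G' a b c e x y \<cong>\<^sub>G H"
proof -
  obtain \<phi> where bij: "bij_betw \<phi> (verts G') (verts K)" and EK: "edges K = (\<lambda>f. \<phi> ` f) ` edges G'"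
    using iso unfolding graph_iso_def by blast
  have inj: "inj_on \<phi> (verts G')" and imV: "\<phi> ` verts G' = verts K" using bij by (auto simp: bij_betw_def)
  have sub: "f \<subseteq> verts G'" if "f \<in> edges G'" for f using sg that by (simp add: simple_graph_def)
  have abV: "a \<in> verts G'" "b \<in> verts G'" "c \<in> verts G'" "e \<in> verts G'" using sub[OF ab] sub[OF ce] by auto
  have inj_edge: "\<phi> ` f = \<phi> ` g \<longleftrightarrow> f = g" if "f \<subseteq> verts G'" "g \<subseteq> verts G'" for f g
    using inj_on_image_eq_iff[OF inj that] .
  have finK: "finite (verts K)" using sg imV by (metis finite_imageI simple_graph_def)
  obtain x' where x': "x' \<notin> verts K" using ex_new_if_finite[OF infinite_UNIV_nat finK] by blast
  obtain y' where y': "y' \<notin> insert x' (verts K)"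
    using ex_new_if_finite[OF infinite_UNIV_nat, of "insert x' (verts K)"] finK by auto
  define H where "H = bridging K (\<phi> a) (\<phi> b) (\<phi> c) (\<phi> e) x' y'"
  have edge: "{\<phi> u, \<phi> v} \<in> edges K \<longleftrightarrow> {u, v} \<in> edges G'" if "u \<in> verts G'" "v \<in> verts G'" for u v
  proof
    assume "{\<phi> u, \<phi> v} \<in> edges K"
    then obtain f where f: "f \<in> edges G'" "\<phi> ` {u, v} = \<phi> ` f" unfolding EK by auto
    then show "{u, v} \<in> edges G'" using inj_edge[of "{u, v}" f] that sub by auto
  next
    assume "{u, v} \<in> edges G'"
    then have "\<phi> ` {u, v} \<in> edges K" unfolding EK by (rule imageI)
    then show "{\<phi> u, \<phi> v} \<in> edges K" by simp
  qed
  have ne: "{a, b} \<noteq> {c, e}" using dist by (auto simp: doubleton_eq_iff)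
  obtain vs where vs: "is_cycle G' vs" "{a, b} \<in> cycle_edges vs" "{c, e} \<in> cycle_edges vs"
    using cycle_through_two_edges[OF c ab ce ne] .
  have "is_cycle K (map \<phi> vs)"
  proof -
    have v: "3 \<le> length vs" "distinct vs" "set vs \<subseteq> verts G'" "cycle_edges vs \<subseteq> edges G'"
      using vs(1) by (auto simp: is_cycle_def)
    have "distinct (map \<phi> vs)" using v inj inj_on_subset by (auto simp: distinct_map)
    moreover have "cycle_edges (map \<phi> vs) \<subseteq> edges K" unfolding cycle_edges_map EK using v(4) by (rule image_mono)
    moreover have "set (map \<phi> vs) \<subseteq> verts K" using v(3) imV by auto
    ultimately show ?thesis using v(1) by (simp add: is_cycle_def)
  qed
  moreover have "{\<phi> a, \<phi> b} \<in> cycle_edges (map \<phi> vs)" "{\<phi> c, \<phi> e} \<in> cycle_edges (map \<phi> vs)"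
  proof -
    have "\<phi> ` {a, b} \<in> cycle_edges (map \<phi> vs)" "\<phi> ` {c, e} \<in> cycle_edges (map \<phi> vs)"
      unfolding cycle_edges_map using vs(2,3) by blast+
    then show "{\<phi> a, \<phi> b} \<in> cycle_edges (map \<phi> vs)" "{\<phi> c, \<phi> e} \<in> cycle_edges (map \<phi> vs)" by simp_all
  qed
  moreover have d: "\<phi> a \<noteq> \<phi> c" "\<phi> a \<noteq> \<phi> e" "\<phi> b \<noteq> \<phi> c" "\<phi> b \<noteq> \<phi> e"
    using dist abV inj_on_eq_iff[OF inj] by auto
  then have "{\<phi> a, \<phi> b} \<inter> {\<phi> c, \<phi> e} = {}" by auto
  moreover have False
    if q: "{\<phi> a, \<phi> b} = {p, s}" "{\<phi> c, \<phi> e} = {q, r}" "{p, q} \<in> edges K" "{r, s} \<in> edges K" for p q r s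
  proof -
    have no': "\<not> ({\<phi> a, \<phi> c} \<in> edges K \<and> {\<phi> b, \<phi> e} \<in> edges K)"
      "\<not> ({\<phi> a, \<phi> e} \<in> edges K \<and> {\<phi> b, \<phi> c} \<in> edges K)"
      using no edge abV by simp_all
    from q(1,2) have "p = \<phi> a \<and> s = \<phi> b \<or> p = \<phi> b \<and> s = \<phi> a" "q = \<phi> c \<and> r = \<phi> e \<or> q = \<phi> e \<and> r = \<phi> c"
      by (auto simp: doubleton_eq_iff)
    then show False using no' q(3,4) by (elim disjE) (simp_all add: insert_commute)
  qed
  ultimately have spread: "cycle_spread_at_least K {\<phi> a, \<phi> b} {\<phi> c, \<phi> e} (1, 2)"
    by (rule cycle_spread_at_least_1_2)
  have "bridging_step K H"
    unfolding bridging_step_def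
  proof (intro exI conjI)
    show "{\<phi> a, \<phi> b} \<in> edges K" "{\<phi> c, \<phi> e} \<in> edges K" using edge abV ab ce by auto
    show "{\<phi> a, \<phi> b} \<noteq> {\<phi> c, \<phi> e}" using d by (auto simp: doubleton_eq_iff)
    show "H = bridging K (\<phi> a) (\<phi> b) (\<phi> c) (\<phi> e) x' y'" by (rule H_def)
  qed (use spread x' y' in auto)
  moreover have "bridging G' a b c e x y \<cong>\<^sub>G H"
  proof -
    define \<psi> where "\<psi> = \<phi>(x := x', y := y')"
    have psi: "\<psi> v = \<phi> v" if "v \<in> verts G'" for v using that xy by (auto simp: \<psi>_def)
    have psi': "\<psi> x = x'" "\<psi> y = y'" using xy by (simp_all add: \<psi>_def)
    have b1: "bij_betw \<psi> (verts G') (verts K)" using bij psi bij_betw_cong[of "verts G'" \<psi> \<phi>] by simp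
    have b2: "bij_betw \<psi> {x, y} {x', y'}" using psi' y' xy(3) by (auto simp: bij_betw_def)
    have "bij_betw \<psi> (verts G' \<union> {x, y}) (verts K \<union> {x', y'})"
      using bij_betw_combine[OF b1 b2] x' y' by auto
    moreover have "edges H = (\<lambda>f. \<psi> ` f) ` edges (bridging G' a b c e x y)"
    proof -
      have im: "\<psi> ` f = \<phi> ` f" if "f \<in> edges G'" for f using sub[OF that] psi by (intro image_cong) auto
      have "(\<lambda>f. \<psi> ` f) ` (edges G' - {{a, b}, {c, e}}) = (\<lambda>f. \<phi> ` f) ` (edges G' - {{a, b}, {c, e}})"
        by (rule image_cong[OF refl]) (rule im, blast)
      also have "\<dots> = edges K - {{\<phi> a, \<phi> b}, {\<phi> c, \<phi> e}}"
      proof -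
        have "inj_on (\<lambda>f. \<phi> ` f) (edges G')" using inj_edge sub by (intro inj_onI) blast
        then have "(\<lambda>f. \<phi> ` f) ` (edges G' - {{a, b}, {c, e}}) =
            (\<lambda>f. \<phi> ` f) ` edges G' - (\<lambda>f. \<phi> ` f) ` {{a, b}, {c, e}}"
          using ab ce by (intro inj_on_image_set_diff[of _ "edges G'"]) auto
        then show ?thesis by (simp add: EK)
      qed
      finally have 1: "(\<lambda>f. \<psi> ` f) ` (edges G' - {{a, b}, {c, e}}) = edges K - {{\<phi> a, \<phi> b}, {\<phi> c, \<phi> e}}" .
      have 2: "(\<lambda>f. \<psi> ` f) ` {{a, x}, {x, b}, {c, y}, {y, e}, {x, y}} =
          {{\<phi> a, x'}, {x', \<phi> b}, {\<phi> c, y'}, {y', \<phi> e}, {x', y'}}"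
        using psi psi' abV by simp
      show ?thesis unfolding H_def bridging_def ugraph.sel image_Un 1 2 ..
    qed
    ultimately show ?thesis unfolding graph_iso_def H_def bridging_def ugraph.sel by blast
  qed
  ultimately show ?thesis by blast
qed

lemma reduction_exists:
  assumes sg: "simple_graph G" and pl: "planar G" and c: "cyc4_adj8 (verts G) (gadj G)"
    and g: "cubic_adj.good (verts G) (gadj G) x y"
  obtains G' a b c e where "simple_graph G'" "planar G'" "cyc4_adj8 (verts G') (gadj G')"
    "card (verts G') < card (verts G)" "G = bridging G' a b c e x y"
    "{a, b} \<in> edges G'" "{c, e} \<in> edges G'" "distinct [a, b, c, e]"
    "\<not> ({a, c} \<in> edges G' \<and> {b, e} \<in> edges G')" "\<not> ({a, e} \<in> edges G' \<and> {b, c} \<in> edges G')"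
    "x \<notin> verts G'" "y \<notin> verts G'" "x \<noteq> y"
proof -
  interpret cyc4_adj8 "verts G" "gadj G" by fact
  obtain a b c e where Nx: "{w. gadj G x w} = {y, a, b}" and Ny: "{w. gadj G y w} = {x, c, e}"
    and dist: "distinct [x, y, a, b, c, e]" and rem: "removable x y"
    and no: "\<not> (gadj G a c \<and> gadj G b e)" "\<not> (gadj G a e \<and> gadj G b c)"
    using good_nbrs[OF g] .
  define E0 where "E0 = {f \<in> edges G. x \<notin> f \<and> y \<notin> f}"
  define G' where "G' = UGraph (verts G - {x, y}) (E0 \<union> {{a, b}, {c, e}})"
  have Ax: "gadj G x w \<longleftrightarrow> w \<in> {y, a, b}" for w using Nx by blast
  have Ay: "gadj G y w \<longleftrightarrow> w \<in> {x, c, e}" for w using Ny by blast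
  have ed: "{x, y} \<in> edges G" "{a, x} \<in> edges G" "{b, x} \<in> edges G" "{c, y} \<in> edges G" "{e, y} \<in> edges G"
    using Ax[of y] Ax[of a] Ax[of b] Ay[of c] Ay[of e] by (simp_all add: insert_commute)
  have inV: "x \<in> verts G" "y \<in> verts G" "a \<in> verts G" "b \<in> verts G" "c \<in> verts G" "e \<in> verts G"
    using ed gadj_verts[OF sg] by blast+
  have nab: "\<not> gadj G a b" "\<not> gadj G c e"
    using no_triangle[of a b x] no_triangle[of c e y] ed by (auto simp: insert_commute)
  have E: "edges G = E0 \<union> {{a, x}, {x, b}, {c, y}, {y, e}, {x, y}}"
  proof
    show "edges G \<subseteq> E0 \<union> {{a, x}, {x, b}, {c, y}, {y, e}, {x, y}}"
    proof
      fix f assume f: "f \<in> edges G"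
      obtain u v where uv: "f = {u, v}" using simple_graph_edge[OF sg f] .
      consider "x \<notin> f \<and> y \<notin> f" | w where "f = {x, w}" | w where "f = {y, w}" using uv by blast
      then show "f \<in> E0 \<union> {{a, x}, {x, b}, {c, y}, {y, e}, {x, y}}"
      proof cases
        case 1
        then show ?thesis using f by (simp add: E0_def)
      next
        case (2 w)
        then show ?thesis using Ax[of w] f by (auto simp: insert_commute)
      next
        case (3 w)
        then show ?thesis using Ay[of w] f by (auto simp: insert_commute)
      qed
    qed
    show "E0 \<union> {{a, x}, {x, b}, {c, y}, {y, e}, {x, y}} \<subseteq> edges G"
      using ed by (auto simp: E0_def insert_commute)
  qed
  have sg': "simple_graph G'"
    using sg dist inV unfolding simple_graph_def G'_def E0_def by auto
  have adj': "gadj G' = suppress_adj (gadj G) x y a b c e"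
    by (intro ext) (auto simp: G'_def E0_def suppress_adj_def)
  have c4: "cyc4_adj (verts G') (gadj G')"
    unfolding adj' using cyc4_adj_suppress[OF rem Nx Ny dist] by (simp add: G'_def)
  have pl': "planar G'"
  proof -
    \<comment> \<open>The intermediate graph with only \<open>x\<close> suppressed. The edge
      \<open>xy\<close> disappears with \<open>x\<close>, so that \<open>y\<close> has just
      \<open>c\<close> and \<open>e\<close> left and can be suppressed in the same way.\<close>
    define E1 where "E1 = insert {a, b} {f \<in> edges G. x \<notin> f}"
    have 1: "planar (UGraph (verts G - {x}) E1)"
      by (rule planar_suppress[OF pl ed(2,3)]) (use dist in \<open>auto simp: E1_def\<close>)
    have 2: "{c, y} \<in> E1" "{e, y} \<in> E1" using ed(4,5) dist by (simp_all add: E1_def)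
    have 3: "E0 \<union> {{a, b}, {c, e}} \<subseteq> insert {c, e} {f \<in> E1. y \<notin> f}"
      using dist unfolding E0_def E1_def by simp blast
    have "planar (UGraph (verts G - {x, y}) (E0 \<union> {{a, b}, {c, e}}))"
    proof (rule planar_suppress[OF 1])
      show "{c, y} \<in> edges (UGraph (verts G - {x}) E1)" "{e, y} \<in> edges (UGraph (verts G - {x}) E1)"
        using 2 by simp_all
      show "c \<noteq> e" "c \<noteq> y" "e \<noteq> y" using dist by auto
      show "verts G - {x, y} \<subseteq> verts (UGraph (verts G - {x}) E1) - {y}" by auto
      show "E0 \<union> {{a, b}, {c, e}} \<subseteq> insert {c, e} {f \<in> edges (UGraph (verts G - {x}) E1). y \<notin> f}"
        using 3 by simp
    qed
    then show ?thesis by (simp add: G'_def)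
  qed
  have cV: "card (verts G') = card (verts G) - 2"
    using inV dist by (simp add: G'_def card_Diff_subset)
  \<comment> \<open>The whole vertex set has an empty cut, so its size is even. The reduced graph
    then has an even number of vertices, at least six but not six.\<close>
  have ev: "even (card (verts G))" using even_cut_size[of "verts G"] by (simp add: cut_size_def)
  have "card (verts G') \<noteq> 6" using cyc4_adj_6_not_planar[OF c4 sg'] pl' by blast
  then have c8: "8 \<le> card (verts G')" using cV ev card8 by presburger
  have c4': "cyc4_adj8 (verts G') (gadj G')"
    using c4 c8 by (simp add: cyc4_adj8_def cyc4_adj8_axioms_def)
  have br: "G = bridging G' a b c e x y"
  proof -
    have "E0 \<union> {{a, b}, {c, e}} - {{a, b}, {c, e}} = E0" using nab by (auto simp: E0_def)
    moreover have "verts G - {x, y} \<union> {x, y} = verts G" using inV by auto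
    ultimately show ?thesis unfolding bridging_def G'_def ugraph.sel using E by (cases G) simp
  qed
  have d: "distinct [a, b, c, e]" "x \<noteq> y" using dist by simp_all
  have lt: "card (verts G') < card (verts G)" using cV card8 by simp
  have ne: "{u, v} \<in> edges G' \<longleftrightarrow> {u, v} \<in> edges G" if "u \<in> {a, b}" "v \<in> {c, e}" for u v
    using that dist by (auto simp: G'_def E0_def doubleton_eq_iff)
  have no': "\<not> ({a, c} \<in> edges G' \<and> {b, e} \<in> edges G')" "\<not> ({a, e} \<in> edges G' \<and> {b, c} \<in> edges G')"
    using no ne by simp_all
  have ends: "{a, b} \<in> edges G'" "{c, e} \<in> edges G'" "x \<notin> verts G'" "y \<notin> verts G'"
    by (simp_all add: G'_def)
  show ?thesis by (rule that[OF sg' pl' c4' lt br ends(1,2) d(1) no' ends(3,4) d(2)])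
qed

lemma no_good_ladder:
  assumes sg: "simple_graph G" and pl: "planar G" and c: "cyc4_adj8 (verts G) (gadj G)"
    and ng: "\<And>x y. \<not> cubic_adj.good (verts G) (gadj G) x y"
  obtains k where "4 \<le> k" "G \<cong>\<^sub>G ladder (2 * k)"
proof -
  interpret cyc4_adj8 "verts G" "gadj G" by fact
  obtain p q r s where sq: "square p q r s" using good_of_no_square ng by blast
  obtain U W where st: "strip U W" using strip_exists[OF sq ng] .
  obtain k where k: "closed_strip k U W" "U k = U 0 \<and> W k = W 0 \<or> U k = W 0 \<and> W k = U 0"
    using strip_closes[OF st] .
  have "\<not> (U k = W 0 \<and> W k = U 0)"
    using moebius_not_planar[OF pl sg, of k U W] k(1) unfolding closed_strip_def by auto
  then show ?thesis
    using that closed_strip_ladder[OF sg c k(1)] k unfolding closed_strip_def by blast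
qed

text \<open>Phrased with the cut condition because this is what \<open>reduction_exists\<close>
  hands back; the induction is on the number of vertices.\<close>

lemma generated_from_ladder:
  fixes G :: "'a ugraph"
  assumes "simple_graph G" "planar G" "cyc4_adj8 (verts G) (gadj G)"
  shows "\<exists>k\<ge>4. \<exists>H :: nat ugraph. bridging_step\<^sup>*\<^sup>* (ladder (2 * k)) H \<and> G \<cong>\<^sub>G H"
  using assms
proof (induction "card (verts G)" arbitrary: G rule: less_induct)
  case less
  show ?case
  proof (cases "\<exists>x y. cubic_adj.good (verts G) (gadj G) x y")
    case False
    then obtain k where "4 \<le> k" "G \<cong>\<^sub>G ladder (2 * k)" using no_good_ladder[OF less.prems] by blast
    then show ?thesis by blast
  next
    case True
    then obtain x y where "cubic_adj.good (verts G) (gadj G) x y" by blast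
    then obtain G' a b c e where r: "simple_graph G'" "planar G'" "cyc4_adj8 (verts G') (gadj G')"
      "card (verts G') < card (verts G)" "G = bridging G' a b c e x y"
      "{a, b} \<in> edges G'" "{c, e} \<in> edges G'" "distinct [a, b, c, e]"
      "\<not> ({a, c} \<in> edges G' \<and> {b, e} \<in> edges G')" "\<not> ({a, e} \<in> edges G' \<and> {b, c} \<in> edges G')"
      "x \<notin> verts G'" "y \<notin> verts G'" "x \<noteq> y"
      by (rule reduction_exists[OF less.prems])
    obtain k K where k: "4 \<le> k" "bridging_step\<^sup>*\<^sup>* (ladder (2 * k)) K" "G' \<cong>\<^sub>G K"
      using less.hyps[OF r(4,1,2,3)] by blast
    have "cyc4_adj (verts G') (gadj G')" using r(3) by (simp add: cyc4_adj8_def)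
    then obtain H where "bridging_step K H" "G \<cong>\<^sub>G H"
      using bridging_iso_step[OF r(1) _ k(3) r(6-13)] r(5) by metis
    then show ?thesis using k(1,2) rtranclp.rtrancl_into_rtrancl by metis
  qed
qed

theorem theorem4p3:
  fixes G :: "'a ugraph" and n :: nat
  assumes "simple_graph G"
    and "planar G"
    and "cyclically_4_connected G"
    and "card (verts G) = n"
    and "n \<ge> 8"
    and "even n"
    and "\<not> G \<cong>\<^sub>G ladder n"
  shows "\<exists>k\<ge>4. \<exists>H :: nat ugraph. bridging_step\<^sup>*\<^sup>* (ladder (2 * k)) H \<and> G \<cong>\<^sub>G H"
  using generated_from_ladder[OF assms(1,2) cyc4_adj8_if_cyclically_4_connected[OF assms(1,3)]] .

end
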